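(* Let $\lambda<1$ with $\lambda\neq 7/8$. Then, for every $t>0$ and every nonnegative, not identically zero, bounded continuous function $\phi:\mathbb R\to\mathbb R$, $$\lim_{N\to\infty}\operatorname{Var}\big(\mathcal Y_{\lambda,N}(t,\phi)\big)=\begin{cases}0&\text{if }\lambda<7/8,\\ \infty&\text{if }\lambda>7/8,\end{cases}$$ where the variance is taken with respect to the law of the Poisson clocks.
   Context: Averaging process on $\mathbb Z$: attach to every bond $\{x,x+1\}$, $x\in\mathbb Z$, an independent Poisson clock of rate one. The state at time $t$ is a mass profile $\eta_t=(\eta_t(x))_{x\in\mathbb Z}\in[0,\infty)^{\mathbb Z}$; when the clock of $\{x,x+1\}$ rings, both $\eta(x)$ and $\eta(x+1)$ are replaced by $\frac12(\eta(x)+\eta(x+1))$, all other coordinates being unchanged. The initial condition is $\eta_0(x)=\mathbf 1_{\{x=0\}}$. For $\lambda\le 1$ and $N\in\mathbb N=\{1,2,\dots\}$ set $\beta_{\lambda,N}=\operatorname{arcsinh}(N^{\lambda-1})$, $$\vartheta_{\lambda,N}(t,x)=\exp\{\beta_{\lambda,N}x-tN(\cosh(\beta_{\lambda,N})-1)\},\qquad t\ge0,\ x\in\mathbb Z,$$ and $$\mathcal Y_{\lambda,N}(t,\phi)=\sum_{x\in\mathbb Z}\vartheta_{\lambda,N}(t,x)\,\eta_{tN}(x)\,\phi\big(N^{-1/2}(x-tN^\lambda)\big).$$ *)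

theory Defs
  imports "HOL-Probability.Probability"
begin

text \<open>
  A Poisson process of rate \<open>r\<close> on \<open>[0,\<infinity>)\<close>, given by its counting process. The increments are
  truncated differences of naturals; by the almost sure monotonicity of the paths these are
  almost surely the true differences.
\<close>

definition poisson_process :: "'w measure \<Rightarrow> real \<Rightarrow> (real \<Rightarrow> 'w \<Rightarrow> nat) \<Rightarrow> bool" where
  "poisson_process M r K \<longleftrightarrow>
     prob_space M \<and>
     (\<forall>t\<ge>0. K t \<in> measurable M (count_space UNIV)) \<and>
     (AE \<omega> in M. K 0 \<omega> = 0 \<and> mono_on {0..} (\<lambda>t. K t \<omega>) \<and>
        (\<forall>t\<ge>0. continuous (at_right t) (\<lambda>u. K u \<omega>))) \<and>
     (\<forall>s t. 0 \<le> s \<and> s < t \<longrightarrow>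
        distr M (count_space UNIV) (\<lambda>\<omega>. K t \<omega> - K s \<omega>) = measure_pmf (poisson_pmf (r * (t - s)))) \<and>
     (\<forall>\<tau> n. 0 \<le> \<tau> 0 \<and> incseq \<tau> \<longrightarrow>
        prob_space.indep_vars M (\<lambda>_. count_space UNIV)
          (\<lambda>i \<omega>. K (\<tau> (Suc i)) \<omega> - K (\<tau> i) \<omega>) {..<n::nat})"

text \<open>The bond \<open>{x, x + 1}\<close> is indexed by its left endpoint \<open>x\<close>.\<close>

definition poisson_clocks :: "'w measure \<Rightarrow> (int \<Rightarrow> real \<Rightarrow> 'w \<Rightarrow> nat) \<Rightarrow> bool" where
  "poisson_clocks M K \<longleftrightarrow>
     (\<forall>x. poisson_process M 1 (K x)) \<and>
     prob_space.indep_vars M (\<lambda>_. PiM {0..} (\<lambda>_. count_space UNIV))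
       (\<lambda>x \<omega>. \<lambda>t\<in>{0..}. K x t \<omega>) UNIV"

definition jump_times :: "(real \<Rightarrow> nat) \<Rightarrow> real set" where
  "jump_times k = {s. 0 < s \<and> (\<forall>u. 0 \<le> u \<and> u < s \<longrightarrow> k u < k s)}"

definition average_bond :: "int \<Rightarrow> (int \<Rightarrow> real) \<Rightarrow> int \<Rightarrow> real" where
  "average_bond x \<eta> = \<eta>(x := (\<eta> x + \<eta> (x + 1)) / 2, x + 1 := (\<eta> x + \<eta> (x + 1)) / 2)"

text \<open>
  A trajectory \<open>e\<close> driven by the sets \<open>R x\<close> of ring times of the bonds \<open>{x, x + 1}\<close>. Since
  infinitely many bonds ring in every time interval, constancy between rings has to be required
  coordinatewise: the mass at \<open>y\<close> is only affected by the bonds \<open>y - 1\<close> and \<open>y\<close> containing \<open>y\<close>.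
  For the Poisson clocks, almost surely no two bonds ring simultaneously and up to any given time
  the bonds that have not rung cut the line into finite blocks, so that the trajectory exists,
  is determined by \<open>R\<close> and its initial value, and has left limits.
\<close>

definition averaging_path :: "(int \<Rightarrow> real set) \<Rightarrow> (real \<Rightarrow> int \<Rightarrow> real) \<Rightarrow> bool" where
  "averaging_path R e \<longleftrightarrow>
     (\<forall>t\<ge>0. \<forall>y. 0 \<le> e t y) \<and>
     (\<forall>s t y. 0 \<le> s \<and> s \<le> t \<and> {s<..t} \<inter> (R (y - 1) \<union> R y) = {} \<longrightarrow> e t y = e s y) \<and>
     (\<forall>x. \<forall>s\<in>R x. e s = average_bond x (\<lambda>y. Lim (at_left s) (\<lambda>u. e u y)))"

definition averaging_process ::
    "'w measure \<Rightarrow> (int \<Rightarrow> real \<Rightarrow> 'w \<Rightarrow> nat) \<Rightarrow> (int \<Rightarrow> real) \<Rightarrow> (real \<Rightarrow> int \<Rightarrow> 'w \<Rightarrow> real) \<Rightarrow> bool" where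
  "averaging_process M K \<eta>0 \<eta> \<longleftrightarrow>
     poisson_clocks M K \<and>
     (\<forall>t\<ge>0. \<forall>x. \<eta> t x \<in> borel_measurable M) \<and>
     (AE \<omega> in M. (\<forall>x. \<eta> 0 x \<omega> = \<eta>0 x) \<and>
        averaging_path (\<lambda>x. jump_times (\<lambda>t. K x t \<omega>)) (\<lambda>t x. \<eta> t x \<omega>))"

definition beta :: "real \<Rightarrow> nat \<Rightarrow> real" where
  "beta lam N = arsinh (real N powr (lam - 1))"

definition vartheta :: "real \<Rightarrow> nat \<Rightarrow> real \<Rightarrow> int \<Rightarrow> real" where
  "vartheta lam N t x =
     exp (beta lam N * of_int x - t * real N * (cosh (beta lam N) - 1))"

text \<open>
  The sum below has almost surely only finitely many nonzero terms when \<open>\<eta>\<close> is the averaging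
  process started from a unit mass at \<open>0\<close>, so the value of \<open>infsum\<close> on non-summable families
  plays no role.
\<close>

definition tilted_field ::
    "(real \<Rightarrow> int \<Rightarrow> 'w \<Rightarrow> real) \<Rightarrow> real \<Rightarrow> nat \<Rightarrow> real \<Rightarrow> (real \<Rightarrow> real) \<Rightarrow> 'w \<Rightarrow> real" where
  "tilted_field \<eta> lam N t \<phi> \<omega> =
     (\<Sum>\<^sub>\<infinity>x\<in>UNIV. vartheta lam N t x * \<eta> (t * real N) x \<omega>
        * \<phi> (real N powr (-1/2) * (of_int x - t * real N powr lam)))"

end

theory Submission
  imports Defs "HOL-Real_Asymp.Real_Asymp"
begin

text \<open>
  The two-point function \<open>E[\<eta>\<^sub>s(x) \<eta>\<^sub>s(y)]\<close> solves a closed linear equation: two walkers of jump rate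
  one half in each direction, with an additional term built from the mixed second difference on the
  diagonal. Under the exponential tilt the gap between the walkers feels an attractive pinning at
  zero whose strength is of order \<open>(cosh \<beta> - 1)\<^sup>2 \<approx> \<beta>\<^sup>4 / 4\<close>, so that the tilted second moment of the
  total mass grows like \<open>exp (c \<beta>\<^sup>8 s)\<close>. At \<open>s = t N\<close> and \<open>\<beta> \<approx> N powr (lam - 1)\<close> the exponent is
  of order \<open>N powr (8 lam - 7)\<close>, which is why \<open>7/8\<close> is critical. The growth rate is read off from
  the gap weight \<open>\<mu> ^ \<bar>z\<bar>\<close>, corrected at \<open>z = 0\<close>.

  Below the threshold, \<open>\<mu> = 1 - N powr (-1/2)\<close> shows that the second moment of the total mass tends to
  one. For a Lipschitz test function the variance is the time integral of the interaction term
  along the backward heat flow, which involves only this mass and the squared lattice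
  gradient. A general test function is bounded below by a Lipschitz function that is close to it
  on a compact set; the tail is handled by the first two moments of the tilted walk.

  Above the threshold, the second moment of the field increases along the backward heat flow, so
  it is enough to bound it at a time \<open>s\<close> much smaller than \<open>N\<close> for which \<open>\<beta>\<^sup>8 s\<close> is still a
  positive power of \<open>N\<close>. At that time the mass is concentrated in a window of width \<open>N powr (1/2)\<close>
  around its drift, where the heat flow of the test function is at least of order \<open>N powr (-2)\<close>; this
  polynomial loss does not matter against the stretched exponential growth.
\<close>

section \<open>Counting paths and averaging trajectories\<close>

text \<open>The exponent 8 comes from one balance. Put a = 1 - \<mu>. To leading order the potential
  left at gap zero is 2 (cosh \<beta> - 1)^2 - 2 a, and the growth rate of the gap weight is a^2.
  The potential changes sign at a of order \<beta>^4, so the rate at the balance is of order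
  \<beta>^8. With a = N^(-1/2) the growth over time t N stays bounded, and the potential is
  repulsive as soon as \<beta>^4 is at most of order N^(-1/2); this is the condition on lam.

  Infinitely many bonds ring in every time interval, so the equation of the two-point function is
  derived from a finite chain of independent updates in a box. Two silent bonds shield a block of
  the box from everything outside, and the error vanishes as the box grows and the mesh is refined.
  The two-point function then decays faster than any exponential, which makes the pairing with
  exponential tilts legitimate.

  First moments are treated as two-point sums against a function of one variable. Since the total
  mass is one, a single evolution equation provides both moments.\<close>

definition regular_count :: "(real \<Rightarrow> nat) \<Rightarrow> bool" where
  "regular_count k \<longleftrightarrow> k 0 = 0 \<and> mono_on {0..} k \<and> (\<forall>t\<ge>0. continuous (at_right t) k)"

lemma regular_count_mono: "regular_count k \<Longrightarrow> 0 \<le> s \<Longrightarrow> s \<le> t \<Longrightarrow> k s \<le> k t"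
  unfolding regular_count_def mono_on_def by auto

lemma jump_timesD: "u \<in> jump_times k \<Longrightarrow> 0 \<le> v \<Longrightarrow> v < u \<Longrightarrow> k v < k u"
  by (auto simp: jump_times_def)

lemma regular_count_eventually_const:
  assumes "regular_count k" "0 \<le> s"
  shows "eventually (\<lambda>u. k u = k s) (at_right s)"
proof -
  have "((\<lambda>u. k u) \<longlongrightarrow> k s) (at_right s)"
    using assms by (simp add: regular_count_def continuous_within)
  then show ?thesis by (simp add: tendsto_discrete)
qed

text \<open>Take the supremum v of the times at which the count still equals \<open>k s\<close>.
  Right continuity forces \<open>k v\<close> to differ from \<open>k s\<close>, while every earlier
  value is at most \<open>k s\<close>; hence v is a jump time in the strict sense of
  \<open>jump_times\<close>.\<close>

lemma jump_time_exists:
  assumes k: "regular_count k" and st: "0 \<le> s" "s \<le> t" and ne: "k s \<noteq> k t"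
  obtains u where "u \<in> jump_times k" "s < u" "u \<le> t"
proof -
  define S where "S = {u. s \<le> u \<and> k u = k s}"
  define v where "v = Sup S"
  have mono: "\<And>a b. 0 \<le> a \<Longrightarrow> a \<le> b \<Longrightarrow> k a \<le> k b" using regular_count_mono[OF k] by blast
  have lt: "k s < k t" using mono[OF st] ne by auto
  have le_t: "u < t" if "u \<in> S" for u
  proof (rule ccontr)
    assume "\<not> u < t"
    then have "k t \<le> k u" using st by (intro mono) auto
    then show False using that lt by (simp add: S_def)
  qed
  have bdd: "bdd_above S" using le_t by (meson bdd_above.I less_imp_le)
  have sS: "s \<in> S" by (simp add: S_def)
  have sv: "s \<le> v" unfolding v_def by (rule cSup_upper[OF sS bdd])
  have vt: "v \<le> t" unfolding v_def using sS le_t by (intro cSup_least) (auto intro: less_imp_le)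
  have below: "k u = k s" if u: "s \<le> u" "u < v" for u
  proof -
    have "\<exists>w\<in>S. u < w" using u(2) sS bdd less_cSup_iff[of S u] unfolding v_def by auto
    then obtain w where w: "w \<in> S" "u < w" by blast
    have "k s \<le> k u" "k u \<le> k w" using mono[of s u] mono[of u w] u w(2) st by auto
    then show ?thesis using w(1) by (simp add: S_def)
  qed
  have notin: "k v \<noteq> k s"
  proof
    assume "k v = k s"
    have "eventually (\<lambda>u. k u = k v) (at_right v)"
      using regular_count_eventually_const[OF k] sv st by auto
    then obtain b where b: "b > v" "\<And>y. v < y \<Longrightarrow> y < b \<Longrightarrow> k y = k v"
      unfolding eventually_at_right_field by auto
    have "(v+b)/2 \<in> S" using b(1) b(2)[of "(v+b)/2"] \<open>k v = k s\<close> sv by (auto simp: S_def)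
    then have "(v+b)/2 \<le> v" unfolding v_def using bdd by (rule cSup_upper)
    then show False using b(1) by simp
  qed
  then have gt: "k s < k v" using mono[of s v] st sv by (simp add: le_neq_implies_less)
  have sv': "s < v" using sv notin by (cases "s = v") auto
  have "v \<in> jump_times k"
    unfolding jump_times_def
  proof (intro CollectI conjI allI impI)
    show "0 < v" using sv' st by simp
    fix u assume u: "0 \<le> u \<and> u < v"
    show "k u < k v"
    proof (cases "s \<le> u")
      case True then show ?thesis using below[of u] u gt by simp
    next
      case False then show ?thesis using mono[of u s] u gt by simp
    qed
  qed
  then show ?thesis using that sv' vt by blast
qed

lemma no_jump_times:
  assumes k: "regular_count k" and st: "0 \<le> s" and eq: "k t = k s"
  shows "{s<..t} \<inter> jump_times k = {}"
proof (rule ccontr)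
  assume "\<not> ?thesis"
  then obtain u where u: "s < u" "u \<le> t" "u \<in> jump_times k" by auto
  have "k s < k u" using jump_timesD[OF u(3) st u(1)] .
  also have "k u \<le> k t" using regular_count_mono[OF k, of u t] u st by auto
  finally show False using eq by simp
qed

text \<open>There is room for one unit step only: at a jump time in the interval the count exceeds
  \<open>k s\<close>, and it cannot exceed \<open>Suc (k s)\<close>.\<close>

lemma jump_time_unique:
  assumes k: "regular_count k" and st: "0 \<le> s" and eq: "k t \<le> Suc (k s)"
    and u: "u \<in> jump_times k" "s < u" "u \<le> t"
  shows "k u = k t" "\<And>v. s \<le> v \<Longrightarrow> v < u \<Longrightarrow> k v = k s"
proof -
  have 1: "k s < k u" using jump_timesD[OF u(1) st u(2)] .
  have 2: "k u \<le> k t" using regular_count_mono[OF k, of u t] u st by auto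
  show "k u = k t" using 1 2 eq by simp
  fix v assume v: "s \<le> v" "v < u"
  show "k v = k s"
    using regular_count_mono[OF k, of s v] jump_timesD[OF u(1), of v] v st 1 2 eq by auto
qed

lemma average_bond_apply:
  "average_bond b \<eta> x = (if x = b \<or> x = b + 1 then (\<eta> b + \<eta> (b + 1)) / 2 else \<eta> x)"
  by (auto simp: average_bond_def)

locale averaging_trajectory =
  fixes k :: "int \<Rightarrow> real \<Rightarrow> nat" and e :: "real \<Rightarrow> int \<Rightarrow> real"
  assumes regular: "\<And>x. regular_count (k x)"
    and path: "averaging_path (\<lambda>x. jump_times (k x)) e"
begin

lemma constant_without_rings:
  assumes "0 \<le> s" "s \<le> t" "k (y - 1) t = k (y - 1) s" "k y t = k y s"
  shows "e t y = e s y"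
proof -
  have "{s<..t} \<inter> (jump_times (k (y - 1)) \<union> jump_times (k y)) = {}"
    using no_jump_times[OF regular assms(1,3)] no_jump_times[OF regular assms(1,4)]
    by (simp add: Int_Un_distrib)
  moreover have "\<forall>s t y. 0 \<le> s \<and> s \<le> t \<and>
      {s<..t} \<inter> (jump_times (k (y - 1)) \<union> jump_times (k y)) = {} \<longrightarrow> e t y = e s y"
    using path by (simp add: averaging_path_def)
  ultimately show ?thesis using assms(1,2) by simp
qed

text \<open>Up to the only ring u of \<open>b\<close> no bond of the window has rung, so the left
  limits at u are the values at s; after u nothing in the window changes. The site l is excluded
  because the mass at y depends on the bonds y - 1 and y.\<close>

lemma single_ring:
  assumes st: "0 \<le> s" "s \<le> t" and b: "l < b" "b < r" "k b t = Suc (k b s)"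
    and other: "\<And>x. l \<le> x \<Longrightarrow> x \<le> r \<Longrightarrow> x \<noteq> b \<Longrightarrow> k x t = k x s"
    and y: "l < y" "y \<le> r"
  shows "e t y = average_bond b (e s) y"
proof -
  have other': "k x v = k x s" if "l \<le> x" "x \<le> r" "x \<noteq> b" "s \<le> v" "v \<le> t" for x v
    using other[OF that(1-3)] regular_count_mono[OF regular, of s v x]
      regular_count_mono[OF regular, of v t x] st that by auto
  have "k b s \<noteq> k b t" using b by simp
  from jump_time_exists[OF regular st this]
  obtain u where u: "u \<in> jump_times (k b)" "s < u" "u \<le> t" .
  have "k b t \<le> Suc (k b s)" using b(3) by simp
  note kbu = jump_time_unique(1)[OF regular st(1) this u]
    and below = jump_time_unique(2)[OF regular st(1) this u]
  have left: "e v z = e s z" if "l < z" "z \<le> r" "s \<le> v" "v < u" for z v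
  proof (rule constant_without_rings)
    show "k (z - 1) v = k (z - 1) s"
      using other'[of "z-1" v] below[of v] that u by (cases "z - 1 = b") auto
    show "k z v = k z s"
      using other'[of z v] below[of v] that u by (cases "z = b") auto
  qed (use st that in auto)
  have Lim: "Lim (at_left u) (\<lambda>v. e v z) = e s z" if "l < z" "z \<le> r" for z
  proof (rule tendsto_Lim)
    have "eventually (\<lambda>v. v \<in> {s<..<u}) (at_left u)"
      unfolding eventually_at_left_field using u(2) by (intro exI[of _ s]) auto
    then have "eventually (\<lambda>v. e v z = e s z) (at_left u)"
      by eventually_elim (rule left[OF that], simp_all)
    then show "((\<lambda>v. e v z) \<longlongrightarrow> e s z) (at_left u)"
      by (rule tendsto_eventually)
  qed simp
  have "e u y = average_bond b (\<lambda>y. Lim (at_left u) (\<lambda>v. e v y)) y"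
    using path u(1) unfolding averaging_path_def by simp
  also have "\<dots> = average_bond b (e s) y"
    using Lim[of b] Lim[of "b+1"] Lim[of y] b y by (auto simp: average_bond_apply)
  finally have "e u y = average_bond b (e s) y" .
  moreover have "e t y = e u y"
  proof (rule constant_without_rings)
    show "k (y - 1) t = k (y - 1) u"
      using other'[of "y-1" u] other[of "y-1"] kbu y u by (cases "y - 1 = b") auto
    show "k y t = k y u"
      using other'[of y u] other[of y] kbu y u by (cases "y = b") auto
  qed (use st u in auto)
  ultimately show ?thesis by simp
qed

end

section \<open>Chains of independent averaging steps\<close>

text \<open>The discrete surrogate for the process. Randomness enters only through the switches
  \<open>upd\<close>; once these are independent, expectations can be computed one update at a
  time.\<close>

primrec chain :: "(nat \<Rightarrow> int) \<Rightarrow> (nat \<Rightarrow> bool) \<Rightarrow> nat \<Rightarrow> int \<Rightarrow> real" where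
  "chain bd upd 0 = (\<lambda>x. if x = 0 then 1 else 0)"
| "chain bd upd (Suc q) = (if upd q then average_bond (bd q) (chain bd upd q) else chain bd upd q)"

lemma chain_no_update:
  assumes "a \<le> c" "\<And>q. a \<le> q \<Longrightarrow> q < c \<Longrightarrow> \<not> upd q"
  shows "chain bd upd c = chain bd upd a"
  using assms
proof (induction c)
  case (Suc c)
  then show ?case by (cases "a = Suc c") auto
qed simp

lemma chain_one_update:
  assumes q0: "a \<le> q0" "q0 < c" "upd q0"
    and "\<And>q. a \<le> q \<Longrightarrow> q < c \<Longrightarrow> q \<noteq> q0 \<Longrightarrow> \<not> upd q"
  shows "chain bd upd c = average_bond (bd q0) (chain bd upd a)"
proof -
  have "chain bd upd c = chain bd upd (Suc q0)"
    by (rule chain_no_update) (use assms in auto)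
  also have "\<dots> = average_bond (bd q0) (chain bd upd q0)" using q0 by simp
  also have "chain bd upd q0 = chain bd upd a"
    by (rule chain_no_update) (use assms in auto)
  finally show ?thesis .
qed

lemma average_bond_nonneg: "(\<And>x. 0 \<le> \<eta> x) \<Longrightarrow> 0 \<le> average_bond b \<eta> x"
  by (auto simp: average_bond_apply)

lemma sum_average_bond:
  assumes "finite F" "b \<in> F" "b + 1 \<in> F"
  shows "sum (average_bond b \<eta>) F = sum \<eta> F"
proof -
  have split: "sum f F = f b + f (b + 1) + sum f (F - {b, b + 1})" for f :: "int \<Rightarrow> real"
    using sum.subset_diff[of "{b, b + 1}" F f] assms by simp
  have "sum (average_bond b \<eta>) (F - {b, b + 1}) = sum \<eta> (F - {b, b + 1})"
    by (rule sum.cong) (auto simp: average_bond_apply)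
  then show ?thesis unfolding split[of "average_bond b \<eta>"] split[of \<eta>]
    by (simp add: average_bond_apply field_simps)
qed

lemma chain_nonneg: "0 \<le> chain bd upd q x"
  by (induction q arbitrary: x) (auto intro: average_bond_nonneg)

text \<open>Adding both ends of the updated bond to F can only increase the sum and makes averaging
  preserve it, so the induction runs over all finite sets at once.\<close>

lemma chain_sum_le:
  assumes "finite F"
  shows "sum (chain bd upd q) F \<le> 1"
  using assms
proof (induction q arbitrary: F)
  case (Suc q)
  let ?G = "F \<union> {bd q, bd q + 1}"
  have "sum (average_bond (bd q) (chain bd upd q)) F \<le> sum (average_bond (bd q) (chain bd upd q)) ?G"
    using Suc.prems by (intro sum_mono2) (auto intro: average_bond_nonneg chain_nonneg)
  also have "\<dots> = sum (chain bd upd q) ?G" using Suc.prems by (intro sum_average_bond) auto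
  also have "\<dots> \<le> 1" using Suc by auto
  finally show ?case using Suc by auto
qed (auto simp: sum.delta)

lemma chain_le_1: "chain bd upd q x \<le> 1"
  using chain_sum_le[of "{x}" bd upd q] by simp

text \<open>The induction runs over all f: the update of step q is absorbed by composing f with
  \<open>average_bond (bd q)\<close>, which leaves a case distinction on the last switch.\<close>

lemma measurable_chain:
  fixes f :: "(int \<Rightarrow> real) \<Rightarrow> real"
  assumes "q \<le> Q"
  shows "(\<lambda>upd. f (chain bd upd q)) \<in> borel_measurable (PiM {..<Q} (\<lambda>_. count_space (UNIV :: bool set)))"
  using assms
proof (induction q arbitrary: f)
  case (Suc q)
  have 1: "(\<lambda>upd. upd q) \<in> measurable (PiM {..<Q} (\<lambda>_. count_space (UNIV :: bool set))) (count_space UNIV)"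
    using Suc.prems by (intro measurable_component_singleton) auto
  have 2: "(\<lambda>upd. if upd q then f (average_bond (bd q) (chain bd upd q)) else f (chain bd upd q))
      \<in> borel_measurable (PiM {..<Q} (\<lambda>_. count_space (UNIV :: bool set)))"
    using Suc.IH[of "\<lambda>c. f (average_bond (bd q) c)"] Suc.IH[of f] Suc.prems 1
    by (intro measurable_If) (auto simp: pred_def[symmetric])
  show ?case by (rule measurable_cong[THEN iffD1, OF _ 2]) simp
qed simp

lemma chain_cong:
  "(\<And>j. j < q \<Longrightarrow> upd j = upd' j) \<Longrightarrow> chain bd upd q = chain bd upd' q"
  by (induction q) auto

context prob_space
begin

lemma borel_measurable_chain:
  fixes f :: "(int \<Rightarrow> real) \<Rightarrow> real"
  assumes "\<And>j. j < q \<Longrightarrow> upd j \<in> measurable M (count_space UNIV)"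
  shows "(\<lambda>\<omega>. f (chain bd (\<lambda>j. upd j \<omega>) q)) \<in> borel_measurable M"
proof -
  have "(\<lambda>\<omega>. \<lambda>j\<in>{..<q}. upd j \<omega>) \<in> measurable M (PiM {..<q} (\<lambda>_. count_space (UNIV :: bool set)))"
    by (intro measurable_restrict) (use assms in auto)
  from measurable_compose[OF this measurable_chain[of q q f bd]]
  show ?thesis
    by (rule measurable_cong[THEN iffD1, rotated]) (auto intro!: arg_cong[where f=f] chain_cong)
qed

text \<open>Condition on the last switch, which is independent of the chain built from the first q
  switches.\<close>

lemma expectation_chain_Suc:
  fixes f :: "(int \<Rightarrow> real) \<Rightarrow> real"
  assumes ind: "indep_vars (\<lambda>_. count_space (UNIV :: bool set)) upd {..<Suc q}"
    and f: "\<And>c. \<bar>f c\<bar> \<le> B"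
    and p: "prob {\<omega>\<in>space M. upd q \<omega>} = p"
  shows "expectation (\<lambda>\<omega>. f (chain bd (\<lambda>j. upd j \<omega>) (Suc q))) =
    (1 - p) * expectation (\<lambda>\<omega>. f (chain bd (\<lambda>j. upd j \<omega>) q)) +
    p * expectation (\<lambda>\<omega>. f (average_bond (bd q) (chain bd (\<lambda>j. upd j \<omega>) q)))"
proof -
  let ?C = "\<lambda>\<omega>. chain bd (\<lambda>j. upd j \<omega>) q"
  have rv: "upd j \<in> measurable M (count_space UNIV)" if "j < Suc q" for j
    using ind that by (auto simp: indep_vars_def2)
  have ev: "{\<omega>\<in>space M. upd q \<omega>} \<in> events"
    using rv[of q] by (intro predE) (auto simp: pred_def)
  have meas: "(\<lambda>\<omega>. g (?C \<omega>)) \<in> borel_measurable M" for g :: "(int \<Rightarrow> real) \<Rightarrow> real"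
    by (intro borel_measurable_chain rv) auto
  have int: "integrable M (\<lambda>\<omega>. g (?C \<omega>))" if "\<And>c. \<bar>g c\<bar> \<le> B" for g
    by (rule integrable_const_bound[where B=B]) (use that meas in auto)
  have factor: "expectation (\<lambda>\<omega>. g (?C \<omega>) * of_bool (upd q \<omega> = v)) =
      expectation (\<lambda>\<omega>. g (?C \<omega>)) * expectation (\<lambda>\<omega>. of_bool (upd q \<omega> = v))"
    if g: "\<And>c. \<bar>g c\<bar> \<le> B" for g v
  proof -
    have "indep_var (PiM {..<q} (\<lambda>_. count_space UNIV)) (\<lambda>\<omega>. restrict (\<lambda>i. upd i \<omega>) {..<q})
        (PiM {q} (\<lambda>_. count_space UNIV)) (\<lambda>\<omega>. restrict (\<lambda>i. upd i \<omega>) {q})"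
      by (rule indep_var_restrict[OF ind]) auto
    from indep_var_compose[OF this measurable_chain[of q q g bd],
        of "\<lambda>u. of_bool (u q = v)" borel]
    have "indep_var borel ((\<lambda>u. g (chain bd u q)) \<circ> (\<lambda>\<omega>. restrict (\<lambda>i. upd i \<omega>) {..<q}))
        borel ((\<lambda>u. of_bool (u q = v) :: real) \<circ> (\<lambda>\<omega>. restrict (\<lambda>i. upd i \<omega>) {q}))"
      by simp
    moreover have "(\<lambda>u. g (chain bd u q)) \<circ> (\<lambda>\<omega>. restrict (\<lambda>i. upd i \<omega>) {..<q}) = (\<lambda>\<omega>. g (?C \<omega>))"
      unfolding comp_def by (intro ext arg_cong[where f=g] chain_cong) auto
    moreover have "(\<lambda>u. of_bool (u q = v) :: real) \<circ> (\<lambda>\<omega>. restrict (\<lambda>i. upd i \<omega>) {q}) = (\<lambda>\<omega>. of_bool (upd q \<omega> = v))"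
      by (auto simp: fun_eq_iff)
    ultimately have iv: "indep_var borel (\<lambda>\<omega>. g (?C \<omega>)) borel (\<lambda>\<omega>. of_bool (upd q \<omega> = v) :: real)" by simp
    have "integrable M (\<lambda>\<omega>. of_bool (upd q \<omega> = v) :: real)"
      using indep_var_rv2[OF iv] by (intro integrable_const_bound[where B=1]) auto
    from indep_var_lebesgue_integral[OF iv int[OF g] this] show ?thesis .
  qed
  have eT: "expectation (\<lambda>\<omega>. of_bool (upd q \<omega> = True)) = p"
  proof -
    have "expectation (\<lambda>\<omega>. of_bool (upd q \<omega> = True)) = expectation (indicator {\<omega>\<in>space M. upd q \<omega>})"
      by (intro Bochner_Integration.integral_cong) (auto simp: indicator_def)
    also have "\<dots> = prob {\<omega>\<in>space M. upd q \<omega>}"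
      using ev sets.sets_into_space[OF ev] by (simp add: Int_absorb1 Int_absorb2)
    finally show ?thesis using p by simp
  qed
  have eF: "expectation (\<lambda>\<omega>. of_bool (upd q \<omega> = False)) = 1 - p"
  proof -
    have "expectation (\<lambda>\<omega>. of_bool (upd q \<omega> = False)) = expectation (indicator (space M - {\<omega>\<in>space M. upd q \<omega>}))"
      by (intro Bochner_Integration.integral_cong) (auto simp: indicator_def)
    also have "\<dots> = prob (space M - {\<omega>\<in>space M. upd q \<omega>})" using ev by (simp add: Int_absorb1 Int_absorb2 Diff_subset)
    finally show ?thesis using ev p prob_compl by simp
  qed
  have int': "integrable M (\<lambda>\<omega>. g (?C \<omega>) * of_bool (upd q \<omega> = v))" if g: "\<And>c. \<bar>g c\<bar> \<le> B" for g v
  proof -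
    have "(\<lambda>\<omega>. of_bool (upd q \<omega> = v) :: real) \<in> borel_measurable M"
      by (rule measurable_compose[OF rv[of q]]) auto
    moreover have "0 \<le> B" using g[of "\<lambda>_. 0"] by linarith
    ultimately show ?thesis
      by (intro integrable_const_bound[where B=B] borel_measurable_times meas)
        (auto simp: g abs_mult)
  qed
  have "expectation (\<lambda>\<omega>. f (chain bd (\<lambda>j. upd j \<omega>) (Suc q))) =
      expectation (\<lambda>\<omega>. f (?C \<omega>) * of_bool (upd q \<omega> = False) +
        f (average_bond (bd q) (?C \<omega>)) * of_bool (upd q \<omega> = True))"
    by (intro Bochner_Integration.integral_cong) auto
  also have "\<dots> = expectation (\<lambda>\<omega>. f (?C \<omega>) * of_bool (upd q \<omega> = False)) +
      expectation (\<lambda>\<omega>. f (average_bond (bd q) (?C \<omega>)) * of_bool (upd q \<omega> = True))"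
    using int'[of f False] int'[of "\<lambda>c. f (average_bond (bd q) c)" True] f
    by (intro Bochner_Integration.integral_add) auto
  also have "\<dots> = (1 - p) * expectation (\<lambda>\<omega>. f (?C \<omega>)) + p * expectation (\<lambda>\<omega>. f (average_bond (bd q) (?C \<omega>)))"
    using factor[of f False] factor[of "\<lambda>c. f (average_bond (bd q) c)" True] f eT eF by simp
  finally show ?thesis .
qed

end

section \<open>Poisson clocks on a mesh\<close>

locale averaging = prob_space M for M :: "'w measure" +
  fixes K :: "int \<Rightarrow> real \<Rightarrow> 'w \<Rightarrow> nat" and \<eta> :: "real \<Rightarrow> int \<Rightarrow> 'w \<Rightarrow> real"
  assumes averaging: "averaging_process M K (\<lambda>x. if x = 0 then 1 else 0) \<eta>"
begin

lemma poisson: "poisson_process M 1 (K x)"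
  using averaging by (simp add: averaging_process_def poisson_clocks_def)

lemma measurable_clock: "0 \<le> t \<Longrightarrow> K x t \<in> measurable M (count_space UNIV)"
  using poisson by (simp add: poisson_process_def)

lemma measurable_eta [measurable]: "0 \<le> t \<Longrightarrow> \<eta> t x \<in> borel_measurable M"
  using averaging by (simp add: averaging_process_def)

lemma AE_regular: "AE \<omega> in M. \<forall>x. regular_count (\<lambda>t. K x t \<omega>)"
  using poisson by (simp add: AE_all_countable poisson_process_def regular_count_def)

lemma AE_trajectory:
  "AE \<omega> in M. averaging_trajectory (\<lambda>x t. K x t \<omega>) (\<lambda>t x. \<eta> t x \<omega>) \<and>
     (\<forall>x. \<eta> 0 x \<omega> = (if x = 0 then 1 else 0))"
proof -
  have "AE \<omega> in M. (\<forall>x. \<eta> 0 x \<omega> = (if x = 0 then 1 else 0)) \<and>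
        averaging_path (\<lambda>x. jump_times (\<lambda>t. K x t \<omega>)) (\<lambda>t x. \<eta> t x \<omega>)"
    using averaging by (simp add: averaging_process_def)
  with AE_regular show ?thesis
    by eventually_elim (simp add: averaging_trajectory_def)
qed

definition incr :: "(nat \<Rightarrow> real) \<Rightarrow> int \<times> nat \<Rightarrow> 'w \<Rightarrow> nat" where
  "incr \<tau> p \<omega> = K (fst p) (\<tau> (Suc (snd p))) \<omega> - K (fst p) (\<tau> (snd p)) \<omega>"

definition mesh :: "(nat \<Rightarrow> real) \<Rightarrow> bool" where
  "mesh \<tau> \<longleftrightarrow> \<tau> 0 = 0 \<and> incseq \<tau>"

lemma mesh_nonneg: "mesh \<tau> \<Longrightarrow> 0 \<le> \<tau> i"
  unfolding mesh_def incseq_def by (metis le0)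

lemma mesh_mono: "mesh \<tau> \<Longrightarrow> i \<le> j \<Longrightarrow> \<tau> i \<le> \<tau> j"
  unfolding mesh_def incseq_def by blast

lemma measurable_incr [measurable]:
  assumes "mesh \<tau>"
  shows "incr \<tau> p \<in> measurable M (count_space UNIV)"
proof -
  have "(\<lambda>\<omega>. K (fst p) (\<tau> (Suc (snd p))) \<omega> - K (fst p) (\<tau> (snd p)) \<omega>) \<in> measurable M (count_space UNIV)"
    using measurable_clock[of "\<tau> (Suc (snd p))" "fst p"] measurable_clock[of "\<tau> (snd p)" "fst p"]
      mesh_nonneg[OF assms] by measurable
  then show ?thesis by (simp add: incr_def[abs_def])
qed

text \<open>Independence over bonds is given for whole paths, independence over time for each bond
  separately. The mesh increments of a bond are measurable functions of its path, so events indexed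
  by rectangles of bonds and intervals factorise; a general finite index set is embedded in such a
  rectangle.\<close>

lemma indep_incr:
  assumes \<tau>: "mesh \<tau>"
  shows "indep_vars (\<lambda>_. count_space UNIV) (incr \<tau>) UNIV"
proof -
  let ?path = "\<lambda>x \<omega>. \<lambda>t\<in>{0::real..}. K x t \<omega>"
  have paths: "indep_vars (\<lambda>_. PiM {0..} (\<lambda>_. count_space UNIV)) ?path UNIV"
    using averaging by (simp add: averaging_process_def poisson_clocks_def)
  have incrs: "indep_vars (\<lambda>_. count_space UNIV) (\<lambda>i. incr \<tau> (x, i)) {..<n}" for x n
  proof -
    have "\<forall>\<tau> n. 0 \<le> \<tau> 0 \<and> incseq \<tau> \<longrightarrow> indep_vars (\<lambda>_. count_space UNIV)
          (\<lambda>i \<omega>. K x (\<tau> (Suc i)) \<omega> - K x (\<tau> i) \<omega>) {..<n::nat}"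
      using poisson[of x] unfolding poisson_process_def by blast
    then show ?thesis
      using \<tau> by (simp add: mesh_def incr_def[abs_def])
  qed
  have rect: "prob (\<Inter>p\<in>X \<times> {..<Suc n}. incr \<tau> p -` B p \<inter> space M) =
      (\<Prod>p\<in>X \<times> {..<Suc n}. prob (incr \<tau> p -` B p \<inter> space M))"
    if X: "finite X" "X \<noteq> {}" for X n B
  proof -
    define A where "A x = {w \<in> space (PiM {0..} (\<lambda>_. count_space (UNIV :: nat set))).
        \<forall>i<Suc n. w (\<tau> (Suc i)) - w (\<tau> i) \<in> B (x, i)}" for x
    have A: "A x \<in> sets (PiM {0..} (\<lambda>_. count_space UNIV))" for x
    proof -
      have [measurable]: "(\<lambda>w. w (\<tau> i)) \<in> measurable (PiM {0..} (\<lambda>_. count_space (UNIV :: nat set))) (count_space UNIV)" for i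
        by (intro measurable_component_singleton) (use mesh_nonneg[OF \<tau>] in auto)
      show ?thesis unfolding A_def by measurable
    qed
    have vA: "?path x -` A x \<inter> space M = (\<Inter>i<Suc n. incr \<tau> (x, i) -` B (x, i) \<inter> space M)" for x
      using mesh_nonneg[OF \<tau>] by (auto simp: A_def incr_def space_PiM PiE_def)
    have "(\<Inter>p\<in>X \<times> {..<Suc n}. incr \<tau> p -` B p \<inter> space M) = (\<Inter>x\<in>X. ?path x -` A x \<inter> space M)"
      unfolding vA by auto
    also have "prob \<dots> = (\<Prod>x\<in>X. prob (?path x -` A x \<inter> space M))"
      using A X by (intro indep_varsD[OF paths]) auto
    also have "\<dots> = (\<Prod>x\<in>X. \<Prod>i<Suc n. prob (incr \<tau> (x, i) -` B (x, i) \<inter> space M))"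
    proof (rule prod.cong[OF refl])
      fix x
      show "prob (?path x -` A x \<inter> space M) = (\<Prod>i<Suc n. prob (incr \<tau> (x, i) -` B (x, i) \<inter> space M))"
        unfolding vA by (intro indep_varsD[OF incrs[of x "Suc n"]]) auto
    qed
    also have "\<dots> = (\<Prod>p\<in>X \<times> {..<Suc n}. prob (incr \<tau> p -` B p \<inter> space M))"
      by (subst prod.cartesian_product) (simp add: case_prod_beta)
    finally show ?thesis .
  qed
  show ?thesis
    unfolding indep_vars_def2
  proof (intro conjI ballI indep_setsI)
    fix p show "incr \<tau> p \<in> measurable M (count_space UNIV)" using \<tau> by measurable
  next
    fix p show "{incr \<tau> p -` A \<inter> space M |A. A \<in> sets (count_space UNIV)} \<subseteq> events"
      using measurable_incr[OF \<tau>, of p] by (auto intro: measurable_sets)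
  next
    fix A and J :: "(int \<times> nat) set"
    assume J: "J \<noteq> {}" "finite J" "\<forall>j\<in>J. A j \<in> {incr \<tau> j -` A \<inter> space M |A. A \<in> sets (count_space UNIV)}"
    then have "\<forall>j\<in>J. \<exists>B. A j = incr \<tau> j -` B \<inter> space M" by auto
    then obtain B where B: "\<And>j. j \<in> J \<Longrightarrow> A j = incr \<tau> j -` B j \<inter> space M" by metis
    \<comment> \<open>Indices outside J carry the sure event, which changes neither the intersection
      nor the product.\<close>
    define B' where "B' p = (if p \<in> J then B p else UNIV)" for p
    define n where "n = Max (snd ` J)"
    let ?R = "fst ` J \<times> {..<Suc n}"
    have sub: "J \<subseteq> ?R"
    proof
      fix p assume p: "p \<in> J"
      then have "snd p \<le> n" unfolding n_def using J by (intro Max_ge) auto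
      then show "p \<in> ?R" using p by (cases p) force
    qed
    have "(\<Inter>j\<in>J. A j) = (\<Inter>p\<in>?R. incr \<tau> p -` B' p \<inter> space M)"
    proof (intro equalityI subsetI INT_I)
      fix \<omega> p assume \<omega>: "\<omega> \<in> (\<Inter>j\<in>J. A j)"
      obtain j where "j \<in> J" using J by auto
      then have "\<omega> \<in> A j" using \<omega> by blast
      then have "\<omega> \<in> space M" using B[OF \<open>j \<in> J\<close>] by blast
      moreover have "incr \<tau> p \<omega> \<in> B p" if "p \<in> J"
      proof -
        have "\<omega> \<in> A p" using \<omega> that by blast
        then show ?thesis using B[OF that] by simp
      qed
      ultimately show "\<omega> \<in> incr \<tau> p -` B' p \<inter> space M" by (auto simp: B'_def)
    next
      fix \<omega> j assume \<omega>: "\<omega> \<in> (\<Inter>p\<in>?R. incr \<tau> p -` B' p \<inter> space M)" and j: "j \<in> J"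
      then have "\<omega> \<in> incr \<tau> j -` B' j \<inter> space M" using sub by blast
      then show "\<omega> \<in> A j" using j B by (auto simp: B'_def)
    qed
    also have "prob \<dots> = (\<Prod>p\<in>?R. prob (incr \<tau> p -` B' p \<inter> space M))"
      using J by (intro rect) auto
    also have "\<dots> = (\<Prod>p\<in>J. prob (incr \<tau> p -` B' p \<inter> space M))"
      using J sub by (intro prod.mono_neutral_right) (auto simp: B'_def prob_space)
    also have "\<dots> = (\<Prod>j\<in>J. prob (A j))"
      by (intro prod.cong) (auto simp: B'_def B)
    finally show "prob (\<Inter>j\<in>J. A j) = (\<Prod>j\<in>J. prob (A j))" .
  qed
qed

lemma prob_incr:
  assumes \<tau>: "mesh \<tau>" and lt: "\<tau> i < \<tau> (Suc i)"
  shows "prob {\<omega>\<in>space M. incr \<tau> (x, i) \<omega> \<in> A} = measure (poisson_pmf (\<tau> (Suc i) - \<tau> i)) A"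
proof -
  have "distr M (count_space UNIV) (incr \<tau> (x, i)) = measure_pmf (poisson_pmf (\<tau> (Suc i) - \<tau> i))"
    using poisson[of x] mesh_nonneg[OF \<tau>, of i] lt unfolding poisson_process_def incr_def[abs_def] by simp
  then have "measure (poisson_pmf (\<tau> (Suc i) - \<tau> i)) A = measure (distr M (count_space UNIV) (incr \<tau> (x, i))) A" by simp
  also have "\<dots> = prob (incr \<tau> (x, i) -` A \<inter> space M)"
    using measurable_incr[OF \<tau>] by (intro measure_distr) auto
  also have "incr \<tau> (x, i) -` A \<inter> space M = {\<omega>\<in>space M. incr \<tau> (x, i) \<omega> \<in> A}" by auto
  finally show ?thesis by simp
qed

lemma prob_incr_pos:
  assumes \<tau>: "mesh \<tau>"
  shows "prob {\<omega>\<in>space M. incr \<tau> (x, i) \<omega> > 0} = 1 - exp (- (\<tau> (Suc i) - \<tau> i))"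
proof (cases "\<tau> i < \<tau> (Suc i)")
  case True
  let ?P = "poisson_pmf (\<tau> (Suc i) - \<tau> i)"
  have "prob {\<omega>\<in>space M. incr \<tau> (x, i) \<omega> \<in> {0<..}} = measure ?P {0<..}"
    by (rule prob_incr[OF \<tau> True])
  also have "{0<..} = UNIV - {0::nat}" by auto
  also have "measure ?P (UNIV - {0}) = 1 - pmf ?P 0"
    using measure_pmf.prob_compl[of "{0}" ?P] by (simp add: measure_pmf_single)
  finally show ?thesis using True by (simp add: pmf_poisson)
next
  case False
  then have "\<tau> (Suc i) = \<tau> i" using mesh_mono[OF \<tau>, of i "Suc i"] by simp
  then show ?thesis by (simp add: incr_def)
qed

lemma prob_incr_ge2:
  assumes \<tau>: "mesh \<tau>"
  shows "prob {\<omega>\<in>space M. incr \<tau> (x, i) \<omega> \<ge> 2} \<le> (\<tau> (Suc i) - \<tau> i)\<^sup>2"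
proof (cases "\<tau> i < \<tau> (Suc i)")
  case True
  let ?l = "\<tau> (Suc i) - \<tau> i"
  let ?P = "poisson_pmf ?l"
  have "prob {\<omega>\<in>space M. incr \<tau> (x, i) \<omega> \<in> {2..}} = measure ?P {2..}"
    by (rule prob_incr[OF \<tau> True])
  also have "measure ?P {2..} = measure ?P (UNIV - {0, 1})" by (rule arg_cong[where f="measure ?P"]) auto
  also have "measure ?P (UNIV - {0, 1}) = 1 - (pmf ?P 0 + pmf ?P 1)"
    using measure_pmf.prob_compl[of "{0,1}" ?P] by (simp add: measure_measure_pmf_finite)
  also have "pmf ?P 0 + pmf ?P 1 = (1 + ?l) * exp (- ?l)"
    using True by (simp add: pmf_poisson algebra_simps)
  \<comment> \<open>The estimate exp (-l) \<ge> 1 - l makes the bound of second order in the mesh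
    width, so that it vanishes even after summation over all mesh intervals.\<close>
  also have "1 - (1 + ?l) * exp (- ?l) \<le> 1 - (1 + ?l) * (1 - ?l)"
    using exp_ge_add_one_self[of "- ?l"] True by (intro diff_left_mono mult_left_mono) linarith+
  also have "\<dots> = ?l\<^sup>2" by (simp add: power2_eq_square algebra_simps)
  finally show ?thesis by simp
next
  case False
  then have "\<tau> (Suc i) = \<tau> i" using mesh_mono[OF \<tau>, of i "Suc i"] by simp
  then show ?thesis by (simp add: incr_def)
qed

lemma prob_incr_all_pos:
  assumes \<tau>: "mesh \<tau>" and J: "finite J"
  shows "prob {\<omega>\<in>space M. \<forall>p\<in>J. incr \<tau> p \<omega> > 0} = (\<Prod>p\<in>J. 1 - exp (- (\<tau> (Suc (snd p)) - \<tau> (snd p))))"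
proof (cases "J = {}")
  case False
  have "{\<omega>\<in>space M. \<forall>p\<in>J. incr \<tau> p \<omega> > 0} = (\<Inter>p\<in>J. incr \<tau> p -` {0<..} \<inter> space M)"
    using False by auto
  also have "prob \<dots> = (\<Prod>p\<in>J. prob (incr \<tau> p -` {0<..} \<inter> space M))"
    using False J by (intro indep_varsD[OF indep_incr[OF \<tau>]]) auto
  also have "\<dots> = (\<Prod>p\<in>J. 1 - exp (- (\<tau> (Suc (snd p)) - \<tau> (snd p))))"
  proof (rule prod.cong[OF refl])
    fix p
    have "incr \<tau> p -` {0<..} \<inter> space M = {\<omega>\<in>space M. incr \<tau> (fst p, snd p) \<omega> > 0}" by auto
    then show "prob (incr \<tau> p -` {0<..} \<inter> space M) = 1 - exp (- (\<tau> (Suc (snd p)) - \<tau> (snd p)))"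
      using prob_incr_pos[OF \<tau>, of "fst p" "snd p"] by simp
  qed
  finally show ?thesis .
qed (simp add: prob_space)

end

section \<open>The generator of the two-point function\<close>

text \<open>If \<open>m x y\<close> is the mean of a product of two coordinates, this is the same
  mean after a ring of \<open>b\<close>, because averaging is linear in each factor.\<close>

definition avg2 :: "int \<Rightarrow> (int \<Rightarrow> int \<Rightarrow> real) \<Rightarrow> int \<Rightarrow> int \<Rightarrow> real" where
  "avg2 b m x y = average_bond b (\<lambda>x'. average_bond b (m x') y) x"

text \<open>The sum is over a set: a bond that touches both walkers is counted once. This is the
  only source of interaction between them.\<close>

definition gen :: "(int \<Rightarrow> int \<Rightarrow> real) \<Rightarrow> int \<Rightarrow> int \<Rightarrow> real" where
  "gen m x y = (\<Sum>b\<in>{x - 1, x, y - 1, y}. avg2 b m x y - m x y)"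

lemma avg2_outside: "b \<notin> {x - 1, x, y - 1, y} \<Longrightarrow> avg2 b m x y = m x y"
  by (auto simp: avg2_def average_bond_apply)

lemma avg2_close:
  assumes "\<And>x' y'. \<bar>x' - x\<bar> \<le> 1 \<Longrightarrow> \<bar>y' - y\<bar> \<le> 1 \<Longrightarrow> \<bar>m x' y' - m' x' y'\<bar> \<le> d"
  shows "\<bar>avg2 b m x y - avg2 b m' x y\<bar> \<le> d"
proof -
  have avg: "\<bar>average_bond b f z - average_bond b g z\<bar> \<le> d"
    if "\<And>z'. \<bar>z' - z\<bar> \<le> 1 \<Longrightarrow> \<bar>f z' - g z'\<bar> \<le> d" for f g :: "int \<Rightarrow> real" and z
  proof -
    consider "z = b" | "z = b + 1" | "z \<noteq> b" "z \<noteq> b + 1" by blast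
    then show ?thesis
    proof cases
      case 1
      then show ?thesis using that[of b] that[of "b+1"] by (simp add: average_bond_apply abs_le_iff field_simps)
    next
      case 2
      then show ?thesis using that[of b] that[of "b+1"] by (simp add: average_bond_apply abs_le_iff field_simps)
    next
      case 3
      then show ?thesis using that[of z] by (simp add: average_bond_apply)
    qed
  qed
  show ?thesis unfolding avg2_def
    by (intro avg) (use assms in auto)
qed

lemma avg2_bounds:
  assumes "\<And>x' y'. 0 \<le> m x' y'" "\<And>x' y'. m x' y' \<le> 1"
  shows "0 \<le> avg2 b m x y" "avg2 b m x y \<le> 1"
proof -
  have bounds: "0 \<le> average_bond b f z \<and> average_bond b f z \<le> 1" if "\<And>z. 0 \<le> f z" "\<And>z. f z \<le> 1" for f z
    using that[of b] that[of z] that(1)[of "b+1"] that(2)[of "b+1"] by (auto simp: average_bond_apply)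
  show "0 \<le> avg2 b m x y" "avg2 b m x y \<le> 1"
    unfolding avg2_def using bounds assms by simp_all
qed

lemma card_bonds: "card {x - 1, x, y - 1, y :: int} \<le> 4"
  using card_length[of "[x - 1, x, y - 1, y]"] by simp

text \<open>At most four bonds contribute, each with two differences of size at most d. The constant
  8 reappears in the decay and Lipschitz estimates.\<close>

lemma gen_close:
  assumes "\<And>x' y'. \<bar>x' - x\<bar> \<le> 1 \<Longrightarrow> \<bar>y' - y\<bar> \<le> 1 \<Longrightarrow> \<bar>m x' y' - m' x' y'\<bar> \<le> d"
  shows "\<bar>gen m x y - gen m' x y\<bar> \<le> 8 * d"
proof -
  have d: "0 \<le> d" using assms[of x y] by simp
  have "\<bar>gen m x y - gen m' x y\<bar> = \<bar>\<Sum>b\<in>{x - 1, x, y - 1, y}. (avg2 b m x y - avg2 b m' x y) - (m x y - m' x y)\<bar>"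
    unfolding gen_def sum_subtractf[symmetric] by (intro arg_cong[where f=abs] sum.cong) auto
  also have "\<dots> \<le> (\<Sum>b\<in>{x - 1, x, y - 1, y}. \<bar>(avg2 b m x y - avg2 b m' x y) - (m x y - m' x y)\<bar>)"
    by (rule sum_abs)
  also have "\<dots> \<le> (\<Sum>b\<in>{x - 1, x, y - 1, y}. 2 * d)"
  proof (rule sum_mono)
    fix b
    show "\<bar>(avg2 b m x y - avg2 b m' x y) - (m x y - m' x y)\<bar> \<le> 2 * d"
      using avg2_close[of x y m m' d b, OF assms] assms[of x y] by simp
  qed
  also have "\<dots> = real (card {x - 1, x, y - 1, y}) * (2 * d)" by simp
  also have "\<dots> \<le> 4 * (2 * d)"
    using card_bonds[of x y] d by (intro mult_right_mono) auto
  finally show ?thesis by simp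
qed

lemma gen_bound:
  assumes "\<And>x' y'. 0 \<le> m x' y'" "\<And>x' y'. m x' y' \<le> 1"
  shows "\<bar>gen m x y\<bar> \<le> 8"
proof -
  have "gen (\<lambda>_ _. 0) x y = 0" unfolding gen_def by (intro sum.neutral) (auto simp: avg2_def average_bond_apply)
  then show ?thesis using gen_close[of x y m "\<lambda>_ _. 0" 1] assms by simp
qed

section \<open>Cyclic sweeps through a finite box\<close>

definition bond :: "nat \<Rightarrow> nat \<Rightarrow> int" where
  "bond L q = int (q mod (2 * L + 1)) - int L"

lemma sum_bond_sweep:
  fixes f :: "int \<Rightarrow> real"
  shows "(\<Sum>q=i * (2 * L + 1)..<i * (2 * L + 1) + (2 * L + 1). f (bond L q)) = sum f {- int L..int L}"
proof -
  let ?w = "2 * L + 1"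
  have "(\<Sum>q=i * ?w..<i * ?w + ?w. f (bond L q)) = (\<Sum>q=0 + i * ?w..<?w + i * ?w. f (bond L q))"
    by (simp add: add.commute)
  also have "\<dots> = (\<Sum>j=0..<?w. f (bond L (j + i * ?w)))"
    by (rule sum.shift_bounds_nat_ivl)
  also have "\<dots> = (\<Sum>j=0..<?w. f (int j - int L))"
    unfolding bond_def mod_mult_self1 by (rule sum.cong) auto
  also have "\<dots> = sum f {- int L..int L}"
    by (rule sum.reindex_bij_witness[of _ "\<lambda>b. nat (b + int L)" "\<lambda>j. int j - int L"]) auto
  finally show ?thesis .
qed

lemma sum_bond:
  fixes f :: "int \<Rightarrow> real"
  shows "(\<Sum>q=k * (2 * L + 1)..<(k + n) * (2 * L + 1). f (bond L q)) = real n * sum f {- int L..int L}"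
proof (induction n)
  case (Suc n)
  let ?w = "2 * L + 1"
  have "(\<Sum>q=k * ?w..<(k + Suc n) * ?w. f (bond L q)) =
      (\<Sum>q=k * ?w..<(k + n) * ?w. f (bond L q)) + (\<Sum>q=(k + n) * ?w..<(k + n) * ?w + ?w. f (bond L q))"
    by (subst sum.atLeastLessThan_concat) (auto simp: algebra_simps)
  also have "\<dots> = real n * sum f {- int L..int L} + sum f {- int L..int L}"
    by (simp only: Suc.IH sum_bond_sweep)
  finally show ?case by (simp add: algebra_simps)
qed simp

text \<open>
  The bonds of a box are updated cyclically, each with probability \<open>p\<close>; to first order in \<open>p\<close>
  a sweep through the box is an Euler step of length \<open>p\<close> for the evolution generated by \<open>gen\<close>.
\<close>

lemma euler_sweeps:
  fixes \<mu> :: "nat \<Rightarrow> int \<Rightarrow> int \<Rightarrow> real"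
  defines "w \<equiv> \<lambda>L. 2 * L + (1::nat)"
  assumes rec: "\<And>q x y. k * w L \<le> q \<Longrightarrow> q < (k + n) * w L \<Longrightarrow>
      \<mu> (Suc q) x y = (1 - p) * \<mu> q x y + p * avg2 (bond L q) (\<mu> q) x y"
    and bnd: "\<And>q x y. 0 \<le> \<mu> q x y" "\<And>q x y. \<mu> q x y \<le> 1"
    and p: "0 \<le> p" and xy: "\<bar>x\<bar> < int L" "\<bar>y\<bar> < int L"
  shows "\<bar>\<mu> ((k + n) * w L) x y - \<mu> (k * w L) x y - real n * p * gen (\<mu> (k * w L)) x y\<bar> \<le> 32 * (real n * p)\<^sup>2"
proof -
  let ?a = "k * w L" and ?c = "(k + n) * w L"
  have ac: "?a \<le> ?c" by simp
  define N where "N x y = {x - 1, x, y - 1, y :: int}" for x y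
  have step: "\<mu> (Suc q) x y - \<mu> q x y = p * (if bond L q \<in> N x y then avg2 (bond L q) (\<mu> q) x y - \<mu> q x y else 0)"
    if "?a \<le> q" "q < ?c" for q x y
  proof (cases "bond L q \<in> N x y")
    case True
    then show ?thesis using rec[OF that, of x y] by (simp add: algebra_simps)
  next
    case False
    then have "avg2 (bond L q) (\<mu> q) x y = \<mu> q x y" unfolding N_def by (rule avg2_outside)
    then show ?thesis using rec[OF that, of x y] False by (simp add: algebra_simps)
  qed
  have tele: "\<mu> q x y - \<mu> ?a x y = (\<Sum>j=?a..<q. p * (if bond L j \<in> N x y then avg2 (bond L j) (\<mu> j) x y - \<mu> j x y else 0))"
    if "?a \<le> q" "q \<le> ?c" for q x y
  proof -
    have "\<mu> q x y - \<mu> ?a x y = (\<Sum>j=?a..<q. \<mu> (Suc j) x y - \<mu> j x y)"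
      using sum_Suc_diff'[OF that(1), of "\<lambda>q. \<mu> q x y"] by simp
    also have "\<dots> = (\<Sum>j=?a..<q. p * (if bond L j \<in> N x y then avg2 (bond L j) (\<mu> j) x y - \<mu> j x y else 0))"
      by (intro sum.cong step) (use that in auto)
    finally show ?thesis .
  qed
  \<comment> \<open>In each sweep at most four updates touch the pair (x, y). Only these contribute,
    so none of the bounds depends on the size of the box.\<close>
  have count: "(\<Sum>q=?a..<?c. of_bool (bond L q \<in> N x y)) \<le> 4 * real n" for x y
  proof -
    have "(\<Sum>q=?a..<?c. of_bool (bond L q \<in> N x y)) = real n * (\<Sum>b\<in>{- int L..int L}. of_bool (b \<in> N x y))"
      unfolding w_def by (rule sum_bond)
    also have "(\<Sum>b\<in>{- int L..int L}. of_bool (b \<in> N x y)) = real (card ({- int L..int L} \<inter> N x y))"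
      by (simp add: of_bool_def sum.If_cases)
    also have "real n * \<dots> \<le> real n * 4"
      by (intro mult_left_mono) (use card_mono[of "N x y" "{- int L..int L} \<inter> N x y"] card_bonds[of x y] in \<open>simp_all add: N_def\<close>)
    finally show ?thesis by (simp only: mult.commute)
  qed
  have drift: "\<bar>\<mu> q x y - \<mu> ?a x y\<bar> \<le> 4 * (real n * p)" if q: "?a \<le> q" "q \<le> ?c" for q x y
  proof -
    have "\<bar>\<mu> q x y - \<mu> ?a x y\<bar> \<le> (\<Sum>j=?a..<q. \<bar>p * (if bond L j \<in> N x y then avg2 (bond L j) (\<mu> j) x y - \<mu> j x y else 0)\<bar>)"
      unfolding tele[OF q] by (rule sum_abs)
    also have "\<dots> \<le> (\<Sum>j=?a..<q. p * of_bool (bond L j \<in> N x y))"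
    proof (rule sum_mono)
      fix j
      have "\<bar>avg2 (bond L j) (\<mu> j) x y - \<mu> j x y\<bar> \<le> 1"
        using avg2_bounds[of "\<mu> j" "bond L j" x y, OF bnd] bnd(1)[of j x y] bnd(2)[of j x y] by linarith
      then show "\<bar>p * (if bond L j \<in> N x y then avg2 (bond L j) (\<mu> j) x y - \<mu> j x y else 0)\<bar> \<le> p * of_bool (bond L j \<in> N x y)"
        using p by (simp add: abs_mult mult_left_le)
    qed
    also have "\<dots> \<le> (\<Sum>j=?a..<?c. p * of_bool (bond L j \<in> N x y))"
      using q p by (intro sum_mono2) auto
    also have "\<dots> = p * (\<Sum>j=?a..<?c. of_bool (bond L j \<in> N x y))"
      by (simp add: sum_distrib_left)
    also have "\<dots> \<le> p * (4 * real n)" using count p by (intro mult_left_mono) auto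
    finally show ?thesis by (simp add: algebra_simps)
  qed
  have lin: "real n * p * gen (\<mu> ?a) x y = (\<Sum>q=?a..<?c. p * (if bond L q \<in> N x y then avg2 (bond L q) (\<mu> ?a) x y - \<mu> ?a x y else 0))"
  proof -
    have "(\<Sum>q=?a..<?c. p * (if bond L q \<in> N x y then avg2 (bond L q) (\<mu> ?a) x y - \<mu> ?a x y else 0)) =
        real n * (\<Sum>b\<in>{- int L..int L}. p * (if b \<in> N x y then avg2 b (\<mu> ?a) x y - \<mu> ?a x y else 0))"
      unfolding w_def by (rule sum_bond)
    also have "(\<Sum>b\<in>{- int L..int L}. p * (if b \<in> N x y then avg2 b (\<mu> ?a) x y - \<mu> ?a x y else 0)) =
        p * (\<Sum>b\<in>N x y. avg2 b (\<mu> ?a) x y - \<mu> ?a x y)"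
      unfolding sum_distrib_left using xy by (intro sum.mono_neutral_cong_right) (auto simp: N_def)
    finally show ?thesis by (simp add: gen_def N_def)
  qed
  \<comment> \<open>The generator is frozen at the start of the block. Each of the at most 4 n
    active updates errs by p times 8 n p: a drift of 4 n p for the averaged value and another 4 n p
    for the value itself.\<close>
  have err: "\<mu> ?c x y - \<mu> ?a x y - real n * p * gen (\<mu> ?a) x y =
     (\<Sum>q=?a..<?c. p * (if bond L q \<in> N x y then (avg2 (bond L q) (\<mu> q) x y - avg2 (bond L q) (\<mu> ?a) x y) - (\<mu> q x y - \<mu> ?a x y) else 0))"
    unfolding tele[OF ac order.refl] lin sum_subtractf[symmetric]
    by (intro sum.cong refl) (simp add: algebra_simps)
  have "\<bar>\<mu> ?c x y - \<mu> ?a x y - real n * p * gen (\<mu> ?a) x y\<bar> \<le>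
      (\<Sum>q=?a..<?c. \<bar>p * (if bond L q \<in> N x y then (avg2 (bond L q) (\<mu> q) x y - avg2 (bond L q) (\<mu> ?a) x y) - (\<mu> q x y - \<mu> ?a x y) else 0)\<bar>)"
    unfolding err by (rule sum_abs)
  also have "\<dots> \<le> (\<Sum>q=?a..<?c. p * (8 * (real n * p)) * of_bool (bond L q \<in> N x y))"
  proof (rule sum_mono)
    fix q assume q: "q \<in> {?a..<?c}"
    have "\<bar>(avg2 (bond L q) (\<mu> q) x y - avg2 (bond L q) (\<mu> ?a) x y) - (\<mu> q x y - \<mu> ?a x y)\<bar> \<le> 8 * (real n * p)"
    proof -
      have qa: "?a \<le> q" "q \<le> ?c" using q by auto
      have "\<bar>avg2 (bond L q) (\<mu> q) x y - avg2 (bond L q) (\<mu> ?a) x y\<bar> \<le> 4 * (real n * p)"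
        by (rule avg2_close) (rule drift[OF qa])
      then show ?thesis using drift[OF qa, of x y] by linarith
    qed
    then show "\<bar>p * (if bond L q \<in> N x y then (avg2 (bond L q) (\<mu> q) x y - avg2 (bond L q) (\<mu> ?a) x y) - (\<mu> q x y - \<mu> ?a x y) else 0)\<bar> \<le>
        p * (8 * (real n * p)) * of_bool (bond L q \<in> N x y)"
      using p by (cases "bond L q \<in> N x y") (simp_all add: abs_mult mult_left_mono del: mult_le_cancel_left)
  qed
  also have "\<dots> = p * (8 * (real n * p)) * (\<Sum>q=?a..<?c. of_bool (bond L q \<in> N x y))"
    by (simp add: sum_distrib_left)
  also have "\<dots> \<le> p * (8 * (real n * p)) * (4 * real n)"
    by (intro mult_left_mono count) (use p in simp)
  also have "\<dots> = 32 * (real n * p)\<^sup>2" by (simp add: power2_eq_square)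
  finally show ?thesis .
qed

text \<open>
  If at most one clock of the box rings per mesh interval, then the order in which a sweep visits
  the bonds is irrelevant. The silent bonds on either side of the origin shield the block between
  them, so that neither the cut-off at the boundary of the box nor rings outside it have any effect.
\<close>

lemma (in averaging_trajectory) chain_agrees:
  fixes \<tau> :: "nat \<Rightarrow> real"
  defines "rung \<equiv> \<lambda>x i. k x (\<tau> (Suc i)) - k x (\<tau> i) > 0"
  assumes init: "\<And>x. e 0 x = (if x = 0 then 1 else 0)"
    and \<tau>: "\<tau> 0 = 0" "incseq \<tau>"
    and once: "\<And>i x. i < n \<Longrightarrow> \<bar>x\<bar> \<le> int L \<Longrightarrow> k x (\<tau> (Suc i)) - k x (\<tau> i) < 2"
    and single: "\<And>i x y. i < n \<Longrightarrow> \<bar>x\<bar> \<le> int L \<Longrightarrow> \<bar>y\<bar> \<le> int L \<Longrightarrow> x \<noteq> y \<Longrightarrow> \<not> (rung x i \<and> rung y i)"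
    and silent: "k l (\<tau> n) = k l 0" "k r (\<tau> n) = k r 0"
    and lr: "- int L \<le> l" "l < r" "r \<le> int L"
    and i: "i \<le> n" and x: "l < x" "x \<le> r"
  shows "chain (bond L) (\<lambda>q. rung (bond L q) (q div (2 * L + 1))) (i * (2 * L + 1)) x = e (\<tau> i) x"
  using i x
proof (induction i arbitrary: x)
  case 0
  then show ?case using init \<tau> by simp
next
  case (Suc i)
  let ?w = "2 * L + 1" and ?upd = "\<lambda>q. rung (bond L q) (q div (2 * L + 1))"
  let ?C = "chain (bond L) ?upd"
  have pos: "0 \<le> \<tau> j" for j using \<tau> unfolding incseq_def by (metis le0)
  have inc: "\<tau> j \<le> \<tau> j'" if "j \<le> j'" for j j' using \<tau> that by (simp add: incseq_def)
  have kmono: "k z (\<tau> j) \<le> k z (\<tau> j')" if "j \<le> j'" for z j j'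
    using regular_count_mono[OF regular pos inc[OF that]] .
  have eq: "k z (\<tau> (Suc i)) = k z (\<tau> i)" if "\<not> rung z i" for z
    using that kmono[of i "Suc i" z] by (simp add: rung_def)
  \<comment> \<open>Counts are monotone, so a bond that is silent over the whole mesh is silent in
    each of its intervals.\<close>
  have not_rung: "\<not> rung z i" if "k z (\<tau> n) = k z 0" for z
    using that kmono[of 0 i z] kmono[of i "Suc i" z] kmono[of "Suc i" n z] \<tau>(1) Suc.prems(1)
    by (simp add: rung_def)
  note sil = not_rung[OF silent(1)] not_rung[OF silent(2)]
  have q: "q div ?w = i \<and> \<bar>bond L q\<bar> \<le> int L" if "i * ?w \<le> q" "q < i * ?w + ?w" for q
  proof -
    have d: "q div ?w = i"
      by (rule div_nat_eqI) (use that in \<open>simp_all add: algebra_simps\<close>)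
    have "q mod ?w < ?w" by simp
    then show ?thesis using d unfolding bond_def by (simp only: abs_le_iff) linarith
  qed
  have Suc_w: "Suc i * ?w = i * ?w + ?w" by simp
  show ?case
  proof (cases "\<exists>b. \<bar>b\<bar> \<le> int L \<and> rung b i")
    case False
    have "?C (Suc i * ?w) = ?C (i * ?w)"
      unfolding Suc_w using q False by (intro chain_no_update) auto
    moreover have "e (\<tau> (Suc i)) x = e (\<tau> i) x"
      using False Suc.prems lr by (intro constant_without_rings pos inc eq) auto
    ultimately show ?thesis using Suc.IH[of x] Suc.prems by simp
  next
    case True
    then obtain b where b: "\<bar>b\<bar> \<le> int L" "rung b i" by blast
    have nb: "\<not> rung z i" if "\<bar>z\<bar> \<le> int L" "z \<noteq> b" for z
      using single[of i z b] that b Suc.prems by auto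
    \<comment> \<open>The position in sweep i at which the only ringing bond is visited.\<close>
    define q0 where "q0 = i * ?w + nat (b + int L)"
    have small: "nat (b + int L) < ?w" using b by auto
    then have q0: "i * ?w \<le> q0" "q0 < i * ?w + ?w" by (simp_all add: q0_def)
    then have q0_div: "q0 div ?w = i" using q by blast
    have "q0 mod ?w = nat (b + int L)"
      unfolding q0_def add.commute[of "i * ?w"] mod_mult_self1 using small by (rule mod_less)
    then have q0_bond: "bond L q0 = b" using b(1) by (simp add: bond_def)
    have uniq: "q' = q0" if q': "i * ?w \<le> q'" "q' < i * ?w + ?w" "bond L q' = b" for q'
    proof -
      have "int (q' mod ?w) = int (q0 mod ?w)" using q'(3) q0_bond unfolding bond_def by linarith
      moreover have "q' div ?w = q0 div ?w" using q[OF q'(1,2)] q0_div by simp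
      ultimately show ?thesis by (metis div_mult_mod_eq of_nat_eq_iff)
    qed
    have "?C (Suc i * ?w) = average_bond (bond L q0) (?C (i * ?w))"
      unfolding Suc_w
    proof (rule chain_one_update)
      fix q' assume q': "i * ?w \<le> q'" "q' < i * ?w + ?w" "q' \<noteq> q0"
      have "bond L q' \<noteq> b" using uniq q' by blast
      then show "\<not> rung (bond L q') (q' div ?w)" using nb q[OF q'(1,2)] by simp
    qed (use q0 q0_div q0_bond b in simp_all)
    then have C: "?C (Suc i * ?w) = average_bond b (?C (i * ?w))" using q0_bond by simp
    have IH: "?C (i * ?w) z = e (\<tau> i) z" if "l < z" "z \<le> r" for z
      using Suc.IH[of z] that Suc.prems by simp
    show ?thesis
    proof (cases "l < b \<and> b < r")
      case True
      have "k b (\<tau> (Suc i)) = Suc (k b (\<tau> i))"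
        using once[of i b] b Suc.prems by (simp add: rung_def)
      then have "e (\<tau> (Suc i)) x = average_bond b (e (\<tau> i)) x"
        using True Suc.prems lr by (intro single_ring[of _ _ l b r] pos inc eq nb) auto
      then show ?thesis unfolding C using IH True Suc.prems by (auto simp: average_bond_apply)
    next
      case False
      \<comment> \<open>The shields are silent, so b lies outside the closed interval from l to r,
        and averaging over b cannot reach x.\<close>
      have "b \<noteq> l" "b \<noteq> r" using sil b by auto
      then have bx: "x \<noteq> b" "x \<noteq> b + 1" "x - 1 \<noteq> b" using False Suc.prems by auto
      have "e (\<tau> (Suc i)) x = e (\<tau> i) x"
        using bx Suc.prems lr by (intro constant_without_rings pos inc eq nb) auto
      then show ?thesis unfolding C using IH[of x] bx Suc.prems by (simp add: average_bond_apply)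
    qed
  qed
qed

text \<open>One mesh that passes through s after n steps and through s + d after 2 n steps, so that
  a single box chain approximates the profile at both times.\<close>

definition mesh2 :: "real \<Rightarrow> real \<Rightarrow> nat \<Rightarrow> nat \<Rightarrow> real" where
  "mesh2 s d n i = real (min i n) * (s / real n) + real (i - n) * (d / real n)"

lemma mesh2_simps:
  assumes "n > 0"
  shows "mesh2 s d n 0 = 0" "mesh2 s d n n = s" "mesh2 s d n (n + n) = s + d"
    "i < n \<Longrightarrow> mesh2 s d n (Suc i) - mesh2 s d n i = s / real n"
    "n \<le> i \<Longrightarrow> mesh2 s d n (Suc i) - mesh2 s d n i = d / real n"
  using assms by (simp_all add: mesh2_def min_def Suc_diff_le field_simps)

lemma incseq_mesh2: "0 \<le> s \<Longrightarrow> 0 \<le> d \<Longrightarrow> incseq (mesh2 s d n)"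
  unfolding incseq_def mesh2_def by (intro allI impI add_mono mult_right_mono) auto

section \<open>The evolution equation of the two-point function\<close>

lemma one_minus_exp_ge:
  assumes "0 \<le> (a::real)"
  shows "a - a\<^sup>2 \<le> 1 - exp (- a)"
proof -
  have "1 \<le> (1 - a + a\<^sup>2) * (1 + a)"
    using assms by (simp add: power2_eq_square algebra_simps)
  also have "\<dots> \<le> (1 - a + a\<^sup>2) * exp a"
  proof (rule mult_left_mono[OF exp_ge_add_one_self])
    have "0 \<le> (a - 1/2)\<^sup>2 + 3/4" by simp
    then show "0 \<le> 1 - a + a\<^sup>2" by (simp add: power2_eq_square algebra_simps)
  qed
  finally have "exp (- a) \<le> 1 - a + a\<^sup>2" by (simp add: exp_minus field_simps)
  then show ?thesis by simp
qed

lemma (in prob_space) indep_vars_inj_reindex: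
  assumes inj: "inj_on f I" and X: "indep_vars (\<lambda>_. N) X (f ` I)"
  shows "indep_vars (\<lambda>_. N) (\<lambda>i. X (f i)) I"
  unfolding indep_vars_def2
proof (intro conjI ballI indep_setsI)
  fix i assume "i \<in> I"
  then show rv: "random_variable N (X (f i))" using X by (simp add: indep_vars_def2)
  then show "{X (f i) -` A \<inter> space M |A. A \<in> sets N} \<subseteq> events" by (auto intro: measurable_sets)
next
  fix A J assume J: "J \<noteq> {}" "J \<subseteq> I" "finite J" "\<forall>j\<in>J. A j \<in> {X (f j) -` A \<inter> space M |A. A \<in> sets N}"
  then have "\<forall>j\<in>J. \<exists>B. B \<in> sets N \<and> A j = X (f j) -` B \<inter> space M" by auto
  then obtain B where B: "\<And>j. j \<in> J \<Longrightarrow> B j \<in> sets N \<and> A j = X (f j) -` B j \<inter> space M" by metis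
  have injJ: "inj_on f J" using inj J(2) by (rule inj_on_subset)
  define C where "C z = B (the_inv_into J f z)" for z
  have C: "C (f j) = B j" if "j \<in> J" for j using that by (simp add: C_def the_inv_into_f_f[OF injJ])
  have "prob (\<Inter>z\<in>f ` J. X z -` C z \<inter> space M) = (\<Prod>z\<in>f ` J. prob (X z -` C z \<inter> space M))"
    by (rule indep_varsD[OF X]) (use J B C in auto)
  moreover have "(\<Inter>z\<in>f ` J. X z -` C z \<inter> space M) = (\<Inter>j\<in>J. A j)"
    using B C by auto
  moreover have "(\<Prod>z\<in>f ` J. prob (X z -` C z \<inter> space M)) = (\<Prod>j\<in>J. prob (A j))"
    unfolding prod.reindex[OF injJ] comp_def by (intro prod.cong refl) (simp add: B C)
  ultimately show "prob (\<Inter>j\<in>J. A j) = (\<Prod>j\<in>J. prob (A j))" by simp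
qed

section \<open>Comparison of the profile with the chain in a box\<close>

context averaging
begin

text \<open>A pair with equal entries stands for a double ring of one bond; thus one family of
  events covers every way of having more than one ring in the box during a mesh interval.\<close>

definition collision :: "(nat \<Rightarrow> real) \<Rightarrow> nat \<Rightarrow> int \<times> int \<Rightarrow> 'w set" where
  "collision \<tau> i z = {\<omega>\<in>space M. if fst z = snd z then incr \<tau> (fst z, i) \<omega> \<ge> 2
     else \<forall>p\<in>{(fst z, i), (snd z, i)}. incr \<tau> p \<omega> > 0}"

lemma sets_collision [measurable]: "mesh \<tau> \<Longrightarrow> collision \<tau> i z \<in> events"
  unfolding collision_def by measurable

lemma prob_collision:
  assumes \<tau>: "mesh \<tau>"
  shows "prob (collision \<tau> i z) \<le> (\<tau> (Suc i) - \<tau> i)\<^sup>2"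
proof (cases "fst z = snd z")
  case True
  then show ?thesis using prob_incr_ge2[OF \<tau>] by (simp add: collision_def)
next
  case False
  let ?l = "\<tau> (Suc i) - \<tau> i"
  have l: "0 \<le> ?l" using mesh_mono[OF \<tau>, of i "Suc i"] by simp
  have "prob (collision \<tau> i z) = (1 - exp (- ?l)) * (1 - exp (- ?l))"
    using False prob_incr_all_pos[OF \<tau>, of "{(fst z, i), (snd z, i)}"] by (simp add: collision_def)
  also have "\<dots> \<le> ?l * ?l"
  proof -
    have "1 - exp (- ?l) \<le> ?l" "0 \<le> 1 - exp (- ?l)" using l exp_ge_add_one_self[of "- ?l"]
      by (linarith, simp)
    then show ?thesis using l by (intro mult_mono)
  qed
  finally show ?thesis by (simp add: power2_eq_square)
qed

text \<open>Written with the increments of the mesh 0, T, T, ... so that the independence of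
  \<open>incr\<close> gives the probability directly.\<close>

definition no_silent :: "real \<Rightarrow> int set \<Rightarrow> 'w set" where
  "no_silent T S = {\<omega>\<in>space M. \<forall>p\<in>S \<times> {0}. incr (\<lambda>i. if i = 0 then 0 else T) p \<omega> > 0}"

lemma mesh_single: "0 \<le> T \<Longrightarrow> mesh (\<lambda>i. if i = 0 then 0 else T)"
  by (auto simp: mesh_def incseq_def)

lemma sets_no_silent:
  assumes "0 \<le> T" "finite S"
  shows "no_silent T S \<in> events"
proof -
  note [measurable] = measurable_incr[OF mesh_single[OF assms(1)]]
  show ?thesis unfolding no_silent_def
    by (intro sets.sets_Collect_finite_All) (use assms in \<open>auto intro!: predE\<close>)
qed

lemma prob_no_silent:
  assumes "0 \<le> T" "finite S"
  shows "prob (no_silent T S) = (1 - exp (- T)) ^ card S"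
proof -
  have "(\<Prod>p\<in>S \<times> {0 :: nat}. 1 - exp (- ((if Suc (snd p) = 0 then 0 else T) - (if snd p = 0 then 0 else T)))) =
      (\<Prod>p\<in>S \<times> {0 :: nat}. 1 - exp (- T))"
    by (rule prod.cong) auto
  also have "\<dots> = (1 - exp (- T)) ^ card S" by (simp add: card_cartesian_product)
  finally show ?thesis
    unfolding no_silent_def
    using prob_incr_all_pos[OF mesh_single[OF assms(1)], of "S \<times> {0}"] assms(2) by simp
qed

text \<open>Off this event there is at most one ring in the box per interval, and on each side of
  the block of radius r some bond of the box stays silent up to the last mesh time.\<close>

definition bad :: "(nat \<Rightarrow> real) \<Rightarrow> nat \<Rightarrow> nat \<Rightarrow> nat \<Rightarrow> 'w set" where
  "bad \<tau> n L r = (\<Union>p\<in>{..<n} \<times> ({- int L..int L} \<times> {- int L..int L}). collision \<tau> (fst p) (snd p)) \<union>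
     (no_silent (\<tau> n) {- int L..- int r - 1} \<union> no_silent (\<tau> n) {int r + 1..int L})"

lemma sets_bad: "mesh \<tau> \<Longrightarrow> bad \<tau> n L r \<in> events"
  unfolding bad_def by (intro sets.Un sets.finite_UN sets_collision sets_no_silent mesh_nonneg) auto

text \<open>Union bound: each of the (2 L + 1)^2 pairs of bonds collides in an interval with
  probability at most h^2, and all L - r bonds of one side ring with probability
  \<open>(1 - exp (- \<tau> n)) ^ (L - r)\<close>.\<close>

lemma prob_bad:
  assumes \<tau>: "mesh \<tau>" and h: "\<And>i. i < n \<Longrightarrow> \<tau> (Suc i) - \<tau> i \<le> h" and rL: "r \<le> L"
  shows "prob (bad \<tau> n L r) \<le> real n * (real (2 * L + 1))\<^sup>2 * h\<^sup>2 + 2 * (1 - exp (- \<tau> n)) ^ (L - r)"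
proof -
  let ?I = "{..<n} \<times> ({- int L..int L} \<times> {- int L..int L})"
  have T: "0 \<le> \<tau> n" using mesh_nonneg[OF \<tau>] .
  have "prob (\<Union>p\<in>?I. collision \<tau> (fst p) (snd p)) \<le> (\<Sum>p\<in>?I. prob (collision \<tau> (fst p) (snd p)))"
    using sets_collision[OF \<tau>] by (intro finite_measure_subadditive_finite) auto
  also have "\<dots> \<le> (\<Sum>p\<in>?I. h\<^sup>2)"
  proof (rule sum_mono)
    fix p assume p: "p \<in> ?I"
    have "prob (collision \<tau> (fst p) (snd p)) \<le> (\<tau> (Suc (fst p)) - \<tau> (fst p))\<^sup>2" by (rule prob_collision[OF \<tau>])
    also have "\<dots> \<le> h\<^sup>2" using p h[of "fst p"] mesh_mono[OF \<tau>, of "fst p" "Suc (fst p)"] by (intro power_mono) auto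
    finally show "prob (collision \<tau> (fst p) (snd p)) \<le> h\<^sup>2" .
  qed
  also have "\<dots> = real n * (real (2 * L + 1))\<^sup>2 * h\<^sup>2"
    by (simp add: card_cartesian_product power2_eq_square algebra_simps)
  finally have 1: "prob (\<Union>p\<in>?I. collision \<tau> (fst p) (snd p)) \<le> real n * (real (2 * L + 1))\<^sup>2 * h\<^sup>2" .
  have c: "card {- int L..- int r - 1} = L - r" "card {int r + 1..int L} = L - r" using rL by auto
  have 2: "prob (no_silent (\<tau> n) {- int L..- int r - 1} \<union> no_silent (\<tau> n) {int r + 1..int L}) \<le> 2 * (1 - exp (- \<tau> n)) ^ (L - r)"
    using measure_Un_le[OF sets_no_silent[OF T, of "{- int L..- int r - 1}"] sets_no_silent[OF T, of "{int r + 1..int L}"]]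
    unfolding prob_no_silent[OF T finite_atLeastAtMost_int] c by simp
  have "prob (bad \<tau> n L r) \<le> prob (\<Union>p\<in>?I. collision \<tau> (fst p) (snd p)) +
      prob (no_silent (\<tau> n) {- int L..- int r - 1} \<union> no_silent (\<tau> n) {int r + 1..int L})"
    unfolding bad_def using sets_collision[OF \<tau>] sets_no_silent[OF T]
    by (intro measure_Un_le sets.finite_UN sets.Un) auto
  with 1 2 show ?thesis by simp
qed

definition rung :: "(nat \<Rightarrow> real) \<Rightarrow> nat \<Rightarrow> nat \<Rightarrow> 'w \<Rightarrow> bool" where
  "rung \<tau> L q \<omega> \<longleftrightarrow> incr \<tau> (bond L q, q div (2 * L + 1)) \<omega> > 0"

definition box_chain :: "(nat \<Rightarrow> real) \<Rightarrow> nat \<Rightarrow> nat \<Rightarrow> 'w \<Rightarrow> int \<Rightarrow> real" where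
  "box_chain \<tau> L q \<omega> = chain (bond L) (\<lambda>q. rung \<tau> L q \<omega>) q"

text \<open>A realisation outside \<open>bad\<close> provides the two silent shields and the
  single-ring property that the deterministic comparison asks for.\<close>

lemma box_chain_agrees:
  assumes \<tau>: "mesh \<tau>"
  shows "AE \<omega> in M. \<omega> \<notin> bad \<tau> n L r \<longrightarrow>
    (\<forall>i\<le>n. \<forall>x. \<bar>x\<bar> \<le> int r \<longrightarrow> box_chain \<tau> L (i * (2 * L + 1)) \<omega> x = \<eta> (\<tau> i) x \<omega>)"
  using AE_trajectory AE_space
proof eventually_elim
  case (elim \<omega>)
  then interpret averaging_trajectory "\<lambda>x t. K x t \<omega>" "\<lambda>t x. \<eta> t x \<omega>" by simp
  show ?case
  proof (intro impI allI)
    fix i x assume ok: "\<omega> \<notin> bad \<tau> n L r" and i: "i \<le> n" and x: "\<bar>x\<bar> \<le> int r"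
    have nocoll: "\<omega> \<notin> collision \<tau> i (x, y)" if "i < n" "\<bar>x\<bar> \<le> int L" "\<bar>y\<bar> \<le> int L" for i x y
      using ok that unfolding bad_def by (force simp: abs_le_iff)
    have zero: "K x (\<tau> n) \<omega> = K x 0 \<omega>" if "\<not> incr (\<lambda>i. if i = 0 then 0 else \<tau> n) (x, 0) \<omega> > 0" for x
      using that regular_count_mono[OF regular, of 0 "\<tau> n" x] mesh_nonneg[OF \<tau>] by (simp add: incr_def)
    have "\<omega> \<notin> no_silent (\<tau> n) {- int L..- int r - 1}" using ok by (simp add: bad_def)
    then obtain l where l: "- int L \<le> l" "l \<le> - int r - 1" "K l (\<tau> n) \<omega> = K l 0 \<omega>"
      using elim(2) zero unfolding no_silent_def by auto
    have "\<omega> \<notin> no_silent (\<tau> n) {int r + 1..int L}" using ok by (simp add: bad_def)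
    then obtain r' where r': "r' \<le> int L" "int r + 1 \<le> r'" "K r' (\<tau> n) \<omega> = K r' 0 \<omega>"
      using elim(2) zero unfolding no_silent_def by auto
    show "box_chain \<tau> L (i * (2 * L + 1)) \<omega> x = \<eta> (\<tau> i) x \<omega>"
      unfolding box_chain_def rung_def incr_def fst_conv snd_conv
    proof (rule chain_agrees[where n=n and l=l and r=r'])
      show "incseq \<tau>" "\<tau> 0 = 0" using \<tau> by (auto simp: mesh_def)
      show "\<And>i x. i < n \<Longrightarrow> \<bar>x\<bar> \<le> int L \<Longrightarrow> K x (\<tau> (Suc i)) \<omega> - K x (\<tau> i) \<omega> < 2"
        using nocoll elim(2) by (fastforce simp: collision_def incr_def)
      show "\<not> (0 < K x (\<tau> (Suc i)) \<omega> - K x (\<tau> i) \<omega> \<and> 0 < K y (\<tau> (Suc i)) \<omega> - K y (\<tau> i) \<omega>)"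
        if "i < n" "\<bar>x\<bar> \<le> int L" "\<bar>y\<bar> \<le> int L" "x \<noteq> y" for i x y
        using nocoll[OF that(1-3)] that(4) elim(2) by (simp add: collision_def incr_def)
    qed (use elim(1) l r' i x in auto)
  qed
qed

text \<open>The order of choices matters. L is fixed first and makes the shielding term small,
  whatever the mesh; refining the mesh then makes the collision term of order 1/n.\<close>

lemma prob_bad_mesh2:
  assumes sd: "0 \<le> s" "0 \<le> d" and \<epsilon>: "0 < \<epsilon>"
  obtains L where "r < L" "eventually (\<lambda>n. n > 0 \<and> prob (bad (mesh2 s d n) (n + n) L r) \<le> \<epsilon>) sequentially"
proof -
  have "(\<lambda>k. (1 - exp (- (s + d))) ^ k) \<longlonglongrightarrow> 0"
    using sd by (intro LIMSEQ_power_zero) auto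
  then have "eventually (\<lambda>k. (1 - exp (- (s + d))) ^ k < \<epsilon> / 4) sequentially"
    using \<epsilon> by (intro order_tendstoD) auto
  then obtain k0 where k0: "\<And>k. k \<ge> k0 \<Longrightarrow> (1 - exp (- (s + d))) ^ k < \<epsilon> / 4"
    by (auto simp: eventually_sequentially)
  define L where "L = Suc (r + k0)"
  let ?C = "2 * (real (2 * L + 1))\<^sup>2 * (s + d)\<^sup>2"
  have "(\<lambda>n. ?C / real n) \<longlonglongrightarrow> 0"
    by (rule lim_const_over_n)
  then have "eventually (\<lambda>n. ?C / real n < \<epsilon> / 2) sequentially"
    using \<epsilon> by (intro order_tendstoD) auto
  then have "eventually (\<lambda>n. n > 0 \<and> prob (bad (mesh2 s d n) (n + n) L r) \<le> \<epsilon>) sequentially"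
    using eventually_gt_at_top[of 0]
  proof eventually_elim
    case (elim n)
    have "prob (bad (mesh2 s d n) (n + n) L r) \<le>
        real (n + n) * (real (2 * L + 1))\<^sup>2 * ((s + d) / real n)\<^sup>2 + 2 * (1 - exp (- mesh2 s d n (n + n))) ^ (L - r)"
    proof (rule prob_bad)
      show "mesh (mesh2 s d n)" using incseq_mesh2[OF sd] elim by (simp add: mesh_def mesh2_simps)
      show "mesh2 s d n (Suc i) - mesh2 s d n i \<le> (s + d) / real n" for i
        using mesh2_simps(4,5)[OF elim(2), of i s d] sd by (cases "i < n") (auto simp: divide_right_mono)
    qed (simp add: L_def)
    also have "real (n + n) * (real (2 * L + 1))\<^sup>2 * ((s + d) / real n)\<^sup>2 = ?C / real n"
      using elim by (simp add: power2_eq_square)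
    also have "2 * (1 - exp (- mesh2 s d n (n + n))) ^ (L - r) \<le> \<epsilon> / 2"
      using k0[of "L - r"] elim by (simp add: mesh2_simps L_def)
    finally show ?case using elim by simp
  qed
  moreover have "r < L" by (simp add: L_def)
  ultimately show ?thesis using that by blast
qed

lemma mesh_mesh2: "0 \<le> s \<Longrightarrow> 0 \<le> d \<Longrightarrow> 0 < n \<Longrightarrow> mesh (mesh2 s d n)"
  using incseq_mesh2 by (simp add: mesh_def mesh2_simps)

text \<open>The chain satisfies the bound, and the profile agrees with the chain on F outside an
  event of arbitrarily small probability.\<close>

lemma AE_sum_eta_le:
  assumes s: "0 \<le> s" and F: "finite F"
  shows "AE \<omega> in M. (\<forall>x. 0 \<le> \<eta> s x \<omega>) \<and> (\<Sum>x\<in>F. \<eta> s x \<omega>) \<le> 1"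
proof -
  have nn: "AE \<omega> in M. \<forall>x. 0 \<le> \<eta> s x \<omega>"
    using AE_trajectory s by (auto simp: averaging_trajectory_def averaging_path_def)
  define r where "r = nat (Max (insert 0 (abs ` F)))"
  have r: "\<bar>x\<bar> \<le> int r" if "x \<in> F" for x
  proof -
    have "\<bar>x\<bar> \<le> Max (insert 0 (abs ` F))" using that F by (intro Max_ge) auto
    then show ?thesis unfolding r_def by linarith
  qed
  define B where "B = {\<omega>\<in>space M. \<not> (\<Sum>x\<in>F. \<eta> s x \<omega>) \<le> 1}"
  have B: "B \<in> events" unfolding B_def using s by measurable
  have "prob B \<le> \<epsilon>" if "\<epsilon> > 0" for \<epsilon>
  proof -
    obtain L where L: "r < L" "eventually (\<lambda>n. n > 0 \<and> prob (bad (mesh2 s 1 n) (n + n) L r) \<le> \<epsilon>) sequentially"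
      using prob_bad_mesh2[of s 1 \<epsilon> r] s \<open>\<epsilon> > 0\<close> by auto
    then obtain n where n: "n > 0" "prob (bad (mesh2 s 1 n) (n + n) L r) \<le> \<epsilon>"
      using eventually_happens[OF L(2)] by auto
    have mesh: "mesh (mesh2 s 1 n)" using s n by (intro mesh_mesh2) auto
    have "AE \<omega> in M. \<omega> \<in> B \<longrightarrow> \<omega> \<in> bad (mesh2 s 1 n) (n + n) L r"
      using box_chain_agrees[OF mesh, of "n + n" L r]
    proof eventually_elim
      case (elim \<omega>)
      show ?case
      proof (rule impI, rule ccontr)
        assume \<omega>: "\<omega> \<in> B" "\<omega> \<notin> bad (mesh2 s 1 n) (n + n) L r"
        have "\<eta> s x \<omega> = box_chain (mesh2 s 1 n) L (n * (2 * L + 1)) \<omega> x" if "x \<in> F" for x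
          using elim[rule_format, OF \<omega>(2), of n x] r[OF that] n by (simp add: mesh2_simps)
        then have "(\<Sum>x\<in>F. \<eta> s x \<omega>) \<le> 1"
          using chain_sum_le[OF F] by (simp add: box_chain_def)
        then show False using \<omega> by (simp add: B_def)
      qed
    qed
    then have "prob B \<le> prob (bad (mesh2 s 1 n) (n + n) L r)"
      by (intro finite_measure_mono_AE sets_bad mesh) auto
    then show ?thesis using n by simp
  qed
  then have "prob B \<le> 0" by (rule field_le_epsilon[of _ 0, simplified])
  then have "B \<in> null_sets M" using B by (simp add: emeasure_eq_measure null_sets_def measure_le_0_iff)
  then have "AE \<omega> in M. \<omega> \<notin> B" by (rule AE_not_in)
  with nn AE_space show ?thesis by eventually_elim (simp add: B_def)
qed

lemma AE_eta_bounds: "0 \<le> s \<Longrightarrow> AE \<omega> in M. 0 \<le> \<eta> s x \<omega> \<and> \<eta> s x \<omega> \<le> 1"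
  using AE_sum_eta_le[of s "{x}"] by (auto elim: eventually_mono)

section \<open>Differentiability of the two-point function\<close>

definition m2 :: "real \<Rightarrow> int \<Rightarrow> int \<Rightarrow> real" where
  "m2 s x y = expectation (\<lambda>\<omega>. \<eta> s x \<omega> * \<eta> s y \<omega>)"

lemma AE_eta_prod_bounds:
  assumes "0 \<le> s"
  shows "AE \<omega> in M. 0 \<le> \<eta> s x \<omega> * \<eta> s y \<omega> \<and> \<eta> s x \<omega> * \<eta> s y \<omega> \<le> 1"
  using AE_eta_bounds[OF assms, of x] AE_eta_bounds[OF assms, of y]
  by eventually_elim (auto intro: mult_le_one)

lemma integrable_eta_prod:
  assumes "0 \<le> s"
  shows "integrable M (\<lambda>\<omega>. \<eta> s x \<omega> * \<eta> s y \<omega>)"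
  by (rule integrable_const_bound[where B=1])
    (use AE_eta_prod_bounds[OF assms, of x y] assms in \<open>auto elim: eventually_mono\<close>)

lemma m2_bounds:
  assumes "0 \<le> s"
  shows "0 \<le> m2 s x y" "m2 s x y \<le> 1"
proof -
  show "0 \<le> m2 s x y" unfolding m2_def
    using AE_eta_prod_bounds[OF assms, of x y] by (intro integral_nonneg_AE) (auto elim: eventually_mono)
  show "m2 s x y \<le> 1" unfolding m2_def
    using AE_eta_prod_bounds[OF assms, of x y] by (intro integral_le_const integrable_eta_prod assms) (auto elim: eventually_mono)
qed

lemma m2_sym: "m2 s x y = m2 s y x"
  by (simp add: m2_def mult.commute)

lemma m2_0: "m2 0 x y = (if x = 0 \<and> y = 0 then 1 else 0)"
proof -
  have "AE \<omega> in M. \<eta> 0 x \<omega> * \<eta> 0 y \<omega> = (if x = 0 \<and> y = 0 then 1 else 0)"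
    using AE_trajectory by eventually_elim simp
  then have "m2 0 x y = expectation (\<lambda>\<omega>. if x = 0 \<and> y = 0 then 1 else 0)"
    unfolding m2_def by (intro integral_cong_AE) auto
  then show ?thesis by (simp add: prob_space)
qed

definition mu :: "(nat \<Rightarrow> real) \<Rightarrow> nat \<Rightarrow> nat \<Rightarrow> int \<Rightarrow> int \<Rightarrow> real" where
  "mu \<tau> L q x y = expectation (\<lambda>\<omega>. box_chain \<tau> L q \<omega> x * box_chain \<tau> L q \<omega> y)"

lemma measurable_rung: "mesh \<tau> \<Longrightarrow> rung \<tau> L q \<in> measurable M (count_space UNIV)"
  unfolding rung_def[abs_def] by measurable

lemma integrable_box_chain:
  assumes "mesh \<tau>"
  shows "integrable M (\<lambda>\<omega>. box_chain \<tau> L q \<omega> x * box_chain \<tau> L q \<omega> y)"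
proof (rule integrable_const_bound[where B=1])
  show "(\<lambda>\<omega>. box_chain \<tau> L q \<omega> x * box_chain \<tau> L q \<omega> y) \<in> borel_measurable M"
    unfolding box_chain_def by (rule borel_measurable_chain[of _ _ "\<lambda>c. c x * c y"]) (rule measurable_rung[OF assms])
qed (auto simp: box_chain_def abs_mult chain_nonneg chain_le_1 intro!: mult_le_one)

lemma mu_bounds:
  assumes "mesh \<tau>"
  shows "0 \<le> mu \<tau> L q x y" "mu \<tau> L q x y \<le> 1"
proof -
  show "0 \<le> mu \<tau> L q x y" unfolding mu_def
    by (intro integral_nonneg_AE AE_I2) (simp add: box_chain_def chain_nonneg)
  show "mu \<tau> L q x y \<le> 1" unfolding mu_def
    by (intro integral_le_const integrable_box_chain assms AE_I2)
      (simp add: box_chain_def chain_nonneg chain_le_1 mult_le_one)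
qed

text \<open>Quotient and remainder recover q from its interval and its bond, so distinct updates are
  driven by distinct increments.\<close>

lemma indep_rung:
  assumes "mesh \<tau>"
  shows "indep_vars (\<lambda>_. count_space UNIV) (rung \<tau> L) I"
proof -
  let ?f = "\<lambda>q. (bond L q, q div (2 * L + 1))"
  have inj: "inj_on ?f I"
  proof (rule inj_onI)
    fix a b assume "?f a = ?f b"
    then have "a mod (2 * L + 1) = b mod (2 * L + 1)" "a div (2 * L + 1) = b div (2 * L + 1)"
      by (simp_all add: bond_def del: add_2_eq_Suc' One_nat_def)
    then show "a = b" by (metis div_mult_mod_eq)
  qed
  have "indep_vars (\<lambda>_. count_space UNIV) (incr \<tau>) (?f ` I)"
    by (rule indep_vars_subset[OF indep_incr[OF assms]]) auto
  from indep_vars_inj_reindex[OF inj this]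
  have "indep_vars (\<lambda>_. count_space UNIV) (\<lambda>q. incr \<tau> (?f q)) I" .
  from indep_vars_compose2[OF this, of "\<lambda>_ k. k > 0" "\<lambda>_. count_space UNIV"]
  show ?thesis by (simp add: rung_def[abs_def])
qed

lemma mu_Suc:
  assumes \<tau>: "mesh \<tau>" and p: "1 - exp (- (\<tau> (Suc (q div (2 * L + 1))) - \<tau> (q div (2 * L + 1)))) = p"
  shows "mu \<tau> L (Suc q) x y = (1 - p) * mu \<tau> L q x y + p * avg2 (bond L q) (mu \<tau> L q) x y"
proof -
  let ?f = "\<lambda>c :: int \<Rightarrow> real. c x * c y"
  \<comment> \<open>\<open>expectation_chain_Suc\<close> asks for a function that is bounded on all
    configurations. The truncated product is, and it agrees with the product on the values of the
    chain and on their averages.\<close>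
  let ?g = "\<lambda>c :: int \<Rightarrow> real. max (-1) (min 1 (c x * c y))"
  let ?b = "bond L q"
  let ?X = "box_chain \<tau> L q"
  have clip: "?g (chain bd u j) = ?f (chain bd u j)" for bd u j
    using chain_nonneg[of bd u j x] chain_nonneg[of bd u j y] chain_le_1[of bd u j x] chain_le_1[of bd u j y]
    by (simp add: mult_le_one max_def min_def) (smt (verit) mult_le_one mult_nonneg_nonneg)
  have avg01: "0 \<le> average_bond b (chain bd u j) x" "average_bond b (chain bd u j) x \<le> 1" for b bd u j x
    using chain_nonneg[of bd u j] chain_le_1[of bd u j]
    by (auto simp: average_bond_apply) (smt (verit))+
  have clip': "?g (average_bond b (chain bd u j)) = ?f (average_bond b (chain bd u j))" for b bd u j
    using avg01[of b bd u j x] avg01[of b bd u j y]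
    by (simp add: max_def min_def) (smt (verit) mult_le_one mult_nonneg_nonneg)
  have pq: "prob {\<omega>\<in>space M. rung \<tau> L q \<omega>} = p"
    using prob_incr_pos[OF \<tau>] p by (simp add: rung_def)
  have "expectation (\<lambda>\<omega>. ?g (box_chain \<tau> L (Suc q) \<omega>)) = (1 - p) * expectation (\<lambda>\<omega>. ?g (?X \<omega>)) +
      p * expectation (\<lambda>\<omega>. ?g (average_bond ?b (?X \<omega>)))"
    unfolding box_chain_def
    by (rule expectation_chain_Suc[OF indep_rung[OF \<tau>] _ pq, where B=1]) auto
  then have "mu \<tau> L (Suc q) x y = (1 - p) * mu \<tau> L q x y + p * expectation (\<lambda>\<omega>. ?f (average_bond ?b (?X \<omega>)))"
    by (simp only: box_chain_def clip clip' mu_def)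
  also have "expectation (\<lambda>\<omega>. ?f (average_bond ?b (?X \<omega>))) = avg2 ?b (mu \<tau> L q) x y"
  proof -
    note int = integrable_box_chain[OF \<tau>, of L q]
    have lin: "expectation (\<lambda>\<omega>. ?X \<omega> x' * average_bond ?b (?X \<omega>) y) = average_bond ?b (mu \<tau> L q x') y \<and>
        integrable M (\<lambda>\<omega>. ?X \<omega> x' * average_bond ?b (?X \<omega>) y)" for x'
    proof (cases "y = ?b \<or> y = ?b + 1")
      case True
      have "(\<lambda>\<omega>. ?X \<omega> x' * average_bond ?b (?X \<omega>) y) =
         (\<lambda>\<omega>. (?X \<omega> x' * ?X \<omega> ?b + ?X \<omega> x' * ?X \<omega> (?b + 1)) / 2)"
        using True by (auto simp: fun_eq_iff average_bond_apply algebra_simps)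
      moreover have "average_bond ?b (mu \<tau> L q x') y = (mu \<tau> L q x' ?b + mu \<tau> L q x' (?b + 1)) / 2"
        using True by (auto simp: average_bond_apply)
      ultimately show ?thesis using int[of x' ?b] int[of x' "?b + 1"] by (simp add: mu_def)
    next
      case False
      then show ?thesis using int[of x' y] by (simp add: average_bond_apply mu_def)
    qed
    show ?thesis
    proof (cases "x = ?b \<or> x = ?b + 1")
      case True
      have "(\<lambda>\<omega>. ?f (average_bond ?b (?X \<omega>))) =
         (\<lambda>\<omega>. (?X \<omega> ?b * average_bond ?b (?X \<omega>) y + ?X \<omega> (?b + 1) * average_bond ?b (?X \<omega>) y) / 2)"
        using True by (auto simp: fun_eq_iff average_bond_apply[of _ _ x] algebra_simps)
      moreover have "avg2 ?b (mu \<tau> L q) x y = (average_bond ?b (mu \<tau> L q ?b) y + average_bond ?b (mu \<tau> L q (?b + 1)) y) / 2"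
        using True by (auto simp: avg2_def average_bond_apply[of _ _ x])
      ultimately show ?thesis using lin[of ?b] lin[of "?b + 1"] by simp
    next
      case False
      then show ?thesis using lin[of x] by (simp add: avg2_def average_bond_apply[of _ _ x])
    qed
  qed
  finally show ?thesis .
qed

text \<open>Both products lie between 0 and 1 and coincide outside \<open>bad\<close>, so they
  differ by at most its indicator.\<close>

lemma m2_close_mu:
  assumes s: "0 \<le> s" and \<tau>: "mesh \<tau>" and i: "i \<le> n" "\<tau> i = s"
    and xy: "\<bar>x\<bar> \<le> int r" "\<bar>y\<bar> \<le> int r"
  shows "\<bar>m2 s x y - mu \<tau> L (i * (2 * L + 1)) x y\<bar> \<le> prob (bad \<tau> n L r)"
proof -
  let ?X = "\<lambda>\<omega>. \<eta> s x \<omega> * \<eta> s y \<omega>"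
  let ?Y = "\<lambda>\<omega>. box_chain \<tau> L (i * (2 * L + 1)) \<omega> x * box_chain \<tau> L (i * (2 * L + 1)) \<omega> y"
  have bad: "bad \<tau> n L r \<in> events" by (rule sets_bad[OF \<tau>])
  note int = integrable_eta_prod[OF s, of x y] integrable_box_chain[OF \<tau>, of L "i * (2 * L + 1)" x y]
  have Y: "0 \<le> ?Y \<omega> \<and> ?Y \<omega> \<le> 1" for \<omega>
    by (simp add: box_chain_def chain_nonneg chain_le_1 mult_le_one)
  have "\<bar>m2 s x y - mu \<tau> L (i * (2 * L + 1)) x y\<bar> = \<bar>expectation (\<lambda>\<omega>. ?X \<omega> - ?Y \<omega>)\<bar>"
    unfolding m2_def mu_def using int by simp
  also have "\<dots> \<le> expectation (\<lambda>\<omega>. \<bar>?X \<omega> - ?Y \<omega>\<bar>)"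
    by (rule integral_abs_bound)
  also have "\<dots> \<le> expectation (indicator (bad \<tau> n L r))"
  proof (rule integral_mono_AE)
    show "integrable M (\<lambda>\<omega>. \<bar>?X \<omega> - ?Y \<omega>\<bar>)" using int by (intro integrable_abs Bochner_Integration.integrable_diff)
    show "integrable M (indicator (bad \<tau> n L r) :: 'w \<Rightarrow> real)" using bad by (intro integrable_real_indicator) (auto simp: emeasure_eq_measure)
    show "AE \<omega> in M. \<bar>?X \<omega> - ?Y \<omega>\<bar> \<le> indicator (bad \<tau> n L r) \<omega>"
      using box_chain_agrees[OF \<tau>, of n L r] AE_eta_prod_bounds[OF s, of x y]
    proof eventually_elim
      case (elim \<omega>)
      show ?case
      proof (cases "\<omega> \<in> bad \<tau> n L r")
        case True
        then show ?thesis using elim(2) Y[of \<omega>] by (simp add: abs_le_iff)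
      next
        case False
        then have "?Y \<omega> = ?X \<omega>" using elim(1) i xy by simp
        then show ?thesis by simp
      qed
    qed
  qed
  also have "\<dots> = prob (bad \<tau> n L r)" using bad sets.sets_into_space[OF bad] by (simp add: Int_absorb1 Int_absorb2)
  finally show ?thesis .
qed

text \<open>The mesh is refined while d stays fixed. The approximation errors vanish, and only the
  second order error of \<open>euler_sweeps\<close> remains, which does not depend on the
  box.\<close>

lemma m2_increment:
  assumes s: "0 \<le> s" and d: "0 \<le> d"
  shows "\<bar>m2 (s + d) x y - m2 s x y - d * gen (m2 s) x y\<bar> \<le> 32 * d\<^sup>2"
proof (rule field_le_epsilon)
  fix e :: real assume e: "0 < e"
  \<comment> \<open>The errors collected at the end amount to (3 + 8 d) \<epsilon>.\<close>
  define \<epsilon> where "\<epsilon> = e / (4 + 8 * d)"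
  have \<epsilon>: "0 < \<epsilon>" using e d by (simp add: \<epsilon>_def)
  define r where "r = nat (max \<bar>x\<bar> \<bar>y\<bar>) + 1"
  have r: "\<bar>x'\<bar> \<le> int r" "\<bar>y'\<bar> \<le> int r" if "\<bar>x' - x\<bar> \<le> 1" "\<bar>y' - y\<bar> \<le> 1" for x' y'
    using that unfolding r_def by linarith+
  obtain L where L: "r < L" and ev: "eventually (\<lambda>n. n > 0 \<and> prob (bad (mesh2 s d n) (n + n) L r) \<le> \<epsilon>) sequentially"
    using prob_bad_mesh2[OF s d \<epsilon>, of r] by blast
  have "(\<lambda>n. 8 * d\<^sup>2 / real n) \<longlonglongrightarrow> 0" by (rule lim_const_over_n)
  then have "eventually (\<lambda>n. 8 * d\<^sup>2 / real n < \<epsilon>) sequentially" using \<epsilon> by (intro order_tendstoD) auto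
  with ev have "eventually (\<lambda>n. (n > 0 \<and> prob (bad (mesh2 s d n) (n + n) L r) \<le> \<epsilon>) \<and> 8 * d\<^sup>2 / real n < \<epsilon>) sequentially"
    by (rule eventually_conj)
  from eventually_happens[OF this] obtain n where n: "n > 0" "prob (bad (mesh2 s d n) (n + n) L r) \<le> \<epsilon>" "8 * d\<^sup>2 / real n < \<epsilon>"
    by auto
  let ?\<tau> = "mesh2 s d n" and ?w = "2 * L + 1"
  have \<tau>: "mesh ?\<tau>" by (rule mesh_mesh2[OF s d n(1)])
  let ?m = "mu ?\<tau> L"
  have A: "\<bar>m2 s x' y' - ?m (n * ?w) x' y'\<bar> \<le> \<epsilon>" if "\<bar>x' - x\<bar> \<le> 1" "\<bar>y' - y\<bar> \<le> 1" for x' y'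
    using m2_close_mu[OF s \<tau>, of n "n + n" x' r y' L] r[OF that] n by (simp add: mesh2_simps)
  have B: "\<bar>m2 (s + d) x y - ?m ((n + n) * ?w) x y\<bar> \<le> \<epsilon>"
    using m2_close_mu[of "s + d" ?\<tau> "n + n" "n + n" x r y L] \<tau> s d r[of x y] n by (simp add: mesh2_simps)
  define p where "p = 1 - exp (- (d / real n))"
  have p0: "0 \<le> p" using d by (simp add: p_def)
  have np: "real n * p \<le> d" "d - d\<^sup>2 / real n \<le> real n * p"
  proof -
    have "p \<le> d / real n" unfolding p_def using exp_ge_add_one_self[of "- (d / real n)"] by linarith
    then show "real n * p \<le> d" using n by (simp add: field_simps)
    have "d / real n - (d / real n)\<^sup>2 \<le> p" unfolding p_def using d by (intro one_minus_exp_ge) simp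
    then have "real n * (d / real n - (d / real n)\<^sup>2) \<le> real n * p" by (intro mult_left_mono) auto
    then show "d - d\<^sup>2 / real n \<le> real n * p" using n by (simp add: power2_eq_square algebra_simps)
  qed
  have euler: "\<bar>?m ((n + n) * ?w) x y - ?m (n * ?w) x y - real n * p * gen (?m (n * ?w)) x y\<bar> \<le> 32 * (real n * p)\<^sup>2"
  proof (rule euler_sweeps)
    fix q x y assume q: "n * ?w \<le> q" "q < (n + n) * ?w"
    have "n * ?w div ?w = n" by (rule nonzero_mult_div_cancel_right) simp
    then have "n \<le> q div ?w" using div_le_mono[OF q(1), of ?w] by argo
    then show "?m (Suc q) x y = (1 - p) * ?m q x y + p * avg2 (bond L q) (?m q) x y"
      using n by (intro mu_Suc[OF \<tau>]) (simp add: mesh2_simps p_def)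
  next
    show "\<bar>x\<bar> < int L" "\<bar>y\<bar> < int L" using r[of x y] L by auto
  qed (use mu_bounds[OF \<tau>] p0 in auto)
  have g: "\<bar>gen (m2 s) x y - gen (?m (n * ?w)) x y\<bar> \<le> 8 * \<epsilon>"
    by (rule gen_close) (rule A)
  have g8: "\<bar>gen (?m (n * ?w)) x y\<bar> \<le> 8"
    by (rule gen_bound) (rule mu_bounds[OF \<tau>])+
  have "\<bar>d * gen (m2 s) x y - real n * p * gen (?m (n * ?w)) x y\<bar> \<le> d * (8 * \<epsilon>) + \<epsilon>"
  proof -
    have "d * gen (m2 s) x y - real n * p * gen (?m (n * ?w)) x y =
        d * (gen (m2 s) x y - gen (?m (n * ?w)) x y) + (d - real n * p) * gen (?m (n * ?w)) x y"
      by (simp add: algebra_simps)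
    moreover have "\<bar>d * (gen (m2 s) x y - gen (?m (n * ?w)) x y)\<bar> \<le> d * (8 * \<epsilon>)"
      using g d by (simp add: abs_mult mult_left_mono)
    moreover have "\<bar>(d - real n * p) * gen (?m (n * ?w)) x y\<bar> \<le> (d\<^sup>2 / real n) * 8"
      unfolding abs_mult using np g8 by (intro mult_mono) auto
    moreover have "d\<^sup>2 / real n * 8 < \<epsilon>" using n(3) by (simp add: mult.commute)
    ultimately show ?thesis by linarith
  qed
  moreover have "32 * (real n * p)\<^sup>2 \<le> 32 * d\<^sup>2" using np p0 by (intro mult_left_mono power_mono) auto
  moreover have "\<bar>m2 s x y - ?m (n * ?w) x y\<bar> \<le> \<epsilon>" using A[of x y] by simp
  ultimately have "\<bar>m2 (s + d) x y - m2 s x y - d * gen (m2 s) x y\<bar> \<le> 32 * d\<^sup>2 + (\<epsilon> + \<epsilon> + (d * (8 * \<epsilon>) + \<epsilon>))"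
    using B euler by linarith
  also have "\<epsilon> + \<epsilon> + (d * (8 * \<epsilon>) + \<epsilon>) \<le> (4 + 8 * d) * \<epsilon>" using \<epsilon> by (simp add: algebra_simps)
  also have "\<dots> = e" using d by (simp add: \<epsilon>_def)
  finally show "\<bar>m2 (s + d) x y - m2 s x y - d * gen (m2 s) x y\<bar> \<le> 32 * d\<^sup>2 + e" by simp
qed

text \<open>To the right of s this is the increment estimate at s. To the left the estimate starts
  from u < s and involves \<open>gen (m2 u)\<close>; the Lipschitz constant 40 moves the generator
  to s at the cost 8 * 40, whence 352 = 32 + 320.\<close>

theorem m2_derivative:
  assumes s: "0 \<le> s"
  shows "((\<lambda>u. m2 u x y) has_real_derivative gen (m2 s) x y) (at s within {0..})"
proof -
  have lip: "\<bar>m2 (u + d) a b - m2 u a b\<bar> \<le> 40 * d" if "0 \<le> u" "0 \<le> d" "d \<le> 1" for u d a b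
  proof -
    have "\<bar>d * gen (m2 u) a b\<bar> \<le> d * 8"
      using gen_bound[of "m2 u" a b] m2_bounds[OF that(1)] that(2) by (simp add: abs_mult mult_left_mono)
    moreover have "32 * d\<^sup>2 \<le> 32 * d" using that by (simp add: power2_eq_square mult_left_le)
    ultimately show ?thesis using m2_increment[OF that(1,2), of a b] by linarith
  qed
  have bound: "\<bar>m2 u x y - m2 s x y - gen (m2 s) x y * (u - s)\<bar> \<le> 352 * (u - s)\<^sup>2" if u: "0 \<le> u" "\<bar>u - s\<bar> \<le> 1" for u
  proof (cases "s \<le> u")
    case True
    then show ?thesis using m2_increment[OF s, of "u - s" x y] 
      zero_le_power2[of "u - s"] by (simp add: mult.commute)
  next
    case False
    let ?d = "s - u"
    have d: "0 \<le> ?d" "?d \<le> 1" using False u by auto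
    have "\<bar>gen (m2 s) x y - gen (m2 u) x y\<bar> \<le> 8 * (40 * ?d)"
      using lip[OF u(1) d] by (intro gen_close) simp
    then have "\<bar>?d * gen (m2 s) x y - ?d * gen (m2 u) x y\<bar> \<le> ?d * (8 * (40 * ?d))"
      unfolding right_diff_distrib[symmetric] abs_mult using d by (intro mult_mono) auto
    moreover have "\<bar>m2 s x y - m2 u x y - ?d * gen (m2 u) x y\<bar> \<le> 32 * ?d\<^sup>2"
      using m2_increment[OF u(1) d(1), of x y] by simp
    moreover have "?d * (8 * (40 * ?d)) = 320 * ?d\<^sup>2" by (simp add: power2_eq_square)
    moreover have "(u - s)\<^sup>2 = ?d\<^sup>2" by (rule power2_commute)
    moreover have "gen (m2 s) x y * (u - s) = - (?d * gen (m2 s) x y)" by (simp add: algebra_simps)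
    ultimately show ?thesis by linarith
  qed
  show ?thesis
    unfolding has_field_derivative_iff
  proof (rule tendstoI)
    fix e :: real assume e: "0 < e"
    have "eventually (\<lambda>u. u \<in> {0..} \<and> u \<noteq> s \<and> \<bar>u - s\<bar> < min 1 (e / 352)) (at s within {0..})"
      unfolding eventually_at using e by (intro exI[of _ "min 1 (e / 352)"]) (auto simp: dist_real_def)
    then show "eventually (\<lambda>u. dist ((m2 u x y - m2 s x y) / (u - s)) (gen (m2 s) x y) < e) (at s within {0..})"
    proof eventually_elim
      case (elim u)
      then have "\<bar>(m2 u x y - m2 s x y) / (u - s) - gen (m2 s) x y\<bar> = \<bar>m2 u x y - m2 s x y - gen (m2 s) x y * (u - s)\<bar> / \<bar>u - s\<bar>"
        by (simp add: abs_divide[symmetric] diff_divide_distrib)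
      also have "\<dots> \<le> 352 * (u - s)\<^sup>2 / \<bar>u - s\<bar>"
        using bound[of u] elim by (intro divide_right_mono) auto
      also have "\<dots> = 352 * \<bar>u - s\<bar>"
      proof -
        have "(u - s)\<^sup>2 = \<bar>u - s\<bar> * \<bar>u - s\<bar>" by (simp add: power2_eq_square)
        then show ?thesis using elim by (simp del: abs_mult_self_eq)
      qed
      also have "\<dots> < e" using elim by simp
      finally show ?case by (simp add: dist_real_def)
    qed
  qed
qed

end

section \<open>Rapidly decaying functions on the square lattice\<close>

no_notation Infinite_Set_Sum.abs_summable_on (infix "abs'_summable'_on" 50)

definition nrm :: "int \<Rightarrow> int \<Rightarrow> real" where "nrm x y = \<bar>of_int x\<bar> + \<bar>of_int y\<bar>"

text \<open>\<open>tame\<close> functions are the admissible weights and \<open>rapid\<close>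
  functions the admissible densities: a product of the two is \<open>rapid\<close>, hence summable.
  The constants are uniform over the times in \<open>A\<close>, as differentiation under the sum
  requires.\<close>

definition tame :: "real set \<Rightarrow> (real \<Rightarrow> int \<Rightarrow> int \<Rightarrow> real) \<Rightarrow> bool" where
  "tame A F \<longleftrightarrow> (\<exists>C B. \<forall>s\<in>A. \<forall>x y. \<bar>F s x y\<bar> \<le> C * exp (B * nrm x y))"

definition rapid :: "real set \<Rightarrow> (real \<Rightarrow> int \<Rightarrow> int \<Rightarrow> real) \<Rightarrow> bool" where
  "rapid A F \<longleftrightarrow> (\<forall>D. \<exists>C. \<forall>s\<in>A. \<forall>x y. \<bar>F s x y\<bar> \<le> C * exp (- D * nrm x y))"

lemma nrm_nonneg: "0 \<le> nrm x y" by (simp add: nrm_def)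

lemma nrm_shift: "nrm (x + i) (y + j) \<le> nrm x y + nrm i j" "nrm x y \<le> nrm (x + i) (y + j) + nrm i j"
  by (auto simp: nrm_def)

lemma tameI: "(\<And>s x y. s \<in> A \<Longrightarrow> \<bar>F s x y\<bar> \<le> C * exp (B * nrm x y)) \<Longrightarrow> tame A F"
  unfolding tame_def by blast

lemma tameE:
  assumes "tame A F"
  obtains C B where "0 \<le> C" "0 \<le> B" "\<And>s x y. s \<in> A \<Longrightarrow> \<bar>F s x y\<bar> \<le> C * exp (B * nrm x y)"
proof -
  obtain C B where CB: "\<And>s x y. s \<in> A \<Longrightarrow> \<bar>F s x y\<bar> \<le> C * exp (B * nrm x y)"
    using assms unfolding tame_def by blast
  show ?thesis
  proof (rule that[of "max 0 C" "max 0 B"])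
    fix s x y assume "s \<in> A"
    then have "\<bar>F s x y\<bar> \<le> C * exp (B * nrm x y)" by (rule CB)
    also have "\<dots> \<le> max 0 C * exp (max 0 B * nrm x y)"
      by (intro mult_mono) (auto intro: mult_right_mono nrm_nonneg)
    finally show "\<bar>F s x y\<bar> \<le> max 0 C * exp (max 0 B * nrm x y)" .
  qed auto
qed

lemma rapidE:
  assumes "rapid A F"
  obtains C where "\<And>s x y. s \<in> A \<Longrightarrow> \<bar>F s x y\<bar> \<le> C * exp (- D * nrm x y)"
  using assms unfolding rapid_def by metis

lemma tame_subset: "tame A F \<Longrightarrow> A' \<subseteq> A \<Longrightarrow> tame A' F"
  unfolding tame_def by blast

lemma rapid_subset: "rapid A F \<Longrightarrow> A' \<subseteq> A \<Longrightarrow> rapid A' F"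
  unfolding rapid_def by blast

lemma tame_bounded: "(\<And>s x y. s \<in> A \<Longrightarrow> \<bar>F s x y\<bar> \<le> C) \<Longrightarrow> tame A F"
  by (rule tameI[of _ _ C 0]) simp

lemma tame_add [intro]:
  assumes "tame A F" "tame A G"
  shows "tame A (\<lambda>s x y. F s x y + G s x y)"
proof -
  from tameE[OF assms(1)] obtain C B where F: "0 \<le> C" "0 \<le> B" "\<And>s x y. s \<in> A \<Longrightarrow> \<bar>F s x y\<bar> \<le> C * exp (B * nrm x y)" by blast
  from tameE[OF assms(2)] obtain C' B' where G: "0 \<le> C'" "0 \<le> B'" "\<And>s x y. s \<in> A \<Longrightarrow> \<bar>G s x y\<bar> \<le> C' * exp (B' * nrm x y)" by blast
  show ?thesis
  proof (rule tameI)
    fix s x y assume s: "s \<in> A"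
    have "C * exp (B * nrm x y) \<le> C * exp ((B + B') * nrm x y)" "C' * exp (B' * nrm x y) \<le> C' * exp ((B + B') * nrm x y)"
      using F G nrm_nonneg[of x y] by (auto intro!: mult_left_mono mult_right_mono)
    then show "\<bar>F s x y + G s x y\<bar> \<le> (C + C') * exp ((B + B') * nrm x y)"
      using F(3)[OF s, of x y] G(3)[OF s, of x y] by (simp add: ring_distribs)
  qed
qed

lemma tame_mult [intro]:
  assumes "tame A F" "tame A G"
  shows "tame A (\<lambda>s x y. F s x y * G s x y)"
proof -
  from tameE[OF assms(1)] obtain C B where F: "0 \<le> C" "0 \<le> B" "\<And>s x y. s \<in> A \<Longrightarrow> \<bar>F s x y\<bar> \<le> C * exp (B * nrm x y)" by blast
  from tameE[OF assms(2)] obtain C' B' where G: "0 \<le> C'" "0 \<le> B'" "\<And>s x y. s \<in> A \<Longrightarrow> \<bar>G s x y\<bar> \<le> C' * exp (B' * nrm x y)" by blast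
  show ?thesis
  proof (rule tameI)
    fix s x y assume s: "s \<in> A"
    have "\<bar>F s x y * G s x y\<bar> \<le> (C * exp (B * nrm x y)) * (C' * exp (B' * nrm x y))"
      unfolding abs_mult using F G s by (intro mult_mono) auto
    then show "\<bar>F s x y * G s x y\<bar> \<le> (C * C') * exp ((B + B') * nrm x y)"
      by (simp add: ring_distribs exp_add mult_ac)
  qed
qed

lemma tame_const [intro]: "tame A (\<lambda>s x y. c)" by (rule tame_bounded[of _ _ "\<bar>c\<bar>"]) simp

lemma tame_minus [intro]: "tame A F \<Longrightarrow> tame A (\<lambda>s x y. - F s x y)" by (simp add: tame_def)

lemma tame_diff [intro]: "tame A F \<Longrightarrow> tame A G \<Longrightarrow> tame A (\<lambda>s x y. F s x y - G s x y)"
  using tame_add[OF _ tame_minus, of A F G] by simp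

lemma tame_shift:
  assumes "tame A F"
  shows "tame A (\<lambda>s x y. F s (x + i) (y + j))"
proof -
  from tameE[OF assms(1)] obtain C B where F: "0 \<le> C" "0 \<le> B" "\<And>s x y. s \<in> A \<Longrightarrow> \<bar>F s x y\<bar> \<le> C * exp (B * nrm x y)" by blast
  show ?thesis
  proof (rule tameI)
    fix s x y assume s: "s \<in> A"
    have "\<bar>F s (x + i) (y + j)\<bar> \<le> C * exp (B * nrm (x + i) (y + j))" by (rule F(3)[OF s])
    also have "\<dots> \<le> C * exp (B * (nrm x y + nrm i j))"
      using F nrm_shift by (intro mult_left_mono) (auto intro!: mult_left_mono)
    also have "\<dots> = (C * exp (B * nrm i j)) * exp (B * nrm x y)" by (simp add: ring_distribs exp_add)
    finally show "\<bar>F s (x + i) (y + j)\<bar> \<le> (C * exp (B * nrm i j)) * exp (B * nrm x y)" .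
  qed
qed

lemma tame_exp: "tame A (\<lambda>s x y. exp (a * of_int x + b * of_int y))"
proof (rule tameI)
  fix s x y
  have "a * of_int x \<le> max \<bar>a\<bar> \<bar>b\<bar> * \<bar>of_int x\<bar>"
    by (rule order.trans[OF abs_ge_self]) (simp add: abs_mult mult_right_mono)
  moreover have "b * of_int y \<le> max \<bar>a\<bar> \<bar>b\<bar> * \<bar>of_int y\<bar>"
    by (rule order.trans[OF abs_ge_self]) (simp add: abs_mult mult_right_mono)
  ultimately show "\<bar>exp (a * of_int x + b * of_int y)\<bar> \<le> 1 * exp (max \<bar>a\<bar> \<bar>b\<bar> * nrm x y)"
    by (simp add: nrm_def ring_distribs)
qed

lemma tame_of_int: "tame A (\<lambda>s x y. of_int x)" "tame A (\<lambda>s x y. of_int y)"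
proof -
  have *: "\<bar>of_int x\<bar> \<le> exp (nrm x y) \<and> \<bar>of_int y\<bar> \<le> exp (nrm x y)" for x y
    using exp_ge_add_one_self[of "nrm x y"] unfolding nrm_def by linarith
  show "tame A (\<lambda>s x y. of_int x)" "tame A (\<lambda>s x y. of_int y)"
    using * by (auto intro!: tameI[of _ _ 1 1])
qed

lemma rapid_add [intro]:
  assumes "rapid A F" "rapid A G"
  shows "rapid A (\<lambda>s x y. F s x y + G s x y)"
  unfolding rapid_def
proof
  fix D
  from rapidE[OF assms(1)] obtain C where F: "\<And>s x y. s \<in> A \<Longrightarrow> \<bar>F s x y\<bar> \<le> C * exp (- D * nrm x y)" by blast
  from rapidE[OF assms(2)] obtain C' where G: "\<And>s x y. s \<in> A \<Longrightarrow> \<bar>G s x y\<bar> \<le> C' * exp (- D * nrm x y)" by blast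
  show "\<exists>C. \<forall>s\<in>A. \<forall>x y. \<bar>F s x y + G s x y\<bar> \<le> C * exp (- D * nrm x y)"
  proof (intro exI ballI allI)
    fix s x y assume s: "s \<in> A"
    show "\<bar>F s x y + G s x y\<bar> \<le> (C + C') * exp (- D * nrm x y)"
      using F[OF s, of x y] G[OF s, of x y] by (simp add: ring_distribs)
  qed
qed

lemma rapid_mult [intro]:
  assumes "rapid A F" "tame A G"
  shows "rapid A (\<lambda>s x y. F s x y * G s x y)"
  unfolding rapid_def
proof
  fix D
  from tameE[OF assms(2)] obtain C' B' where G: "0 \<le> C'" "0 \<le> B'" "\<And>s x y. s \<in> A \<Longrightarrow> \<bar>G s x y\<bar> \<le> C' * exp (B' * nrm x y)" by blast
  from rapidE[OF assms(1)] obtain C where F: "\<And>s x y. s \<in> A \<Longrightarrow> \<bar>F s x y\<bar> \<le> C * exp (- (D + B') * nrm x y)" by blast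
  show "\<exists>C. \<forall>s\<in>A. \<forall>x y. \<bar>F s x y * G s x y\<bar> \<le> C * exp (- D * nrm x y)"
  proof (intro exI ballI allI)
    fix s x y assume s: "s \<in> A"
    have "\<bar>F s x y * G s x y\<bar> \<le> (C * exp (- (D + B') * nrm x y)) * (C' * exp (B' * nrm x y))"
      unfolding abs_mult using F[OF s, of x y] G(3)[OF s, of x y] by (intro mult_mono) (auto intro: order.trans[OF abs_ge_zero])
    also have "\<dots> = (C * C') * exp (- D * nrm x y)"
      by (simp add: mult_ac exp_add[symmetric] ring_distribs)
    finally show "\<bar>F s x y * G s x y\<bar> \<le> (C * C') * exp (- D * nrm x y)" .
  qed
qed

lemma rapid_minus [intro]: "rapid A F \<Longrightarrow> rapid A (\<lambda>s x y. - F s x y)" by (simp add: rapid_def)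

lemma rapid_diff [intro]: "rapid A F \<Longrightarrow> rapid A G \<Longrightarrow> rapid A (\<lambda>s x y. F s x y - G s x y)"
  using rapid_add[OF _ rapid_minus, of A F G] by simp

lemma rapid_cmult [intro]: "rapid A F \<Longrightarrow> rapid A (\<lambda>s x y. c * F s x y)"
  using rapid_mult[OF _ tame_const, of A F c] by (simp add: mult.commute)

lemma rapid_shift:
  assumes "rapid A F"
  shows "rapid A (\<lambda>s x y. F s (x + i) (y + j))"
  unfolding rapid_def
proof
  fix D
  from rapidE[OF assms(1)] obtain C where F: "\<And>s x y. s \<in> A \<Longrightarrow> \<bar>F s x y\<bar> \<le> C * exp (- max 0 D * nrm x y)" by blast
  show "\<exists>C. \<forall>s\<in>A. \<forall>x y. \<bar>F s (x + i) (y + j)\<bar> \<le> C * exp (- D * nrm x y)"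
  proof (intro exI ballI allI)
    fix s x y assume s: "s \<in> A"
    have C: "0 \<le> C" using F[OF s, of x y] by (metis abs_ge_zero exp_gt_zero order.trans zero_le_mult_iff less_le_not_le)
    have "\<bar>F s (x + i) (y + j)\<bar> \<le> C * exp (- max 0 D * nrm (x + i) (y + j))" by (rule F[OF s])
    also have "\<dots> \<le> C * exp (- max 0 D * (nrm x y - nrm i j))"
      using C nrm_shift(2)[of x y i j] by (intro mult_left_mono) (auto intro!: mult_left_mono)
    also have "\<dots> = (C * exp (max 0 D * nrm i j)) * exp (- max 0 D * nrm x y)" by (simp add: ring_distribs exp_add[symmetric])
    also have "\<dots> \<le> (C * exp (max 0 D * nrm i j)) * exp (- D * nrm x y)"
      using C nrm_nonneg[of x y] by (intro mult_left_mono) (auto intro!: mult_right_mono)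
    finally show "\<bar>F s (x + i) (y + j)\<bar> \<le> (C * exp (max 0 D * nrm i j)) * exp (- D * nrm x y)" .
  qed
qed

lemma summable_on_exp_abs: "(\<lambda>x::int. exp (- \<bar>of_int x :: real\<bar>)) summable_on UNIV"
proof -
  have "(\<lambda>n. exp (- real n)) summable_on UNIV"
  proof (rule norm_summable_imp_summable_on)
    have "(\<lambda>n. norm (exp (- real n))) = (\<lambda>n. (exp (-1)) ^ n)" by (simp add: fun_eq_iff exp_of_nat_mult[symmetric])
    then show "summable (\<lambda>n. norm (exp (- real n)))" by (simp add: summable_geometric)
  qed
  then have 1: "(\<lambda>x. exp (- \<bar>of_int x :: real\<bar>)) summable_on (range int)"
    and 2: "(\<lambda>x. exp (- \<bar>of_int x :: real\<bar>)) summable_on (range (\<lambda>n. - int n))"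
    by (subst summable_on_reindex, auto simp: inj_on_def comp_def)+
  have "(UNIV :: int set) = range int \<union> range (\<lambda>n. - int n)"
    by (auto simp: image_iff) (metis int_cases2)
  then show ?thesis using summable_on_Un_disjoint[OF 1, of "range (\<lambda>n. - int n) - range int"] summable_on_subset_banach[OF 2]
    by (metis Diff_disjoint Diff_subset Un_Diff_cancel)
qed

lemma summable_on_exp_nrm: "(\<lambda>p. exp (- nrm (fst p) (snd p))) summable_on UNIV"
proof -
  let ?e = "\<lambda>x::int. exp (- \<bar>of_int x :: real\<bar>)"
  have eq: "(\<lambda>p. exp (- nrm (fst p) (snd p))) = (\<lambda>p. ?e (fst p) * ?e (snd p))"
    by (simp add: fun_eq_iff nrm_def exp_add[symmetric])
  have e: "?e summable_on UNIV" by (rule summable_on_exp_abs)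
  have "(\<lambda>p. ?e (fst p) * ?e (snd p)) abs_summable_on (Sigma UNIV (\<lambda>_. UNIV))"
    unfolding Infinite_Sum.abs_summable_on_Sigma_iff
  proof (intro conjI ballI)
    fix x :: int
    show "(\<lambda>y. ?e (fst (x, y)) * ?e (snd (x, y))) abs_summable_on UNIV"
      using e by (auto intro!: summable_on_cmult_right simp: abs_mult)
  next
    have 0: "(\<lambda>x. ?e x * infsum ?e UNIV) summable_on UNIV" by (intro summable_on_cmult_left e)
    have 1: "(\<Sum>\<^sub>\<infinity>y. norm (?e (fst (x, y)) * ?e (snd (x, y)))) = ?e x * infsum ?e UNIV" for x :: int
      by (simp add: abs_mult infsum_cmult_right')
    have 2: "norm (?e x * infsum ?e UNIV) = ?e x * infsum ?e UNIV" for x :: int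
      unfolding real_norm_def by (intro abs_of_nonneg mult_nonneg_nonneg infsum_nonneg) simp_all
    show "(\<lambda>x. \<Sum>\<^sub>\<infinity>y. norm (?e (fst (x, y)) * ?e (snd (x, y)))) abs_summable_on UNIV"
      unfolding 1 2 by (rule 0)
  qed
  from abs_summable_summable[OF this] show ?thesis unfolding eq by simp
qed

lemma rapid_bound:
  assumes "rapid A F"
  obtains C where "0 \<le> C" "\<And>s x y. s \<in> A \<Longrightarrow> \<bar>F s x y\<bar> \<le> C * exp (- nrm x y)"
proof -
  from rapidE[OF assms(1)] obtain C where C: "\<And>s x y. s \<in> A \<Longrightarrow> \<bar>F s x y\<bar> \<le> C * exp (- 1 * nrm x y)" by blast
  show ?thesis
  proof (rule that[of "max 0 C"])
    fix s x y assume "s \<in> A"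
    then have "\<bar>F s x y\<bar> \<le> C * exp (- nrm x y)" using C by simp
    also have "\<dots> \<le> max 0 C * exp (- nrm x y)" by (intro mult_right_mono) auto
    finally show "\<bar>F s x y\<bar> \<le> max 0 C * exp (- nrm x y)" .
  qed simp
qed

section \<open>Double sums and their derivatives in time\<close>

definition S2 :: "(int \<Rightarrow> int \<Rightarrow> real) \<Rightarrow> real" where
  "S2 f = (\<Sum>\<^sub>\<infinity>p\<in>UNIV. f (fst p) (snd p))"

lemma rapid_summable:
  assumes "rapid {s} F"
  shows "(\<lambda>p. F s (fst p) (snd p)) summable_on UNIV"
proof -
  obtain C where C: "0 \<le> C" "\<And>x y. \<bar>F s x y\<bar> \<le> C * exp (- nrm x y)"
    using rapid_bound[OF assms] by (metis singletonI)
  have "(\<lambda>p. F s (fst p) (snd p)) abs_summable_on UNIV"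
  proof (rule Infinite_Sum.abs_summable_on_comparison_test)
    show "(\<lambda>p. C * exp (- nrm (fst p) (snd p))) abs_summable_on UNIV"
      using summable_on_cmult_right[OF summable_on_exp_nrm, of C] C by (simp add: abs_mult)
  qed (use C in auto)
  then show ?thesis by (rule abs_summable_summable)
qed

lemma rapid_summable_line:
  assumes "rapid {s} F"
  shows "(\<lambda>x. F s (x + i) (x + j)) summable_on UNIV"
proof -
  have "inj (\<lambda>x::int. (x + i, x + j))" by (auto simp: inj_on_def)
  then show ?thesis
    using summable_on_subset_banach[OF rapid_summable[OF assms], of "range (\<lambda>x. (x + i, x + j))"]
    by (simp add: summable_on_reindex comp_def)
qed

lemma S2_add: "rapid {s} F \<Longrightarrow> rapid {s} G \<Longrightarrow> S2 (\<lambda>x y. F s x y + G s x y) = S2 (F s) + S2 (G s)"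
  unfolding S2_def by (intro infsum_add rapid_summable)

lemma S2_cmult: "S2 (\<lambda>x y. c * f x y) = c * S2 f"
  unfolding S2_def by (rule infsum_cmult_right')

lemma S2_diff:
  assumes "rapid {s} F" "rapid {s} G"
  shows "S2 (\<lambda>x y. F s x y - G s x y) = S2 (F s) - S2 (G s)"
  using S2_add[OF assms(1) rapid_cmult[OF assms(2), of "- 1"]] S2_cmult[of "- 1" "G s"] by simp

lemma S2_shift: "S2 (\<lambda>x y. f (x + i) (y + j)) = S2 f"
proof -
  have "bij_betw (\<lambda>p. (fst p + i, snd p + j)) (UNIV :: (int \<times> int) set) UNIV"
    by (rule bij_betwI[where g="\<lambda>p. (fst p - i, snd p - j)"]) auto
  from infsum_reindex_bij_betw[OF this, of "\<lambda>p. f (fst p) (snd p)"]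
  show ?thesis by (simp add: S2_def)
qed

lemma S2_mono:
  assumes "rapid {s} F" "rapid {s} G" "\<And>x y. F s x y \<le> G s x y"
  shows "S2 (F s) \<le> S2 (G s)"
  unfolding S2_def by (intro infsum_mono rapid_summable assms)

lemma S2_nonneg: "(\<And>x y. 0 \<le> f x y) \<Longrightarrow> 0 \<le> S2 f"
  unfolding S2_def by (rule infsum_nonneg)

lemma S2_line: "S2 (\<lambda>x y. if y = x + k then f x y else 0) = (\<Sum>\<^sub>\<infinity>x. f x (x + k))"
proof -
  have inj: "inj (\<lambda>x::int. (x, x + k))" by (auto simp: inj_on_def)
  have "S2 (\<lambda>x y. if y = x + k then f x y else 0) = (\<Sum>\<^sub>\<infinity>p\<in>range (\<lambda>x. (x, x + k)). f (fst p) (snd p))"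
    unfolding S2_def by (rule infsum_cong_neutral) auto
  also have "\<dots> = (\<Sum>\<^sub>\<infinity>x. f x (x + k))"
    by (subst infsum_reindex[OF inj]) (simp add: comp_def)
  finally show ?thesis .
qed

lemma infsum_shift_int: "(\<Sum>\<^sub>\<infinity>x::int. f (x + k)) = (\<Sum>\<^sub>\<infinity>x. f x)"
proof -
  have "bij_betw (\<lambda>x::int. x + k) UNIV UNIV" by (rule bij_betwI[where g="\<lambda>x. x - k"]) auto
  from infsum_reindex_bij_betw[OF this] show ?thesis .
qed

text \<open>The lattice is enumerated by the naturals, and the Weierstrass test is applied to the
  series of derivatives, dominated by a multiple of \<open>exp (- nrm x y)\<close> uniformly in
  time.\<close>

lemma S2_has_derivative:
  assumes T: "0 < T"
    and deriv: "\<And>s x y. s \<in> {0..T} \<Longrightarrow> ((\<lambda>s. F s x y) has_real_derivative F' s x y) (at s within {0..T})"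
    and F: "rapid {0..T} F" and F': "rapid {0..T} F'" and s: "s \<in> {0..T}"
  shows "((\<lambda>s. S2 (F s)) has_real_derivative S2 (F' s)) (at s within {0..T})"
proof -
  define e :: "nat \<Rightarrow> int \<times> int" where "e = from_nat_into UNIV"
  have e: "bij e" unfolding e_def
    by (rule bij_betw_from_nat_into) (auto simp: infinite_UNIV_char_0 finite_prod)
  from rapid_bound[OF F] obtain C where C: "0 \<le> C" "\<And>s x y. s \<in> {0..T} \<Longrightarrow> \<bar>F s x y\<bar> \<le> C * exp (- nrm x y)" by blast
  obtain C' where C': "0 \<le> C'" "\<And>s x y. s \<in> {0..T} \<Longrightarrow> \<bar>F' s x y\<bar> \<le> C' * exp (- nrm x y)" by (rule rapid_bound[OF F']) blast
  let ?f = "\<lambda>n s. F s (fst (e n)) (snd (e n))" and ?f' = "\<lambda>n s. F' s (fst (e n)) (snd (e n))"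
  have E: "summable (\<lambda>n. K * exp (- nrm (fst (e n)) (snd (e n))))" for K
  proof -
    have "(\<lambda>n. exp (- nrm (fst (e n)) (snd (e n)))) summable_on UNIV"
      using summable_on_reindex_bij_betw[OF e, of "\<lambda>p. exp (- nrm (fst p) (snd p))"] summable_on_exp_nrm by simp
    then show ?thesis using summable_mult by (intro summable_mult) (rule summable_on_imp_summable)
  qed
  have sums: "(\<lambda>n. g (fst (e n)) (snd (e n))) sums S2 g" if "\<And>x y. \<bar>g x y\<bar> \<le> K * exp (- nrm x y)" for g K
  proof -
    have "summable (\<lambda>n. norm (g (fst (e n)) (snd (e n))))"
      by (rule summable_comparison_test'[OF E[of K]]) (use that in auto)
    from norm_summable_imp_has_sum[OF this summable_sums[OF summable_norm_cancel[OF this]]]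
    have "((\<lambda>n. g (fst (e n)) (snd (e n))) has_sum (\<Sum>n. g (fst (e n)) (snd (e n)))) UNIV" .
    then have "infsum (\<lambda>n. g (fst (e n)) (snd (e n))) UNIV = (\<Sum>n. g (fst (e n)) (snd (e n)))" by (rule infsumI)
    moreover have "infsum (\<lambda>n. g (fst (e n)) (snd (e n))) UNIV = S2 g"
      unfolding S2_def using infsum_reindex_bij_betw[OF e, of "\<lambda>p. g (fst p) (snd p)"] by simp
    ultimately show ?thesis
      using \<open>summable (\<lambda>n. norm (g (fst (e n)) (snd (e n))))\<close> summable_norm_cancel summable_sums by metis
  qed
  have ul: "uniform_limit {0..T} (\<lambda>n s. \<Sum>i<n. ?f' i s) (\<lambda>s. S2 (F' s)) sequentially"
  proof -
    have "uniform_limit {0..T} (\<lambda>n s. \<Sum>i<n. ?f' i s) (\<lambda>s. suminf (\<lambda>i. ?f' i s)) sequentially"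
      by (rule Weierstrass_m_test[OF _ E[of C']]) (use C' in auto)
    moreover have "suminf (\<lambda>i. ?f' i s) = S2 (F' s)" if "s \<in> {0..T}" for s
      using sums[of "F' s" C'] C'(2)[OF that] by (simp add: sums_iff)
    ultimately show ?thesis
      by (subst uniform_limit_cong'[where g="\<lambda>n s. \<Sum>i<n. ?f' i s" and i="\<lambda>s. suminf (\<lambda>i. ?f' i s)"]) simp_all
  qed
  obtain g where g: "\<And>s. s \<in> {0..T} \<Longrightarrow> (\<lambda>n. ?f n s) sums g s"
    "\<And>s. s \<in> {0..T} \<Longrightarrow> (g has_field_derivative S2 (F' s)) (at s within {0..T})"
  proof -
    have "\<exists>g. \<forall>s\<in>{0..T}. (\<lambda>n. ?f n s) sums g s \<and> (g has_field_derivative S2 (F' s)) (at s within {0..T})"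
    proof (rule has_field_derivative_series[OF _ _ ul, of _ 0])
      show "summable (\<lambda>n. ?f n 0)" using sums[of "F 0" C] C(2)[of 0] T by (simp add: sums_iff)
    qed (use deriv T in auto)
    then show ?thesis using that by blast
  qed
  have "g s = S2 (F s)" if "s \<in> {0..T}" for s
    using sums_unique2[OF g(1)[OF that] sums[of "F s" C]] C(2)[OF that] by simp
  then show ?thesis
    by (intro has_field_derivative_transform_within[OF g(2)[OF s] zero_less_one s])
qed

text \<open>The mixed second difference on the diagonal. For the two-point function of the profile
  it is the mean square of \<eta>(b) - \<eta>(b + 1), hence nonnegative; for a product g(x) g(y) it
  is the squared increment of g over the bond.\<close>

definition dd :: "(int \<Rightarrow> int \<Rightarrow> real) \<Rightarrow> int \<Rightarrow> real" where
  "dd m b = m b b + m (b + 1) (b + 1) - m b (b + 1) - m (b + 1) b"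

definition lap :: "(int \<Rightarrow> int \<Rightarrow> real) \<Rightarrow> int \<Rightarrow> int \<Rightarrow> real" where
  "lap m x y = (m (x + 1) y + m (x - 1) y + m x (y + 1) + m x (y - 1) - 4 * m x y) / 2"

text \<open>Walkers at distance at least two have no bond in common and move independently. At
  distance at most one a common bond acts on both, and the deviation from independent motion is a
  combination of values of \<open>dd\<close> at the common bonds.\<close>

lemma gen_eq:
  "gen m x y = lap m x y +
    (if y = x then (dd m x + dd m (x - 1)) / 4 else if y = x + 1 then - dd m x / 4
     else if y = x - 1 then - dd m (x - 1) / 4 else 0)"
proof -
  consider "y = x" | "y = x + 1" | "y = x - 1" | "y \<noteq> x" "y \<noteq> x + 1" "y \<noteq> x - 1" by blast
  then show ?thesis
  proof cases
    case 1
    then have "{x - 1, x, y - 1, y} = {x - 1, x}" by auto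
    then show ?thesis using 1
      by (simp add: gen_def lap_def dd_def avg2_def average_bond_apply field_simps)
  next
    case 2
    then have "{x - 1, x, y - 1, y} = {x - 1, x, x + 1}" by auto
    then show ?thesis using 2
      by (simp add: gen_def lap_def dd_def avg2_def average_bond_apply field_simps)
  next
    case 3
    then have "x = y + 1" by simp
    moreover from this have "{x - 1, x, y - 1, y} = {y - 1, y, y + 1}" by auto
    ultimately show ?thesis
      by (simp add: gen_def lap_def dd_def avg2_def average_bond_apply field_simps)
  next
    case 4
    then have "y - 1 \<noteq> x" "x - 1 \<noteq> y" "x \<noteq> y" "x - 1 \<noteq> y - 1" by auto
    then show ?thesis using 4
      by (simp add: gen_def lap_def avg2_def average_bond_apply field_simps)
  qed
qed

lemma tame_lap:
  assumes "tame A F" shows "tame A (\<lambda>s. lap (F s))"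
proof -
  have "tame A (\<lambda>s x y. (F s (x + 1) (y + 0) + F s (x + (-1)) (y + 0) + F s (x + 0) (y + 1) + F s (x + 0) (y + (-1)) - 4 * F s x y) * (1/2))"
    by (intro tame_mult tame_add tame_diff tame_const tame_shift assms)
  then show ?thesis by (simp add: lap_def[abs_def])
qed

lemma rapid_of_lines:
  assumes "rapid A F"
  shows "rapid A (\<lambda>s x y. if P x y then F s x y else 0)"
  using rapid_mult[OF assms tame_bounded[of A "\<lambda>s x y. if P x y then 1 else 0" 1]]
  by (simp add: if_distrib cong: if_cong)

lemma tame_dd:
  assumes "tame A F" shows "tame A (\<lambda>s x y. dd (F s) (x + i))"
proof -
  have *: "tame A (\<lambda>s x y. F s (x + j) (x + k))" for j k
  proof -
    obtain C B where F: "0 \<le> C" "0 \<le> B" "\<And>s x y. s \<in> A \<Longrightarrow> \<bar>F s x y\<bar> \<le> C * exp (B * nrm x y)"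
      using tameE[OF assms] by blast
    have "tame A (\<lambda>s x y. F s (x + 0) (x + 0))"
    proof (rule tameI)
      fix s x y assume s: "s \<in> A"
      have "\<bar>F s x x\<bar> \<le> C * exp (B * nrm x x)" by (rule F(3)[OF s])
      also have "\<dots> \<le> C * exp (2 * B * nrm x y)"
        using F by (intro mult_left_mono) (auto simp: nrm_def intro!: mult_left_mono)
      finally show "\<bar>F s (x + 0) (x + 0)\<bar> \<le> C * exp (2 * B * nrm x y)" by simp
    qed
    show ?thesis
    proof (rule tameI)
      fix s x y assume s: "s \<in> A"
      have "\<bar>F s (x + j) (x + k)\<bar> \<le> C * exp (B * nrm (x + j) (x + k))" by (rule F(3)[OF s])
      also have "\<dots> \<le> C * exp (B * (2 * nrm x y + nrm j k))"
        using F by (intro mult_left_mono) (auto simp: nrm_def intro!: mult_left_mono)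
      also have "\<dots> = (C * exp (B * nrm j k)) * exp (2 * B * nrm x y)" by (simp add: ring_distribs exp_add mult_ac)
      finally show "\<bar>F s (x + j) (x + k)\<bar> \<le> (C * exp (B * nrm j k)) * exp (2 * B * nrm x y)" .
    qed
  qed
  show ?thesis unfolding dd_def add.assoc by (intro tame_diff tame_add *)
qed

lemma rapid_dd_summable:
  assumes F: "rapid {s} F" and H: "tame {s} H"
  shows "(\<lambda>b. dd (F s) b * dd (H s) b) summable_on UNIV"
proof -
  have "rapid {s} (\<lambda>s x y. F s (x + i) (y + j) * dd (H s) (x + 0))" for i j
    by (intro rapid_mult rapid_shift F tame_dd H)
  from rapid_summable_line[OF this, where i=0 and j=0]
  have "(\<lambda>b. F s (b + i) (b + j) * dd (H s) b) summable_on UNIV" for i j by simp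
  note sm = this
  have neg: "(\<lambda>b. - (F s (b + i) (b + j) * dd (H s) b)) summable_on UNIV" for i j
    using sm[of i j] by (subst summable_on_uminus) simp
  from summable_on_add[OF summable_on_add[OF summable_on_add[OF sm[of 0 0] sm[of 1 1]] neg[of 0 1]] neg[of 1 0]]
  show ?thesis by (simp add: dd_def[of "F s"] algebra_simps)
qed

text \<open>
  Two walkers move independently except on a common bond, where both are resampled. The resulting
  interaction term is the product of the mixed second differences of \<open>F\<close> and \<open>H\<close> on the
  diagonal.
\<close>

lemma S2_gen:
  assumes F: "rapid {s} F" and H: "tame {s} H"
  shows "S2 (\<lambda>x y. gen (F s) x y * H s x y) =
    S2 (\<lambda>x y. F s x y * lap (H s) x y) + (\<Sum>\<^sub>\<infinity>b. dd (F s) b * dd (H s) b) / 4"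
proof -
  let ?F = "F s" and ?H = "H s"
  have sh: "S2 (\<lambda>x y. ?F (x + i) (y + j) * ?H x y) = S2 (\<lambda>x y. ?F x y * ?H (x - i) (y - j))" for i j
    using S2_shift[of "\<lambda>x y. ?F x y * ?H (x - i) (y - j)" i j] by simp
  have rF: "rapid {s} (\<lambda>s x y. F s (x + i) (y + j) * H s x y)" for i j
    by (intro rapid_mult rapid_shift F H)
  have rH: "rapid {s} (\<lambda>s x y. F s x y * H s (x + i) (y + j))" for i j
    by (intro rapid_mult tame_shift F H)
  have L1: "S2 (\<lambda>x y. lap ?F x y * ?H x y) = (S2 (\<lambda>x y. ?F (x + 1) (y + 0) * ?H x y) + S2 (\<lambda>x y. ?F (x + (- 1)) (y + 0) * ?H x y)
      + S2 (\<lambda>x y. ?F (x + 0) (y + 1) * ?H x y) + S2 (\<lambda>x y. ?F (x + 0) (y + (- 1)) * ?H x y) - 4 * S2 (\<lambda>x y. ?F (x + 0) (y + 0) * ?H x y)) * (1 / 2)"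
  proof -
    have "S2 (\<lambda>x y. lap ?F x y * ?H x y) = S2 (\<lambda>x y. 1 / 2 * (?F (x + 1) (y + 0) * ?H x y + ?F (x + (- 1)) (y + 0) * ?H x y
      + ?F (x + 0) (y + 1) * ?H x y + ?F (x + 0) (y + (- 1)) * ?H x y - 4 * (?F (x + 0) (y + 0) * ?H x y)))"
      by (simp add: lap_def field_simps)
    also have "\<dots> = 1 / 2 * (S2 (\<lambda>x y. ?F (x + 1) (y + 0) * ?H x y) + S2 (\<lambda>x y. ?F (x + (- 1)) (y + 0) * ?H x y)
      + S2 (\<lambda>x y. ?F (x + 0) (y + 1) * ?H x y) + S2 (\<lambda>x y. ?F (x + 0) (y + (- 1)) * ?H x y) - 4 * S2 (\<lambda>x y. ?F (x + 0) (y + 0) * ?H x y))"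
      unfolding S2_cmult
      by (subst S2_diff[of s "\<lambda>s x y. F s (x + 1) (y + 0) * H s x y + F s (x + (- 1)) (y + 0) * H s x y
      + F s (x + 0) (y + 1) * H s x y + F s (x + 0) (y + (- 1)) * H s x y" "\<lambda>s x y. 4 * (F s (x + 0) (y + 0) * H s x y)"],
        (intro rapid_add rapid_cmult rF)+,
        subst S2_add[of s "\<lambda>s x y. F s (x + 1) (y + 0) * H s x y + F s (x + (- 1)) (y + 0) * H s x y
      + F s (x + 0) (y + 1) * H s x y" "\<lambda>s x y. F s (x + 0) (y + (- 1)) * H s x y"], (intro rapid_add rF)+,
        subst S2_add[of s "\<lambda>s x y. F s (x + 1) (y + 0) * H s x y + F s (x + (- 1)) (y + 0) * H s x y"
        "\<lambda>s x y. F s (x + 0) (y + 1) * H s x y"], (intro rapid_add rF)+,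
        subst S2_add[of s "\<lambda>s x y. F s (x + 1) (y + 0) * H s x y" "\<lambda>s x y. F s (x + (- 1)) (y + 0) * H s x y"],
        (intro rF)+, simp add: S2_cmult)
    finally show ?thesis by simp
  qed
  have L2: "S2 (\<lambda>x y. ?F x y * lap ?H x y) = (S2 (\<lambda>x y. ?F x y * ?H (x + 1) (y + 0)) + S2 (\<lambda>x y. ?F x y * ?H (x + (- 1)) (y + 0))
      + S2 (\<lambda>x y. ?F x y * ?H (x + 0) (y + 1)) + S2 (\<lambda>x y. ?F x y * ?H (x + 0) (y + (- 1))) - 4 * S2 (\<lambda>x y. ?F x y * ?H (x + 0) (y + 0))) * (1 / 2)"
  proof -
    have "S2 (\<lambda>x y. ?F x y * lap ?H x y) = S2 (\<lambda>x y. 1 / 2 * (?F x y * ?H (x + 1) (y + 0) + ?F x y * ?H (x + (- 1)) (y + 0)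
      + ?F x y * ?H (x + 0) (y + 1) + ?F x y * ?H (x + 0) (y + (- 1)) - 4 * (?F x y * ?H (x + 0) (y + 0))))"
      by (simp add: lap_def field_simps)
    also have "\<dots> = 1 / 2 * (S2 (\<lambda>x y. ?F x y * ?H (x + 1) (y + 0)) + S2 (\<lambda>x y. ?F x y * ?H (x + (- 1)) (y + 0))
      + S2 (\<lambda>x y. ?F x y * ?H (x + 0) (y + 1)) + S2 (\<lambda>x y. ?F x y * ?H (x + 0) (y + (- 1))) - 4 * S2 (\<lambda>x y. ?F x y * ?H (x + 0) (y + 0)))"
      unfolding S2_cmult
      by (subst S2_diff[of s "\<lambda>s x y. F s x y * H s (x + 1) (y + 0) + F s x y * H s (x + (- 1)) (y + 0)
      + F s x y * H s (x + 0) (y + 1) + F s x y * H s (x + 0) (y + (- 1))" "\<lambda>s x y. 4 * (F s x y * H s (x + 0) (y + 0))"],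
        (intro rapid_add rapid_cmult rH)+,
        subst S2_add[of s "\<lambda>s x y. F s x y * H s (x + 1) (y + 0) + F s x y * H s (x + (- 1)) (y + 0)
      + F s x y * H s (x + 0) (y + 1)" "\<lambda>s x y. F s x y * H s (x + 0) (y + (- 1))"], (intro rapid_add rH)+,
        subst S2_add[of s "\<lambda>s x y. F s x y * H s (x + 1) (y + 0) + F s x y * H s (x + (- 1)) (y + 0)"
        "\<lambda>s x y. F s x y * H s (x + 0) (y + 1)"], (intro rapid_add rH)+,
        subst S2_add[of s "\<lambda>s x y. F s x y * H s (x + 1) (y + 0)" "\<lambda>s x y. F s x y * H s (x + (- 1)) (y + 0)"],
        (intro rH)+, simp add: S2_cmult)
    finally show ?thesis by simp
  qed
  \<comment> \<open>Summation by parts: translating the lattice moves the shifts from F to H, and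
    the symmetric operator returns to its own form.\<close>
  have L: "S2 (\<lambda>x y. lap ?F x y * ?H x y) = S2 (\<lambda>x y. ?F x y * lap ?H x y)"
    unfolding L1 L2 unfolding sh by (simp add: algebra_simps)
  have rdd: "rapid {s} (\<lambda>s x y. if y = x + k then dd (F s) (x + i) * H s x y else 0)" for k i
  proof -
    have "rapid {s} (\<lambda>s x y. if y = x + k then F s (x + a) (y + (b - k)) * H s x y else 0)" for a b
      by (intro rapid_of_lines rapid_mult rapid_shift F H)
    then have *: "rapid {s} (\<lambda>s x y. if y = x + k then F s (x + a) (x + b) * H s x y else 0)" for a b
      by (rule subst[where P="rapid {s}", rotated]) (auto simp: fun_eq_iff)
    have "rapid {s} (\<lambda>s x y. (if y = x + k then F s (x + i) (x + i) * H s x y else 0)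
       + (if y = x + k then F s (x + (i + 1)) (x + (i + 1)) * H s x y else 0)
       - (if y = x + k then F s (x + i) (x + (i + 1)) * H s x y else 0)
       - (if y = x + k then F s (x + (i + 1)) (x + i) * H s x y else 0))"
      by (intro rapid_diff rapid_add *)
    then show ?thesis
      by (rule subst[where P="rapid {s}", rotated]) (auto simp: fun_eq_iff dd_def algebra_simps)
  qed
  let ?t = "\<lambda>k i x y. if y = x + k then dd ?F (x + i) * ?H x y else 0"
  have line: "S2 (?t k i) = (\<Sum>\<^sub>\<infinity>b. dd ?F (b + i) * ?H b (b + k))" for k i
    by (rule S2_line)
  have sline: "(\<lambda>b. dd ?F (b + i) * ?H b (b + k)) summable_on UNIV" for k i
    using rapid_summable_line[OF rdd[of k i], where i=0 and j=k] by simp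
  have sline': "(\<lambda>b. dd ?F b * ?H (b + i) (b + j)) summable_on UNIV" for i j
  proof -
    have "bij_betw (\<lambda>x::int. x + i) UNIV UNIV" by (rule bij_betwI[where g="\<lambda>x. x - i"]) auto
    from summable_on_reindex_bij_betw[OF this, of "\<lambda>b. dd ?F (b + (- i)) * ?H b (b + (j - i))"]
    show ?thesis using sline[of "- i" "j - i"] by (simp add: add.assoc)
  qed
  have e: "S2 (\<lambda>x y. gen ?F x y * ?H x y) = S2 (\<lambda>x y. lap ?F x y * ?H x y) +
      (S2 (?t 0 0) + S2 (?t 0 (- 1)) - S2 (?t 1 0) - S2 (?t (- 1) (- 1))) * (1 / 4)"
  proof -
    have rl: "rapid {s} (\<lambda>s x y. lap (F s) x y * H s x y)"
    proof -
      have "rapid {s} (\<lambda>s x y. (1/2) * (F s (x + 1) (y + 0) * H s x y + F s (x + (- 1)) (y + 0) * H s x y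
      + F s (x + 0) (y + 1) * H s x y + F s (x + 0) (y + (- 1)) * H s x y - 4 * (F s (x + 0) (y + 0) * H s x y)))"
        by (intro rapid_cmult rapid_diff rapid_add rF)
      then show ?thesis by (rule subst[where P="rapid {s}", rotated]) (auto simp: fun_eq_iff lap_def field_simps)
    qed
    let ?u = "\<lambda>k i s x y. if y = x + k then dd (F s) (x + i) * H s x y else 0"
    have "S2 (\<lambda>x y. gen ?F x y * ?H x y) = S2 (\<lambda>x y. lap ?F x y * ?H x y + 1/4 * (?t 0 0 x y + ?t 0 (- 1) x y - ?t 1 0 x y - ?t (- 1) (- 1) x y))"
      by (rule arg_cong[where f=S2]) (auto simp: fun_eq_iff gen_eq algebra_simps)
    also have "\<dots> = S2 (\<lambda>x y. lap ?F x y * ?H x y) + S2 (\<lambda>x y. 1/4 * (?t 0 0 x y + ?t 0 (- 1) x y - ?t 1 0 x y - ?t (- 1) (- 1) x y))"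
      by (rule S2_add[OF rl]) (intro rapid_cmult rapid_diff rapid_add rdd)
    also have "\<dots> = S2 (\<lambda>x y. lap ?F x y * ?H x y) + 1/4 * S2 (\<lambda>x y. ?t 0 0 x y + ?t 0 (- 1) x y - ?t 1 0 x y - ?t (- 1) (- 1) x y)"
      by (simp only: S2_cmult)
    finally have e0: "S2 (\<lambda>x y. gen ?F x y * ?H x y) =
      S2 (\<lambda>x y. lap ?F x y * ?H x y) + 1/4 * S2 (\<lambda>x y. ?t 0 0 x y + ?t 0 (- 1) x y - ?t 1 0 x y - ?t (- 1) (- 1) x y)" .
    have e1: "S2 (\<lambda>x y. ?t 0 0 x y + ?t 0 (- 1) x y - ?t 1 0 x y - ?t (- 1) (- 1) x y) = S2 (\<lambda>x y. ?t 0 0 x y + ?t 0 (- 1) x y - ?t 1 0 x y) - S2 (?t (- 1) (- 1))"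
      by (rule S2_diff) (intro rapid_diff rapid_add rdd)+
    have e2: "S2 (\<lambda>x y. ?t 0 0 x y + ?t 0 (- 1) x y - ?t 1 0 x y) = S2 (\<lambda>x y. ?t 0 0 x y + ?t 0 (- 1) x y) - S2 (?t 1 0)"
      by (rule S2_diff) (intro rapid_diff rapid_add rdd)+
    have e3: "S2 (\<lambda>x y. ?t 0 0 x y + ?t 0 (- 1) x y) = S2 (?t 0 0) + S2 (?t 0 (- 1))"
      by (rule S2_add) (intro rdd)+
    show ?thesis unfolding e0 e1 e2 e3 by simp
  qed
  \<comment> \<open>The lines that carry \<open>dd\<close> at b - 1 are reindexed by one. All four
    lines then have the factor \<open>dd (F s) b\<close>, and the accompanying values of H assemble
    to \<open>dd (H s) b\<close>.\<close>
  have sh1: "(\<Sum>\<^sub>\<infinity>b. dd ?F (b + (- 1)) * ?H b (b + k)) = (\<Sum>\<^sub>\<infinity>b. dd ?F b * ?H (b + 1) (b + (k + 1)))" for k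
    using infsum_shift_int[of "\<lambda>b. dd ?F (b + (- 1)) * ?H b (b + k)" 1] by (simp add: add_ac)
  have "S2 (?t 0 0) + S2 (?t 0 (- 1)) - S2 (?t 1 0) - S2 (?t (- 1) (- 1)) =
     (\<Sum>\<^sub>\<infinity>b. dd ?F b * ?H (b + 0) (b + 0)) + (\<Sum>\<^sub>\<infinity>b. dd ?F b * ?H (b + 1) (b + 1))
      - (\<Sum>\<^sub>\<infinity>b. dd ?F b * ?H (b + 0) (b + 1)) - (\<Sum>\<^sub>\<infinity>b. dd ?F b * ?H (b + 1) (b + 0))"
    unfolding line sh1 by simp
  also have "\<dots> = (\<Sum>\<^sub>\<infinity>b. dd ?F b * dd ?H b)"
  proof -
    note hs = has_sum_infsum[OF sline']
    have "((\<lambda>b. dd ?F b * ?H (b + 0) (b + 0) + dd ?F b * ?H (b + 1) (b + 1)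
      + - (dd ?F b * ?H (b + 0) (b + 1)) + - (dd ?F b * ?H (b + 1) (b + 0))) has_sum
     ((\<Sum>\<^sub>\<infinity>b. dd ?F b * ?H (b + 0) (b + 0)) + (\<Sum>\<^sub>\<infinity>b. dd ?F b * ?H (b + 1) (b + 1))
      + - (\<Sum>\<^sub>\<infinity>b. dd ?F b * ?H (b + 0) (b + 1)) + - (\<Sum>\<^sub>\<infinity>b. dd ?F b * ?H (b + 1) (b + 0)))) UNIV"
      by (intro has_sum_add hs; simp only: has_sum_uminus minus_minus; rule hs)
    moreover have "(\<lambda>b. dd ?F b * ?H (b + 0) (b + 0) + dd ?F b * ?H (b + 1) (b + 1)
      + - (dd ?F b * ?H (b + 0) (b + 1)) + - (dd ?F b * ?H (b + 1) (b + 0))) = (\<lambda>b. dd ?F b * dd ?H b)"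
      by (simp add: fun_eq_iff dd_def[of ?H] algebra_simps)
    ultimately show ?thesis by (simp add: infsumI[symmetric])
  qed
  finally show ?thesis unfolding e L by simp
qed

lemma DERIV_within_nonneg_mono:
  fixes g :: "real \<Rightarrow> real"
  assumes d: "\<And>u. a \<le> u \<Longrightarrow> u \<le> b \<Longrightarrow> (g has_real_derivative g' u) (at u within {a..b})"
    and pos: "\<And>u. a \<le> u \<Longrightarrow> u \<le> b \<Longrightarrow> 0 \<le> g' u" and ab: "a \<le> b"
  shows "g a \<le> g b"
proof (cases "a = b")
  case False
  then have "a < b" using ab by simp
  then obtain x where x: "x \<in> {a<..<b}" "g b - g a = g' x * (b - a)"
    using mvt_simple[of a b g "\<lambda>x h. g' x * h"] d unfolding has_field_derivative_def by auto
  have "0 \<le> g' x * (b - a)" using x(1) pos[of x] ab by simp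
  with x(2) show ?thesis by linarith
qed simp

section \<open>Tilted two-point functions\<close>

text \<open>The interface between probability and analysis: the moment estimates in this locale rest
  on these properties and do not mention the clocks.\<close>

locale two_point =
  fixes m :: "real \<Rightarrow> int \<Rightarrow> int \<Rightarrow> real"
  assumes bounds: "\<And>s x y. 0 \<le> s \<Longrightarrow> 0 \<le> m s x y" "\<And>s x y. 0 \<le> s \<Longrightarrow> m s x y \<le> 1"
    and sym: "\<And>s x y. m s x y = m s y x"
    and init: "\<And>x y. m 0 x y = (if x = 0 \<and> y = 0 then 1 else 0)"
    and deriv: "\<And>s x y. 0 \<le> s \<Longrightarrow> ((\<lambda>u. m u x y) has_real_derivative gen (m s) x y) (at s within {0..})"
begin

text \<open>Induction on the distance from the origin. \<open>gen\<close> looks only one site away,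
  so at distance k + 1 its size is at most 8 times the bound for k; integration in time adds a power
  and a factor of the factorial.\<close>

lemma decay:
  assumes "0 \<le> s" "int k \<le> \<bar>x\<bar> \<or> int k \<le> \<bar>y\<bar>"
  shows "m s x y \<le> (8 * s) ^ k / fact k"
  using assms
proof (induction k arbitrary: s x y)
  case 0
  then show ?case using bounds by simp
next
  case (Suc k)
  define g where "g u = (8 * u) ^ Suc k / fact (Suc k) - m u x y" for u
  have dg: "(g has_real_derivative (8 * ((8 * u) ^ k / fact k) - gen (m u) x y)) (at u within {0..s})"
    if u: "0 \<le> u" "u \<le> s" for u
  proof -
    have "((\<lambda>u. m u x y) has_real_derivative gen (m u) x y) (at u within {0..s})"
      by (rule has_field_derivative_subset[OF deriv]) (use u in auto)
    moreover have "((\<lambda>u. (8 * u) ^ Suc k / fact (Suc k)) has_real_derivative real (Suc k) * (8 * u) ^ k * 8 / fact (Suc k)) (at u within {0..s})"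
    proof -
      have "((\<lambda>u. 8 * u) has_real_derivative 8) (at u within {0..s})" by (auto intro!: derivative_eq_intros)
      from DERIV_cdivide[OF DERIV_power[OF this, of "Suc k"], of "fact (Suc k)"]
      show ?thesis by (simp add: mult_ac del: power_Suc of_nat_Suc fact_Suc)
    qed
    ultimately have "(g has_real_derivative (real (Suc k) * (8 * u) ^ k * 8 / fact (Suc k) - gen (m u) x y)) (at u within {0..s})"
      unfolding g_def[abs_def] by (rule DERIV_diff[rotated])
    moreover have "real (Suc k) * (8 * u) ^ k * 8 / fact (Suc k) = 8 * ((8 * u) ^ k / fact k)"
      by (simp add: fact_Suc field_simps del: of_nat_Suc)
    ultimately show ?thesis by (simp only:)
  qed
  have pos: "0 \<le> 8 * ((8 * u) ^ k / fact k) - gen (m u) x y" if u: "0 \<le> u" "u \<le> s" for u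
  proof -
    have g0: "gen (\<lambda>_ _. 0) x y = 0" unfolding gen_def by (intro sum.neutral) (auto simp: avg2_def average_bond_apply)
    have "\<bar>gen (m u) x y - gen (\<lambda>_ _. 0) x y\<bar> \<le> 8 * ((8 * u) ^ k / fact k)"
    proof (rule gen_close)
      fix x' y' assume "\<bar>x' - x\<bar> \<le> 1" "\<bar>y' - y\<bar> \<le> 1"
      then have "int k \<le> \<bar>x'\<bar> \<or> int k \<le> \<bar>y'\<bar>" using Suc.prems(2) by auto
      then show "\<bar>m u x' y' - 0\<bar> \<le> (8 * u) ^ k / fact k"
        using Suc.IH[OF u(1)] bounds(1)[OF u(1)] by simp
    qed
    then show ?thesis using g0 by simp
  qed
  have "g 0 \<le> g s"
    by (rule DERIV_within_nonneg_mono[OF dg pos Suc.prems(1)])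
  moreover have "0 \<le> g 0" using Suc.prems(2) by (auto simp: g_def init)
  ultimately show ?case by (simp add: g_def)
qed

text \<open>The bound (8 T)^k / k! beats q^(-k) for every q, since (8 T q)^k / k! is a term of the
  series of \<open>exp (8 * T * q)\<close>. As k is the larger of the two distances,
  \<open>nrm x y\<close> is at most 2 k; this explains q =
  \<open>exp (2 * \<bar>D\<bar>)\<close>.\<close>

lemma rapid_m: "rapid {0..T} m"
  unfolding rapid_def
proof
  fix D :: real
  define q where "q = exp (2 * \<bar>D\<bar>)"
  show "\<exists>C. \<forall>s\<in>{0..T}. \<forall>x y. \<bar>m s x y\<bar> \<le> C * exp (- D * nrm x y)"
  proof (intro exI ballI allI)
    fix s x y assume s: "s \<in> {0..T}"
    define k where "k = nat (max \<bar>x\<bar> \<bar>y\<bar>)"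
    have q: "0 < q" by (simp add: q_def)
    have "m s x y \<le> (8 * s) ^ k / fact k"
      by (rule decay) (use s in \<open>auto simp: k_def\<close>)
    also have "\<dots> \<le> (8 * T) ^ k / fact k" using s by (intro divide_right_mono power_mono) auto
    also have "\<dots> = (8 * T * q) ^ k / fact k / q ^ k" using q by (simp add: power_mult_distrib)
    also have "\<dots> \<le> exp (8 * T * q) / q ^ k"
    proof (rule divide_right_mono)
      have "0 \<le> 8 * T * q" using s q by auto
      then have "(8 * T * q) ^ k /\<^sub>R fact k \<le> exp (8 * T * q)"
        using sums_unique[OF exp_converges[of "8 * T * q"]] sum_le_suminf[OF sums_summable[OF exp_converges[of "8 * T * q"]], of "{k}"]
        by simp
      then show "(8 * T * q) ^ k / fact k \<le> exp (8 * T * q)" by (simp add: divide_inverse mult.commute)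
    qed (use q in simp)
    also have "\<dots> = exp (8 * T * q) * exp (- (2 * \<bar>D\<bar> * real k))"
      by (simp add: q_def exp_minus divide_inverse exp_of_nat_mult[symmetric] mult.commute)
    also have "\<dots> \<le> exp (8 * T * q) * exp (- D * nrm x y)"
    proof -
      have "nrm x y \<le> 2 * real k" unfolding nrm_def k_def by simp
      then have "\<bar>D\<bar> * nrm x y \<le> \<bar>D\<bar> * (2 * real k)" by (intro mult_left_mono) auto
      moreover have "D * nrm x y \<le> \<bar>D\<bar> * nrm x y" by (intro mult_right_mono nrm_nonneg) auto
      ultimately show ?thesis by (simp add: mult_ac)
    qed
    finally show "\<bar>m s x y\<bar> \<le> exp (8 * T * q) * exp (- D * nrm x y)" using bounds(1)[of s x y] s by simp
  qed
qed

lemma rapid_at: "0 \<le> s \<Longrightarrow> rapid {s} m"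
  by (rule rapid_subset[OF rapid_m[of s]]) auto

lemma rapid_gen: "rapid {0..T} (\<lambda>s. gen (m s))"
proof -
  have *: "rapid {0..T} (\<lambda>s x y. if P x y then m s (x + i) (y + j) else 0)" for P i j
    by (intro rapid_of_lines rapid_shift rapid_m)
  let ?l = "\<lambda>k i j s x y. if y = x + k then m s (x + i) (y + j) else 0"
  have "rapid {0..T} (\<lambda>s x y. (1/2) * (m s (x + 1) (y + 0) + m s (x + (- 1)) (y + 0)
      + m s (x + 0) (y + 1) + m s (x + 0) (y + (- 1)) - 4 * m s (x + 0) (y + 0))
      + (1/4) * ((?l 0 0 0 s x y + ?l 0 1 1 s x y - ?l 0 0 1 s x y - ?l 0 1 0 s x y)
        + (?l 0 (-1) (-1) s x y + ?l 0 0 0 s x y - ?l 0 (-1) 0 s x y - ?l 0 0 (-1) s x y)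
        - (?l 1 0 (-1) s x y + ?l 1 1 0 s x y - ?l 1 0 0 s x y - ?l 1 1 (-1) s x y)
        - (?l (-1) (-1) 0 s x y + ?l (-1) 0 1 s x y - ?l (-1) (-1) 1 s x y - ?l (-1) 0 0 s x y)))"
    by (intro rapid_cmult rapid_diff rapid_add rapid_shift rapid_m rapid_of_lines)
  then show ?thesis
    by (rule subst[where P="rapid {0..T}", rotated]) (auto simp: fun_eq_iff gen_eq dd_def lap_def field_simps)
qed

text \<open>The evolution equation in weak form: the operator passes to the weight, at the price of
  the diagonal interaction, and a time-dependent weight adds its own derivative.\<close>

lemma pairing:
  assumes T: "0 < T" and H: "tame {0..T} H" and H': "tame {0..T} H'"
    and dH: "\<And>s x y. s \<in> {0..T} \<Longrightarrow> ((\<lambda>s. H s x y) has_real_derivative H' s x y) (at s within {0..T})"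
    and s: "s \<in> {0..T}"
  shows "((\<lambda>s. S2 (\<lambda>x y. m s x y * H s x y)) has_real_derivative
     S2 (\<lambda>x y. m s x y * (lap (H s) x y + H' s x y)) + (\<Sum>\<^sub>\<infinity>b. dd (m s) b * dd (H s) b) / 4) (at s within {0..T})"
proof -
  have r1: "rapid {0..T} (\<lambda>s x y. gen (m s) x y * H s x y)" by (intro rapid_mult rapid_gen H)
  have r2: "rapid {0..T} (\<lambda>s x y. m s x y * H' s x y)" by (intro rapid_mult rapid_m H')
  have sub: "{s} \<subseteq> {0..T}" using s by simp
  have "((\<lambda>s. S2 (\<lambda>x y. m s x y * H s x y)) has_real_derivative
     S2 (\<lambda>x y. gen (m s) x y * H s x y + m s x y * H' s x y)) (at s within {0..T})"
  proof (rule S2_has_derivative[OF T _ _ _ s])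
    fix s x y assume s: "s \<in> {0..T}"
    have "((\<lambda>s. m s x y) has_real_derivative gen (m s) x y) (at s within {0..T})"
      by (rule has_field_derivative_subset[OF deriv]) (use s in auto)
    from DERIV_mult[OF this dH[OF s, of x y]]
    show "((\<lambda>s. m s x y * H s x y) has_real_derivative gen (m s) x y * H s x y + m s x y * H' s x y) (at s within {0..T})"
      by (simp add: algebra_simps)
  qed (intro rapid_add r1 r2 rapid_mult rapid_m H)+
  also have "S2 (\<lambda>x y. gen (m s) x y * H s x y + m s x y * H' s x y) = S2 (\<lambda>x y. gen (m s) x y * H s x y) + S2 (\<lambda>x y. m s x y * H' s x y)"
    by (rule S2_add[OF rapid_subset[OF r1 sub] rapid_subset[OF r2 sub]])
  also have "S2 (\<lambda>x y. gen (m s) x y * H s x y) = S2 (\<lambda>x y. m s x y * lap (H s) x y) + (\<Sum>\<^sub>\<infinity>b. dd (m s) b * dd (H s) b) / 4"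
    by (rule S2_gen[OF rapid_subset[OF rapid_m sub] tame_subset[OF H sub]])
  also have "S2 (\<lambda>x y. m s x y * lap (H s) x y) + (\<Sum>\<^sub>\<infinity>b. dd (m s) b * dd (H s) b) / 4 + S2 (\<lambda>x y. m s x y * H' s x y) =
     S2 (\<lambda>x y. m s x y * (lap (H s) x y + H' s x y)) + (\<Sum>\<^sub>\<infinity>b. dd (m s) b * dd (H s) b) / 4"
  proof -
    have "rapid {s} (\<lambda>s x y. m s x y * lap (H s) x y)"
      by (intro rapid_mult tame_lap rapid_subset[OF rapid_m sub] tame_subset[OF H sub])
    from S2_add[OF this rapid_subset[OF r2 sub]] show ?thesis by (simp add: ring_distribs)
  qed
  finally show ?thesis .
qed

end

text \<open>Normalised so that it is space-time harmonic for two independent walkers: the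
  exponential in each coordinate has eigenvalue \<open>cosh \<beta> - 1\<close>.\<close>

definition tilt2 :: "real \<Rightarrow> real \<Rightarrow> int \<Rightarrow> int \<Rightarrow> real" where
  "tilt2 \<beta> s x y = exp (\<beta> * (of_int x + of_int y) - 2 * s * (cosh \<beta> - 1))"

text \<open>
  The weight \<open>\<mu> ^ \<bar>z\<bar>\<close> of the gap \<open>z\<close> between the walkers is an eigenfunction of the tilted
  motion away from \<open>z = 0\<close>. The value at \<open>0\<close> is chosen such that the contributions of
  neighbouring sites cancel and only a potential \<open>pot\<close> at \<open>z = 0\<close> remains. The sign of this
  potential decides whether the tilted second moment is bounded below or above.
\<close>

definition gap_weight :: "real \<Rightarrow> real \<Rightarrow> int \<Rightarrow> real" where
  "gap_weight \<beta> \<mu> z = (if z = 0 then 2 - \<mu> / cosh \<beta> else \<mu> ^ nat \<bar>z\<bar>)"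

definition rate :: "real \<Rightarrow> real \<Rightarrow> real" where
  "rate \<beta> \<mu> = cosh \<beta> * (\<mu> + 1 / \<mu> - 2)"

definition pot :: "real \<Rightarrow> real \<Rightarrow> real" where
  "pot \<beta> \<mu> = (\<mu> ^ 3 - 2 * cosh \<beta> * \<mu>\<^sup>2 + (2 * (cosh \<beta>)\<^sup>2 + 1) * \<mu> - 2 * cosh \<beta>) / \<mu>"

text \<open>Away from the origin the powers of \<mu> solve the recurrence with eigenvalue
  \<open>rate \<beta> \<mu>\<close>. The modified value at 0 leaves
  \<open>cosh \<beta> - \<mu>\<close> at the sites 1 and -1. The remainder at 0 is split so that
  \<open>pot \<beta> \<mu>\<close> is what survives once the interaction is added.\<close>

lemma gap_weight_recurrence:
  assumes \<mu>: "0 < \<mu>"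
  shows "cosh \<beta> * (gap_weight \<beta> \<mu> (z + 1) + gap_weight \<beta> \<mu> (z - 1) - 2 * gap_weight \<beta> \<mu> z) = rate \<beta> \<mu> * gap_weight \<beta> \<mu> z +
    (if z = 0 then pot \<beta> \<mu> - 2 * cosh \<beta> * (cosh \<beta> - \<mu>) else if \<bar>z\<bar> = 1 then cosh \<beta> - \<mu> else 0)"
proof -
  have c: "0 < cosh \<beta>" by (rule cosh_real_pos)
  consider "z = 0" | "z = 1" | "z = -1" | n where "z = int n + 2" | n where "z = - int n - 2"
  proof -
    have "z = 0 \<or> z = 1 \<or> z = -1 \<or> z = int (nat (z - 2)) + 2 \<or> z = - int (nat (- z - 2)) - 2" by auto
    then show ?thesis using that by blast
  qed
  then show ?thesis
  proof cases
    case 1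
    then show ?thesis using \<mu> c by (simp add: gap_weight_def rate_def pot_def field_simps power2_eq_square power3_eq_cube)
  next
    case 2
    then show ?thesis using \<mu> c by (simp add: gap_weight_def rate_def field_simps power2_eq_square)
  next
    case 3
    then show ?thesis using \<mu> c by (simp add: gap_weight_def rate_def field_simps power2_eq_square)
  next
    case (4 n)
    have "nat \<bar>int n + 2\<bar> = n + 2" "nat \<bar>int n + 2 + 1\<bar> = n + 3" "nat \<bar>int n + 2 - 1\<bar> = n + 1" by auto
    then show ?thesis unfolding 4 using \<mu> c
      by (simp add: gap_weight_def rate_def field_simps power_add power2_eq_square power3_eq_cube)
  next
    case (5 n)
    have "nat \<bar>- int n - 2\<bar> = n + 2" "nat \<bar>- int n - 2 + 1\<bar> = n + 1" "nat \<bar>- int n - 2 - 1\<bar> = n + 3" by auto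
    then show ?thesis unfolding 5 using \<mu> c
      by (simp add: gap_weight_def rate_def field_simps power_add power2_eq_square power3_eq_cube)
  qed
qed

lemma gap_weight_bounds:
  assumes "0 < \<mu>" "\<mu> \<le> 1"
  shows "0 \<le> gap_weight \<beta> \<mu> z" "gap_weight \<beta> \<mu> z \<le> 2 - \<mu> / cosh \<beta>" "1 \<le> 2 - \<mu> / cosh \<beta>" "2 - \<mu> / cosh \<beta> \<le> 2"
proof -
  define a p where "a = \<mu> / cosh \<beta>" and "p = \<mu> ^ nat \<bar>z\<bar>"
  have "a \<le> 1" using assms cosh_real_ge_1[of \<beta>] by (simp add: a_def divide_le_eq_1)
  moreover have "0 \<le> a" using assms cosh_real_pos[of \<beta>] by (simp add: a_def)
  moreover have "p \<le> 1" "0 \<le> p" using assms by (auto simp: p_def power_le_one)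
  ultimately show "0 \<le> gap_weight \<beta> \<mu> z" "gap_weight \<beta> \<mu> z \<le> 2 - \<mu> / cosh \<beta>" "1 \<le> 2 - \<mu> / cosh \<beta>" "2 - \<mu> / cosh \<beta> \<le> 2"
    unfolding gap_weight_def a_def[symmetric] p_def[symmetric] by auto
qed

lemma gap_weight_abs_le: "0 < \<mu> \<Longrightarrow> \<mu> \<le> 1 \<Longrightarrow> \<bar>gap_weight \<beta> \<mu> z\<bar> \<le> 2"
  using gap_weight_bounds(1)[of \<mu> \<beta> z] gap_weight_bounds(2)[of \<mu> \<beta> z] gap_weight_bounds(4)[of \<mu> \<beta>] by linarith

lemma tame_tilt2: "tame {0..T} (\<lambda>s. tilt2 \<beta> s)"
proof -
  have "tame {0..T} (\<lambda>s x y. exp (\<beta> * of_int x + \<beta> * of_int y) * exp (- 2 * s * (cosh \<beta> - 1)))"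
    by (intro tame_mult tame_exp tame_bounded[of _ _ 1]) (auto simp: cosh_real_ge_1)
  then show ?thesis by (simp add: tilt2_def[abs_def] exp_add[symmetric] algebra_simps)
qed

lemma tilt2_pos: "0 < tilt2 \<beta> s x y" by (simp add: tilt2_def)

lemma tilt2_shift: "tilt2 \<beta> s (x + i) (y + j) = exp (\<beta> * (of_int i + of_int j)) * tilt2 \<beta> s x y"
  by (simp add: tilt2_def exp_add[symmetric] algebra_simps)

text \<open>A step of either walker changes the gap by one, and the exponential factors of the steps
  leading to the same gap combine to \<open>cosh \<beta>\<close>.\<close>

lemma lap_tilt2:
  "lap (\<lambda>x y. tilt2 \<beta> s x y * h (x - y)) x y =
    tilt2 \<beta> s x y * (cosh \<beta> * (h (x - y + 1) + h (x - y - 1)) - 2 * h (x - y))"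
proof -
  have e: "tilt2 \<beta> s (x + 1) y = exp \<beta> * tilt2 \<beta> s x y" "tilt2 \<beta> s (x - 1) y = exp (- \<beta>) * tilt2 \<beta> s x y"
    "tilt2 \<beta> s x (y + 1) = exp \<beta> * tilt2 \<beta> s x y" "tilt2 \<beta> s x (y - 1) = exp (- \<beta>) * tilt2 \<beta> s x y"
    using tilt2_shift[of \<beta> s x 1 y 0] tilt2_shift[of \<beta> s x "-1" y 0] tilt2_shift[of \<beta> s x 0 y 1] tilt2_shift[of \<beta> s x 0 y "-1"]
    by simp_all
  have z: "x + 1 - y = x - y + 1" "x - 1 - y = x - y - 1" "x - (y + 1) = x - y - 1" "x - (y - 1) = x - y + 1" by auto
  show ?thesis unfolding lap_def e z cosh_def by (simp add: field_simps)
qed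

lemma dd_tilt2:
  assumes "h (-1) = h 1"
  shows "dd (\<lambda>x y. tilt2 \<beta> s x y * h (x - y)) b = 2 * exp (\<beta> * (2 * of_int b + 1) - 2 * s * (cosh \<beta> - 1)) * (cosh \<beta> * h 0 - h 1)"
proof -
  let ?e = "exp (\<beta> * (2 * of_int b + 1) - 2 * s * (cosh \<beta> - 1))"
  have "tilt2 \<beta> s b b = exp (- \<beta>) * ?e" "tilt2 \<beta> s (b + 1) (b + 1) = exp \<beta> * ?e"
    "tilt2 \<beta> s b (b + 1) = ?e" "tilt2 \<beta> s (b + 1) b = ?e"
    by (simp_all add: tilt2_def exp_add[symmetric] algebra_simps)
  then show ?thesis using assms by (simp add: dd_def cosh_def field_simps)
qed

section \<open>Evolution of the tilted second moments\<close>

context two_point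
begin

definition lyap :: "real \<Rightarrow> (int \<Rightarrow> real) \<Rightarrow> real \<Rightarrow> real" where
  "lyap \<beta> h s = S2 (\<lambda>x y. m s x y * (tilt2 \<beta> s x y * h (x - y)))"

definition diag :: "real \<Rightarrow> real \<Rightarrow> real" where
  "diag \<beta> s = (\<Sum>\<^sub>\<infinity>b. m s b b * tilt2 \<beta> s b b)"

text \<open>The interaction sum for weights that depend on the gap only; the exponential is the tilt
  at the pair (b, b + 1).\<close>

definition grad :: "real \<Rightarrow> real \<Rightarrow> real" where
  "grad \<beta> s = (\<Sum>\<^sub>\<infinity>b. dd (m s) b * exp (\<beta> * (2 * of_int b + 1) - 2 * s * (cosh \<beta> - 1)))"

definition off :: "real \<Rightarrow> real \<Rightarrow> real" where
  "off \<beta> s = (\<Sum>\<^sub>\<infinity>b. m s b (b + 1) * tilt2 \<beta> s b (b + 1))"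

lemma rapid_tilt2: "rapid {0..T} (\<lambda>s x y. m s x y * tilt2 \<beta> s x y)"
  by (intro rapid_mult rapid_m tame_tilt2)

lemma rapid_tilt2_at: "0 \<le> s \<Longrightarrow> rapid {s} (\<lambda>s x y. m s x y * tilt2 \<beta> s x y)"
  by (rule rapid_subset[OF rapid_tilt2[of s]]) auto

lemma line_summable: "0 \<le> s \<Longrightarrow> (\<lambda>b. m s (b + i) (b + j) * tilt2 \<beta> s (b + i) (b + j)) summable_on UNIV"
  using rapid_summable_line[OF rapid_tilt2_at] .

lemma grad_summable:
  assumes "0 \<le> s"
  shows "(\<lambda>b. dd (m s) b * exp (\<beta> * (2 * of_int b + 1) - 2 * s * (cosh \<beta> - 1))) summable_on UNIV"
    "grad \<beta> s = 2 * cosh \<beta> * diag \<beta> s - 2 * off \<beta> s"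
proof -
  let ?e = "\<lambda>b. exp (\<beta> * (2 * of_int b + 1) - 2 * s * (cosh \<beta> - 1))"
  have eq: "dd (m s) b * ?e b = exp \<beta> * (m s b b * tilt2 \<beta> s b b) + exp (- \<beta>) * (m s (b + 1) (b + 1) * tilt2 \<beta> s (b + 1) (b + 1))
      + (- 2) * (m s b (b + 1) * tilt2 \<beta> s b (b + 1))" for b
  proof -
    have "tilt2 \<beta> s b b = exp (- \<beta>) * ?e b" "tilt2 \<beta> s (b + 1) (b + 1) = exp \<beta> * ?e b"
      "tilt2 \<beta> s b (b + 1) = ?e b"
      by (simp_all add: tilt2_def exp_add[symmetric] algebra_simps)
    then show ?thesis using sym[of s "b + 1" b] by (simp add: dd_def exp_minus field_simps)
  qed
  note hs = has_sum_infsum[OF line_summable[OF assms, where \<beta>=\<beta>]]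
  have d: "((\<lambda>b. m s b b * tilt2 \<beta> s b b) has_sum diag \<beta> s) UNIV"
    using hs[of 0 0] by (simp add: diag_def)
  have d': "((\<lambda>b. m s (b + 1) (b + 1) * tilt2 \<beta> s (b + 1) (b + 1)) has_sum diag \<beta> s) UNIV"
    using hs[of 1 1] infsum_shift_int[of "\<lambda>b. m s b b * tilt2 \<beta> s b b" 1] by (simp add: diag_def)
  have o: "((\<lambda>b. m s b (b + 1) * tilt2 \<beta> s b (b + 1)) has_sum off \<beta> s) UNIV"
    using hs[of 0 1] by (simp add: off_def)
  have "((\<lambda>b. dd (m s) b * ?e b) has_sum (exp \<beta> * diag \<beta> s + exp (- \<beta>) * diag \<beta> s + (- 2) * off \<beta> s)) UNIV"
    unfolding eq by (intro has_sum_add has_sum_cmult_right d d' o)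
  moreover have "exp \<beta> * diag \<beta> s + exp (- \<beta>) * diag \<beta> s + (- 2) * off \<beta> s = 2 * cosh \<beta> * diag \<beta> s - 2 * off \<beta> s"
    by (simp add: cosh_def algebra_simps)
  ultimately show "(\<lambda>b. dd (m s) b * ?e b) summable_on UNIV" "grad \<beta> s = 2 * cosh \<beta> * diag \<beta> s - 2 * off \<beta> s"
    by (auto simp: grad_def summable_on_def intro: infsumI)
qed

lemma off_nonneg: "0 \<le> s \<Longrightarrow> 0 \<le> off \<beta> s"
  unfolding off_def by (intro infsum_nonneg mult_nonneg_nonneg bounds) (auto simp: tilt2_def)

lemma diag_nonneg: "0 \<le> s \<Longrightarrow> 0 \<le> diag \<beta> s"
  unfolding diag_def by (intro infsum_nonneg mult_nonneg_nonneg bounds) (auto simp: tilt2_def)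

lemma grad_le: "0 \<le> s \<Longrightarrow> grad \<beta> s \<le> 2 * cosh \<beta> * diag \<beta> s"
  using grad_summable(2)[of s \<beta>] off_nonneg[of s \<beta>] by simp

lemma S2_init: "S2 (\<lambda>x y. m 0 x y * H x y) = H 0 0"
proof -
  have "S2 (\<lambda>x y. m 0 x y * H x y) = (\<Sum>\<^sub>\<infinity>p\<in>{(0,0)}. m 0 (fst p) (snd p) * H (fst p) (snd p))"
    unfolding S2_def by (rule infsum_cong_neutral) (auto simp: init)
  then show ?thesis by (simp add: init)
qed

text \<open>The decay of the normalisation turns the term -2 h of \<open>lap_tilt2\<close> into -2 h
  cosh \<beta>, so the gap performs a symmetric walk sped up by \<open>cosh \<beta>\<close>. The
  symmetry of h at 1 and -1 makes the interaction a multiple of \<open>grad\<close>.\<close>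

lemma lyap_derivative:
  assumes T: "0 < T" and h: "\<And>z. \<bar>h z\<bar> \<le> C" "h (-1) = h 1" and s: "s \<in> {0..T}"
  shows "(lyap \<beta> h has_real_derivative
     lyap \<beta> (\<lambda>z. cosh \<beta> * (h (z + 1) + h (z - 1) - 2 * h z)) s + grad \<beta> s * ((cosh \<beta> * h 0 - h 1) / 2)) (at s within {0..T})"
proof -
  let ?H = "\<lambda>s x y. tilt2 \<beta> s x y * h (x - y)"
  let ?H' = "\<lambda>s x y. - 2 * (cosh \<beta> - 1) * (tilt2 \<beta> s x y * h (x - y))"
  have tH: "tame {0..T} ?H"
    by (intro tame_mult tame_tilt2 tame_bounded[of _ _ C] h)
  have "((\<lambda>s. S2 (\<lambda>x y. m s x y * ?H s x y)) has_real_derivative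
     S2 (\<lambda>x y. m s x y * (lap (?H s) x y + ?H' s x y)) + (\<Sum>\<^sub>\<infinity>b. dd (m s) b * dd (?H s) b) / 4) (at s within {0..T})"
  proof (rule pairing[OF T tH _ _ s])
    show "tame {0..T} ?H'" by (intro tame_mult[OF tame_const] tH)
    show "((\<lambda>s. ?H s x y) has_real_derivative ?H' s x y) (at s within {0..T})" for s x y
      unfolding tilt2_def by (auto intro!: derivative_eq_intros)
  qed
  also have "(\<lambda>s. S2 (\<lambda>x y. m s x y * ?H s x y)) = lyap \<beta> h" by (simp add: lyap_def fun_eq_iff)
  also have "S2 (\<lambda>x y. m s x y * (lap (?H s) x y + ?H' s x y)) = lyap \<beta> (\<lambda>z. cosh \<beta> * (h (z + 1) + h (z - 1) - 2 * h z)) s"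
    unfolding lyap_def lap_tilt2 by (rule arg_cong[where f=S2]) (simp add: fun_eq_iff algebra_simps)
  also have "(\<Sum>\<^sub>\<infinity>b. dd (m s) b * dd (?H s) b) / 4 = grad \<beta> s * ((cosh \<beta> * h 0 - h 1) / 2)"
    unfolding dd_tilt2[of h, OF h(2)] grad_def infsum_cmult_left'[symmetric]
      divide_inverse[of _ 4] by (rule infsum_cong) (simp add: algebra_simps)
  finally show ?thesis .
qed

lemma lyap_1_derivative:
  assumes "0 < T" "s \<in> {0..T}"
  shows "(lyap \<beta> (\<lambda>_. 1) has_real_derivative (cosh \<beta> - 1) / 2 * grad \<beta> s) (at s within {0..T})"
  using lyap_derivative[OF assms(1) _ _ assms(2), of "\<lambda>_. 1" 1 \<beta>] by (simp add: lyap_def S2_def mult.commute)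

text \<open>The terms with \<open>off\<close> cancel: the recurrence contributes
  \<open>2 * (cosh \<beta> - \<mu>) * off \<beta> s\<close>, and the interaction subtracts the same
  amount. This requirement determines the value \<open>2 - \<mu> / cosh \<beta>\<close> of the
  weight at 0.\<close>

lemma lyap_gap_weight_derivative:
  assumes T: "0 < T" and s: "s \<in> {0..T}" and \<mu>: "0 < \<mu>" "\<mu> \<le> 1"
  shows "(lyap \<beta> (gap_weight \<beta> \<mu>) has_real_derivative
     rate \<beta> \<mu> * lyap \<beta> (gap_weight \<beta> \<mu>) s + pot \<beta> \<mu> * diag \<beta> s) (at s within {0..T})"
proof -
  let ?h = "gap_weight \<beta> \<mu>" and ?c = "cosh \<beta>"
  have s0: "0 \<le> s" using s by simp
  have hb: "\<bar>?h z\<bar> \<le> 2" for z using gap_weight_abs_le[OF \<mu>] .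
  have c: "0 < ?c" by (rule cosh_real_pos)
  have h01: "?c * ?h 0 - ?h 1 = 2 * (?c - \<mu>)" using c by (simp add: gap_weight_def field_simps)
  have E: "lyap \<beta> (\<lambda>z. ?c * (?h (z + 1) + ?h (z - 1) - 2 * ?h z)) s =
      rate \<beta> \<mu> * lyap \<beta> ?h s + ((pot \<beta> \<mu> - 2 * ?c * (?c - \<mu>)) * diag \<beta> s + (?c - \<mu>) * (off \<beta> s + off \<beta> s))"
  proof -
    let ?k = "pot \<beta> \<mu> - 2 * ?c * (?c - \<mu>)"
    let ?w = "\<lambda>s x y. m s x y * tilt2 \<beta> s x y"
    let ?l = "\<lambda>k s x y. if y = x + k then ?w s x y else 0"
    have r: "rapid {s} ?w" by (rule rapid_tilt2_at[OF s0])
    have rl: "rapid {s} (?l k)" for k by (rule rapid_of_lines[OF r])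
    have rh: "rapid {s} (\<lambda>s x y. rate \<beta> \<mu> * (?w s x y * ?h (x - y)))"
      by (intro rapid_cmult rapid_mult[OF r] tame_bounded[of _ _ 2] hb)
    have "lyap \<beta> (\<lambda>z. ?c * (?h (z + 1) + ?h (z - 1) - 2 * ?h z)) s =
      S2 (\<lambda>x y. rate \<beta> \<mu> * (?w s x y * ?h (x - y)) + (?k * ?l 0 s x y + (?c - \<mu>) * (?l 1 s x y + ?l (- 1) s x y)))"
      unfolding lyap_def gap_weight_recurrence[OF \<mu>(1)]
      by (rule arg_cong[where f=S2]) (auto simp: fun_eq_iff algebra_simps)
    also have "\<dots> = S2 (\<lambda>x y. rate \<beta> \<mu> * (?w s x y * ?h (x - y))) + S2 (\<lambda>x y. ?k * ?l 0 s x y + (?c - \<mu>) * (?l 1 s x y + ?l (- 1) s x y))"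
      by (rule S2_add[OF rh]) (intro rapid_add rapid_cmult rl)
    also have "S2 (\<lambda>x y. rate \<beta> \<mu> * (?w s x y * ?h (x - y))) = rate \<beta> \<mu> * lyap \<beta> ?h s"
      unfolding S2_cmult lyap_def by (simp add: mult.assoc)
    also have "S2 (\<lambda>x y. ?k * ?l 0 s x y + (?c - \<mu>) * (?l 1 s x y + ?l (- 1) s x y)) =
       S2 (\<lambda>x y. ?k * ?l 0 s x y) + S2 (\<lambda>x y. (?c - \<mu>) * (?l 1 s x y + ?l (- 1) s x y))"
      by (rule S2_add) (intro rapid_add rapid_cmult rl)+
    also have "S2 (\<lambda>x y. (?c - \<mu>) * (?l 1 s x y + ?l (- 1) s x y)) = (?c - \<mu>) * (S2 (?l 1 s) + S2 (?l (- 1) s))"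
      unfolding S2_cmult by (subst S2_add[OF rl rl]) simp
    also have "S2 (\<lambda>x y. ?k * ?l 0 s x y) = ?k * S2 (?l 0 s)" by (rule S2_cmult)
    also have "S2 (?l 0 s) = diag \<beta> s" using S2_line[of 0 "?w s"] by (simp add: diag_def)
    also have "S2 (?l 1 s) = off \<beta> s" using S2_line[of 1 "?w s"] by (simp add: off_def)
    also have "S2 (?l (- 1) s) = off \<beta> s"
    proof -
      have "S2 (?l (- 1) s) = (\<Sum>\<^sub>\<infinity>x. ?w s x (x + (- 1)))" by (rule S2_line)
      also have "\<dots> = (\<Sum>\<^sub>\<infinity>x. ?w s (x + 1) (x + 1 + (- 1)))" by (rule infsum_shift_int[symmetric])
      also have "\<dots> = off \<beta> s"
        unfolding off_def by (rule infsum_cong) (simp add: sym[of s "_ + 1"] tilt2_def add.commute)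
      finally show ?thesis .
    qed
    finally show ?thesis .
  qed
  have "?h (- 1) = ?h 1" by (simp add: gap_weight_def)
  from lyap_derivative[where h="gap_weight \<beta> \<mu>" and C=2 and \<beta>=\<beta>, OF T hb this s]
  show ?thesis unfolding h01 E grad_summable(2)[OF s0]
    by (rule DERIV_cong) (simp add: field_simps)
qed

lemma lyap_init: "lyap \<beta> h 0 = h 0"
  unfolding lyap_def by (subst S2_init) (simp add: tilt2_def)

lemma rapid_lyap:
  assumes "0 \<le> s" "\<And>z. \<bar>h z\<bar> \<le> C"
  shows "rapid {s} (\<lambda>s x y. m s x y * (tilt2 \<beta> s x y * h (x - y)))"
  unfolding mult.assoc[symmetric] by (intro rapid_mult[OF rapid_tilt2_at[OF assms(1)]] tame_bounded[of _ _ C] assms)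

lemma lyap_mono:
  assumes "0 \<le> s" "\<And>z. \<bar>h z\<bar> \<le> C" "\<And>z. \<bar>h' z\<bar> \<le> C" "\<And>z. h z \<le> h' z"
  shows "lyap \<beta> h s \<le> lyap \<beta> h' s"
  unfolding lyap_def
  by (rule S2_mono[OF rapid_lyap rapid_lyap]) (use assms bounds tilt2_pos in \<open>auto intro!: mult_left_mono simp: less_imp_le\<close>)

lemma lyap_nonneg: "0 \<le> s \<Longrightarrow> (\<And>z. 0 \<le> h z) \<Longrightarrow> 0 \<le> lyap \<beta> h s"
  unfolding lyap_def by (intro S2_nonneg mult_nonneg_nonneg bounds) (auto simp: tilt2_def)

lemma lyap_cmult: "lyap \<beta> (\<lambda>z. c * h z) s = c * lyap \<beta> h s"
  unfolding lyap_def S2_cmult[symmetric] by (simp add: mult_ac)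

text \<open>With a nonnegative potential the weighted moment, discounted by
  \<open>exp (- rate \<beta> \<mu> * s)\<close>, is nondecreasing. It starts from the value of the
  weight at 0, which is also its maximum, so passing to the unweighted moment costs no
  constant.\<close>

lemma mass_lower:
  assumes T: "0 \<le> T" and \<mu>: "0 < \<mu>" "\<mu> \<le> 1" and pot: "0 \<le> pot \<beta> \<mu>"
  shows "exp (rate \<beta> \<mu> * T) \<le> lyap \<beta> (\<lambda>_. 1) T"
proof (cases "T = 0")
  case True
  then show ?thesis by (simp add: lyap_init)
next
  case False
  then have T': "0 < T" using T by simp
  let ?h = "gap_weight \<beta> \<mu>" and ?top = "2 - \<mu> / cosh \<beta>"
  let ?G = "\<lambda>s. exp (- rate \<beta> \<mu> * s) * lyap \<beta> ?h s"
  have "?G 0 \<le> ?G T"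
  proof (rule DERIV_within_nonneg_mono[where g = ?G and g' = "\<lambda>s. exp (- rate \<beta> \<mu> * s) * (pot \<beta> \<mu> * diag \<beta> s)"])
    fix s assume s: "0 \<le> s" "s \<le> T"
    have "s \<in> {0..T}" using s by simp
    from lyap_gap_weight_derivative[OF T' this \<mu>, of \<beta>]
    show "(?G has_real_derivative exp (- rate \<beta> \<mu> * s) * (pot \<beta> \<mu> * diag \<beta> s)) (at s within {0..T})"
      by (auto intro!: derivative_eq_intros simp: algebra_simps)
    show "0 \<le> exp (- rate \<beta> \<mu> * s) * (pot \<beta> \<mu> * diag \<beta> s)"
      using pot diag_nonneg[OF s(1)] by simp
  qed (rule T)
  then have "?top \<le> exp (- rate \<beta> \<mu> * T) * lyap \<beta> ?h T" by (simp add: lyap_init gap_weight_def)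
  also have "lyap \<beta> ?h T \<le> lyap \<beta> (\<lambda>_. ?top * 1) T"
  proof (rule lyap_mono[where C=2])
    show "\<bar>?top * 1\<bar> \<le> 2" using gap_weight_bounds(3,4)[OF \<mu>, of \<beta>] unfolding mult_1_right by linarith
    show "gap_weight \<beta> \<mu> z \<le> ?top * 1" for z using gap_weight_bounds(2)[OF \<mu>, of \<beta> z] by simp
  qed (use T gap_weight_abs_le[OF \<mu>] in auto)
  also have "\<dots> = ?top * lyap \<beta> (\<lambda>_. 1) T" by (rule lyap_cmult)
  finally have "?top * 1 \<le> ?top * (exp (- rate \<beta> \<mu> * T) * lyap \<beta> (\<lambda>_. 1) T)" by (simp add: mult_ac)
  then have "1 \<le> exp (- rate \<beta> \<mu> * T) * lyap \<beta> (\<lambda>_. 1) T"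
    using gap_weight_bounds(3)[OF \<mu>, of \<beta>] by (subst (asm) mult_le_cancel_left_pos) linarith
  then show ?thesis by (simp add: exp_minus field_simps)
qed

text \<open>
  With a repulsive potential the time spent on the diagonal is paid for by the decrease of the
  weighted second moment.
\<close>

lemma lyap_potential:
  assumes T: "0 < T" and \<mu>: "0 < \<mu>" "\<mu> \<le> 1" and pot: "pot \<beta> \<mu> \<le> - \<rho>" and \<rho>: "0 < \<rho>" and A: "0 \<le> A"
    and V: "\<And>s. s \<in> {0..T} \<Longrightarrow> (V has_real_derivative V' s) (at s within {0..T})"
    and V': "\<And>s. s \<in> {0..T} \<Longrightarrow> V' s \<le> A * diag \<beta> s"
  shows "V T \<le> V 0 + 2 * A / \<rho> * exp (rate \<beta> \<mu> * T)"
proof -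
  let ?h = "gap_weight \<beta> \<mu>" and ?r = "rate \<beta> \<mu>"
  \<comment> \<open>A multiple of the weighted moment, amplified by the growth still to come, is
    added to \<open>V\<close>. The repulsive potential makes it fall by at least A times
    \<open>diag\<close>, which pays for the growth of \<open>V\<close>.\<close>
  let ?G = "\<lambda>s. - V s - A / \<rho> * exp (?r * (T - s)) * lyap \<beta> ?h s"
  let ?G' = "\<lambda>s. - V' s - A / \<rho> * exp (?r * (T - s)) * (pot \<beta> \<mu> * diag \<beta> s)"
  have r: "0 \<le> ?r"
  proof -
    have "\<mu> + 1 / \<mu> - 2 = (\<mu> - 1)\<^sup>2 / \<mu>" using \<mu> by (simp add: field_simps power2_eq_square)
    then show ?thesis using \<mu> cosh_real_pos[of \<beta>] by (simp add: rate_def)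
  qed
  have "?G 0 \<le> ?G T"
  proof (rule DERIV_within_nonneg_mono[where g = ?G and g' = ?G'])
    fix s assume s: "0 \<le> s" "s \<le> T"
    have sT: "s \<in> {0..T}" using s by simp
    from lyap_gap_weight_derivative[OF T sT \<mu>, of \<beta>] V[OF sT]
    show "(?G has_real_derivative ?G' s) (at s within {0..T})"
      using \<rho> by (auto intro!: derivative_eq_intros simp: algebra_simps)
    have d: "0 \<le> diag \<beta> s" by (rule diag_nonneg[OF s(1)])
    have "A * diag \<beta> s \<le> A * diag \<beta> s * exp (?r * (T - s))"
      using mult_left_mono[of 1 "exp (?r * (T - s))" "A * diag \<beta> s"] A d s r by simp
    also have "\<dots> = A / \<rho> * exp (?r * (T - s)) * (\<rho> * diag \<beta> s)" using \<rho> by simp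
    also have "\<dots> \<le> A / \<rho> * exp (?r * (T - s)) * (- pot \<beta> \<mu> * diag \<beta> s)"
      using pot A \<rho> d by (intro mult_left_mono mult_right_mono) auto
    finally show "0 \<le> ?G' s" using V'[OF sT] by simp
  qed (use T in simp)
  then have "V T + A / \<rho> * lyap \<beta> ?h T \<le> V 0 + A / \<rho> * exp (?r * T) * (2 - \<mu> / cosh \<beta>)"
    by (simp add: lyap_init gap_weight_def)
  moreover have "0 \<le> A / \<rho> * lyap \<beta> ?h T"
    using A \<rho> T gap_weight_bounds(1)[OF \<mu>] by (intro mult_nonneg_nonneg lyap_nonneg) auto
  moreover have "A / \<rho> * exp (?r * T) * (2 - \<mu> / cosh \<beta>) \<le> A / \<rho> * exp (?r * T) * 2"
    using A \<rho> gap_weight_bounds(4)[OF \<mu>] by (intro mult_left_mono) auto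
  ultimately show ?thesis by (simp add: mult_ac)
qed

text \<open>The weight with \<mu> = 1 differs from the constant 1 at most at 0 and has rate 0, so
  its moment grows only through \<open>2 * (cosh \<beta> - 1)\<^sup>2\<close> times
  \<open>diag\<close>. A second weight, with repulsive potential, controls the time integral of
  \<open>diag\<close>.\<close>

lemma mass_upper:
  assumes T: "0 < T" and \<mu>: "0 < \<mu>" "\<mu> \<le> 1" and pot: "pot \<beta> \<mu> \<le> - \<rho>" and \<rho>: "0 < \<rho>"
  shows "lyap \<beta> (\<lambda>_. 1) T \<le> 2 - 1 / cosh \<beta> + 4 * (cosh \<beta> - 1)\<^sup>2 / \<rho> * exp (rate \<beta> \<mu> * T)"
proof -
  have p1: "pot \<beta> 1 = 2 * (cosh \<beta> - 1)\<^sup>2" by (simp add: pot_def power2_eq_square algebra_simps)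
  have r1: "rate \<beta> 1 = 0" by (simp add: rate_def)
  have "lyap \<beta> (gap_weight \<beta> 1) T \<le> lyap \<beta> (gap_weight \<beta> 1) 0 + 2 * (2 * (cosh \<beta> - 1)\<^sup>2) / \<rho> * exp (rate \<beta> \<mu> * T)"
    by (rule lyap_potential[OF T \<mu> pot \<rho>, where V' = "\<lambda>s. 2 * (cosh \<beta> - 1)\<^sup>2 * diag \<beta> s"])
      (use lyap_gap_weight_derivative[OF T _ zero_less_one order.refl, of _ \<beta>] in \<open>simp_all add: p1 r1\<close>)
  moreover have "lyap \<beta> (\<lambda>_. 1) T \<le> lyap \<beta> (gap_weight \<beta> 1) T"
  proof (rule lyap_mono[where C=2])
    show "1 \<le> gap_weight \<beta> 1 z" for z using gap_weight_bounds(3)[of 1 \<beta>] by (simp add: gap_weight_def)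
  qed (use T gap_weight_abs_le in auto)
  ultimately show ?thesis by (simp add: lyap_init gap_weight_def)
qed

end

section \<open>The tilted heat semigroup\<close>

definition hop :: "real \<Rightarrow> (int \<Rightarrow> real) \<Rightarrow> int \<Rightarrow> real" where
  "hop \<beta> \<psi> x = (exp \<beta> * \<psi> (x + 1) + exp (- \<beta>) * \<psi> (x - 1)) / 2"

text \<open>The semigroup of the walk that jumps right at rate \<open>exp \<beta> / 2\<close> and
  left at rate \<open>exp (- \<beta>) / 2\<close>, as the exponential series of
  \<open>hop \<beta>\<close> minus \<open>cosh \<beta>\<close>. Its mean displacement at time r is
  \<open>r * sinh \<beta>\<close>.\<close>

definition heat :: "real \<Rightarrow> real \<Rightarrow> (int \<Rightarrow> real) \<Rightarrow> int \<Rightarrow> real" where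
  "heat \<beta> r \<psi> x = exp (- (r * cosh \<beta>)) * (\<Sum>k. (hop \<beta> ^^ k) \<psi> x / fact k * r ^ k)"

lemma hop_bound:
  assumes "\<And>x. \<bar>\<psi> x\<bar> \<le> B"
  shows "\<bar>(hop \<beta> ^^ k) \<psi> x\<bar> \<le> B * cosh \<beta> ^ k"
proof (induction k arbitrary: x)
  case (Suc k)
  have "\<bar>hop \<beta> ((hop \<beta> ^^ k) \<psi>) x\<bar> \<le> (exp \<beta> * \<bar>(hop \<beta> ^^ k) \<psi> (x + 1)\<bar> + exp (- \<beta>) * \<bar>(hop \<beta> ^^ k) \<psi> (x - 1)\<bar>) / 2"
    unfolding hop_def[of \<beta> "(hop \<beta> ^^ k) \<psi>"] abs_divide abs_numeral
    by (rule divide_right_mono[OF order.trans[OF abs_triangle_ineq]]) (simp_all add: abs_mult)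
  also have "\<dots> \<le> (exp \<beta> * (B * cosh \<beta> ^ k) + exp (- \<beta>) * (B * cosh \<beta> ^ k)) / 2"
    by (intro divide_right_mono add_mono mult_left_mono Suc.IH) auto
  also have "\<dots> = B * cosh \<beta> ^ Suc k" by (simp add: cosh_def algebra_simps)
  finally show ?case by simp
qed (use assms in simp)

lemma hop_nonneg: "(\<And>x. 0 \<le> \<psi> x) \<Longrightarrow> 0 \<le> (hop \<beta> ^^ k) \<psi> x"
  by (induction k arbitrary: x) (simp_all add: hop_def)

lemma hop_diff: "(hop \<beta> ^^ k) (\<lambda>x. \<psi> (x + 1) - \<psi> x) x = (hop \<beta> ^^ k) \<psi> (x + 1) - (hop \<beta> ^^ k) \<psi> x"
proof (induction k arbitrary: x)
  case (Suc k)
  let ?d = "\<lambda>x. \<psi> (x + 1) - \<psi> x"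
  have e: "hop \<beta> ((hop \<beta> ^^ k) ?d) x = (exp \<beta> * ((hop \<beta> ^^ k) \<psi> (x + 1 + 1) - (hop \<beta> ^^ k) \<psi> (x + 1))
      + exp (- \<beta>) * ((hop \<beta> ^^ k) \<psi> (x - 1 + 1) - (hop \<beta> ^^ k) \<psi> (x - 1))) / 2"
    by (simp only: hop_def[of \<beta> "(hop \<beta> ^^ k) ?d"] Suc.IH)
  show ?case
    unfolding funpow.simps o_apply e hop_def[of \<beta> "(hop \<beta> ^^ k) \<psi>"] by (simp add: field_simps)
qed simp

lemma heat_summable:
  assumes "\<And>x. \<bar>\<psi> x\<bar> \<le> B"
  shows "summable (\<lambda>k. (hop \<beta> ^^ k) \<psi> x / fact k * r ^ k)"
proof (rule summable_comparison_test')
  show "summable (\<lambda>k. B * ((cosh \<beta> * \<bar>r\<bar>) ^ k /\<^sub>R fact k))"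
    by (intro summable_mult summable_exp_generic)
  show "norm ((hop \<beta> ^^ k) \<psi> x / fact k * r ^ k) \<le> B * ((cosh \<beta> * \<bar>r\<bar>) ^ k /\<^sub>R fact k)" for k
  proof -
    have "\<bar>(hop \<beta> ^^ k) \<psi> x\<bar> * (\<bar>r\<bar> ^ k / fact k) \<le> (B * cosh \<beta> ^ k) * (\<bar>r\<bar> ^ k / fact k)"
      by (intro mult_right_mono hop_bound assms) auto
    then show ?thesis by (simp add: abs_mult power_abs power_mult_distrib divide_inverse mult_ac)
  qed
qed

lemma heat_bound:
  assumes "\<And>x. \<bar>\<psi> x\<bar> \<le> B" "0 \<le> r"
  shows "\<bar>heat \<beta> r \<psi> x\<bar> \<le> B"
proof -
  have s: "summable (\<lambda>k. B * ((cosh \<beta> * r) ^ k /\<^sub>R fact k))"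
    by (intro summable_mult summable_exp_generic)
  have t: "\<bar>(hop \<beta> ^^ k) \<psi> x / fact k * r ^ k\<bar> \<le> B * ((cosh \<beta> * r) ^ k /\<^sub>R fact k)" for k
  proof -
    have "\<bar>(hop \<beta> ^^ k) \<psi> x\<bar> * (r ^ k / fact k) \<le> (B * cosh \<beta> ^ k) * (r ^ k / fact k)"
      using assms by (intro mult_right_mono hop_bound) auto
    then show ?thesis using assms(2) by (simp add: abs_mult power_mult_distrib divide_inverse mult_ac)
  qed
  have "\<bar>\<Sum>k. (hop \<beta> ^^ k) \<psi> x / fact k * r ^ k\<bar> \<le> (\<Sum>k. \<bar>(hop \<beta> ^^ k) \<psi> x / fact k * r ^ k\<bar>)"
    by (rule summable_rabs) (rule summable_comparison_test'[OF s], use t in simp)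
  also have "\<dots> \<le> (\<Sum>k. B * ((cosh \<beta> * r) ^ k /\<^sub>R fact k))"
    by (intro suminf_le t s summable_comparison_test'[OF s]) (use t in simp)
  also have "\<dots> = B * exp (cosh \<beta> * r)"
    unfolding exp_def by (rule suminf_mult[OF summable_exp_generic])
  finally have "exp (- (r * cosh \<beta>)) * \<bar>\<Sum>k. (hop \<beta> ^^ k) \<psi> x / fact k * r ^ k\<bar> \<le> exp (- (r * cosh \<beta>)) * (B * exp (cosh \<beta> * r))"
    by (rule mult_left_mono) simp
  then show ?thesis by (simp add: heat_def abs_mult exp_minus field_simps)
qed

lemma heat_0: "heat \<beta> 0 \<psi> x = \<psi> x"
  unfolding heat_def using powser_zero[of "\<lambda>k. (hop \<beta> ^^ k) \<psi> x / fact k"] by simp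

lemma heat_ge_term:
  assumes "\<And>x. \<bar>\<psi> x\<bar> \<le> B" "\<And>x. 0 \<le> \<psi> x" "0 \<le> r"
  shows "exp (- (r * cosh \<beta>)) * ((hop \<beta> ^^ k) \<psi> x / fact k * r ^ k) \<le> heat \<beta> r \<psi> x"
  unfolding heat_def
  using sum_le_suminf[OF heat_summable[where \<psi>=\<psi> and B=B, OF assms(1)], where I="{k}"] hop_nonneg[where \<psi>=\<psi>, OF assms(2)] assms(3)
  by (intro mult_left_mono) auto

lemma heat_nonneg:
  assumes "\<And>x. \<bar>\<psi> x\<bar> \<le> B" "\<And>x. 0 \<le> \<psi> x" "0 \<le> r"
  shows "0 \<le> heat \<beta> r \<psi> x"
  by (rule order.trans[OF _ heat_ge_term[where \<psi>=\<psi> and B=B and \<beta>=\<beta> and k=0 and x=x, OF assms]]) (use assms in auto)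

lemma heat_diff:
  assumes "\<And>x. \<bar>\<psi> x\<bar> \<le> B"
  shows "heat \<beta> r \<psi> (x + 1) - heat \<beta> r \<psi> x = heat \<beta> r (\<lambda>x. \<psi> (x + 1) - \<psi> x) x"
  unfolding heat_def hop_diff diff_divide_distrib left_diff_distrib
    suminf_diff[OF heat_summable[where \<psi>=\<psi> and B=B, OF assms] heat_summable[where \<psi>=\<psi> and B=B, OF assms], symmetric]
  by (simp add: right_diff_distrib)

lemma heat_derivative:
  assumes b: "\<And>x. \<bar>\<psi> x\<bar> \<le> B"
  shows "((\<lambda>r. heat \<beta> r \<psi> x) has_real_derivative (hop \<beta> (heat \<beta> r \<psi>) x - cosh \<beta> * heat \<beta> r \<psi> x)) (at r)"
proof -
  let ?c = "\<lambda>k. (hop \<beta> ^^ k) \<psi> x / fact k"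
  have d: "((\<lambda>r. \<Sum>k. ?c k * r ^ k) has_real_derivative (\<Sum>k. diffs ?c k * r ^ k)) (at r)"
    by (rule termdiffs_strong_converges_everywhere) (rule heat_summable[where \<psi>=\<psi> and B=B, OF b])
  have "diffs ?c k * r ^ k = (exp \<beta> * ((hop \<beta> ^^ k) \<psi> (x + 1) / fact k * r ^ k) + exp (- \<beta>) * ((hop \<beta> ^^ k) \<psi> (x - 1) / fact k * r ^ k)) / 2" for k
    by (simp add: diffs_def hop_def[of _ "(hop \<beta> ^^ k) \<psi>"] field_simps del: of_nat_Suc)
  moreover note sums_divide[OF sums_add[OF
      sums_mult[OF summable_sums[OF heat_summable[where \<psi>=\<psi> and B=B and \<beta>=\<beta> and x="x + 1" and r=r, OF b]], of "exp \<beta>"]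
      sums_mult[OF summable_sums[OF heat_summable[where \<psi>=\<psi> and B=B and \<beta>=\<beta> and x="x - 1" and r=r, OF b]], of "exp (- \<beta>)"]], of 2]
  ultimately have "(\<Sum>k. diffs ?c k * r ^ k) = (exp \<beta> * (\<Sum>k. (hop \<beta> ^^ k) \<psi> (x + 1) / fact k * r ^ k) + exp (- \<beta>) * (\<Sum>k. (hop \<beta> ^^ k) \<psi> (x - 1) / fact k * r ^ k)) / 2"
    by (simp only: sums_iff)
  note d' = d[unfolded this]
  have "((\<lambda>r. exp (- (r * cosh \<beta>))) has_real_derivative - cosh \<beta> * exp (- (r * cosh \<beta>))) (at r)"
    by (auto intro!: derivative_eq_intros)
  from DERIV_mult[OF this d'] show ?thesis
    by (simp add: heat_def hop_def field_simps)
qed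

text \<open>Only paths with i steps to the right and k - i to the left are kept; distinguishing the
  first step counts them by Pascal's rule.\<close>

lemma hop_ge_binomial:
  assumes "\<And>x. 0 \<le> \<psi> x"
  shows "i \<le> k \<Longrightarrow> real (k choose i) * (exp \<beta> / 2) ^ i * (exp (- \<beta>) / 2) ^ (k - i) * \<psi> (x + int i - int (k - i)) \<le> (hop \<beta> ^^ k) \<psi> x"
proof (induction k arbitrary: i x)
  case (Suc k)
  let ?a = "exp \<beta> / 2" and ?b = "exp (- \<beta>) / 2"
  let ?P = "\<lambda>k. (hop \<beta> ^^ k) \<psi>"
  have nn: "0 \<le> ?a * ?P k (x + 1)" "0 \<le> ?b * ?P k (x - 1)" using hop_nonneg[where \<psi>=\<psi> and \<beta>=\<beta> and k=k, OF assms] by simp_all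
  have step: "?P (Suc k) x = ?a * ?P k (x + 1) + ?b * ?P k (x - 1)"
    by (simp add: hop_def add_divide_distrib)
  show ?case
  proof (cases i)
    case 0
    have "real (k choose 0) * ?a ^ 0 * ?b ^ (k - 0) * \<psi> (x - 1 + int 0 - int (k - 0)) \<le> ?P k (x - 1)"
      by (rule Suc.IH) simp
    then have "?b * (?b ^ k * \<psi> (x - 1 - int k)) \<le> ?b * ?P k (x - 1)" by (intro mult_left_mono) auto
    moreover have "real (Suc k choose i) * ?a ^ i * ?b ^ (Suc k - i) * \<psi> (x + int i - int (Suc k - i)) =
        ?b * (?b ^ k * \<psi> (x - 1 - int k))"
      using 0 by (simp add: algebra_simps)
    ultimately show ?thesis unfolding step using nn by linarith
  next
    case (Suc j)
    then have j: "j \<le> k" using Suc.prems by simp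
    let ?z = "x + int i - int (Suc k - i)"
    have z1: "x + 1 + int j - int (k - j) = ?z" using Suc j by simp
    have 1: "real (k choose j) * ?a ^ j * ?b ^ (k - j) * \<psi> ?z \<le> ?P k (x + 1)"
      using Suc.IH[OF j, of "x + 1"] unfolding z1 .
    have t1: "real (k choose j) * ?a ^ i * ?b ^ (Suc k - i) * \<psi> ?z \<le> ?a * ?P k (x + 1)"
      using mult_left_mono[OF 1, of ?a] Suc by (simp add: mult_ac)
    have t2: "real (k choose i) * ?a ^ i * ?b ^ (Suc k - i) * \<psi> ?z \<le> ?b * ?P k (x - 1)"
    proof (cases "i \<le> k")
      case True
      have z2: "x - 1 + int i - int (k - i) = ?z" using True by simp
      have 2: "real (k choose i) * ?a ^ i * ?b ^ (k - i) * \<psi> ?z \<le> ?P k (x - 1)"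
        using Suc.IH[OF True, of "x - 1"] unfolding z2 .
      show ?thesis using mult_left_mono[OF 2, of ?b] True by (simp add: Suc_diff_le mult_ac)
    next
      case False
      then show ?thesis using nn by (simp add: binomial_eq_0)
    qed
    have "real (Suc k choose i) = real (k choose j) + real (k choose i)" using Suc by simp
    then show ?thesis unfolding step using t1 t2 by (simp add: algebra_simps)
  qed
qed simp

text \<open>Right and left jumps of the walk are independent Poisson variables, and a single pair of
  jump counts already bounds the semigroup from below.\<close>

lemma heat_ge_poisson:
  assumes "\<And>x. \<bar>\<psi> x\<bar> \<le> B" "\<And>x. 0 \<le> \<psi> x" "0 \<le> r"
  shows "(exp (- (r * exp \<beta> / 2)) * (r * exp \<beta> / 2) ^ i / fact i) * (exp (- (r * exp (- \<beta>) / 2)) * (r * exp (- \<beta>) / 2) ^ j / fact j)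
     * \<psi> (x + int i - int j) \<le> heat \<beta> r \<psi> x"
proof -
  have "real ((i + j) choose i) * (exp \<beta> / 2) ^ i * (exp (- \<beta>) / 2) ^ j * \<psi> (x + int i - int j) \<le> (hop \<beta> ^^ (i + j)) \<psi> x"
    using hop_ge_binomial[where \<psi>=\<psi> and i=i and k="i + j" and \<beta>=\<beta> and x=x, OF assms(2)] by simp
  then have "exp (- (r * cosh \<beta>)) * (real ((i + j) choose i) * (exp \<beta> / 2) ^ i * (exp (- \<beta>) / 2) ^ j * \<psi> (x + int i - int j) / fact (i + j) * r ^ (i + j))
     \<le> exp (- (r * cosh \<beta>)) * ((hop \<beta> ^^ (i + j)) \<psi> x / fact (i + j) * r ^ (i + j))"
    using assms(3) by (intro mult_left_mono mult_right_mono divide_right_mono) auto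
  also have "\<dots> \<le> heat \<beta> r \<psi> x" by (rule heat_ge_term[where \<psi>=\<psi> and B=B, OF assms])
  finally have "exp (- (r * cosh \<beta>)) * (real ((i + j) choose i) * (exp \<beta> / 2) ^ i * (exp (- \<beta>) / 2) ^ j * \<psi> (x + int i - int j) / fact (i + j) * r ^ (i + j))
     \<le> heat \<beta> r \<psi> x" .
  moreover have "real ((i + j) choose i) = fact (i + j) / (fact i * fact j)"
    using binomial_fact[of i "i + j", where 'a=real] by simp
  moreover have "exp (- (r * cosh \<beta>)) = exp (- (r * exp \<beta> / 2)) * exp (- (r * exp (- \<beta>) / 2))"
    by (simp add: exp_add[symmetric] cosh_def field_simps)
  ultimately show ?thesis
    by (simp add: power_mult_distrib power_add power_divide mult_ac)
qed

definition wt :: "real \<Rightarrow> real \<Rightarrow> int \<Rightarrow> real" where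
  "wt \<beta> s x = exp (\<beta> * of_int x - s * (cosh \<beta> - 1))"

lemma tilt2_wt: "tilt2 \<beta> s x y = wt \<beta> s x * wt \<beta> s y"
  by (simp add: tilt2_def wt_def exp_add[symmetric] algebra_simps)

lemma wt_pos: "0 < wt \<beta> s x" by (simp add: wt_def)

lemma wt_shift: "wt \<beta> s (x + 1) = exp \<beta> * wt \<beta> s x" "wt \<beta> s (1 + x) = exp \<beta> * wt \<beta> s x" "wt \<beta> s (x - 1) = exp (- \<beta>) * wt \<beta> s x"
  by (simp_all add: wt_def exp_add[symmetric] algebra_simps)

lemma tame_wt: "tame {0..T} (\<lambda>s x y. wt \<beta> s x)" "tame {0..T} (\<lambda>s x y. wt \<beta> s y)"
proof -
  have "tame {0..T} (\<lambda>s x y. exp (\<beta> * of_int x + 0 * of_int y) * exp (- s * (cosh \<beta> - 1)))"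
    "tame {0..T} (\<lambda>s x y. exp (0 * of_int x + \<beta> * of_int y) * exp (- s * (cosh \<beta> - 1)))"
    by (intro tame_mult tame_exp tame_bounded[of _ _ 1]; auto simp: cosh_real_ge_1)+
  then show "tame {0..T} (\<lambda>s x y. wt \<beta> s x)" "tame {0..T} (\<lambda>s x y. wt \<beta> s y)"
    by (simp_all add: wt_def[abs_def] exp_add[symmetric] algebra_simps)
qed

text \<open>Minus the generator of the walk with jump rate 1/2 in each direction: the time
  derivative of a solution of the backward equation.\<close>

definition backward :: "(int \<Rightarrow> real) \<Rightarrow> int \<Rightarrow> real" where
  "backward g x = - (g (x + 1) + g (x - 1) - 2 * g x) / 2"

lemma tame_back:
  assumes "tame A (\<lambda>s x y. g s x)" "tame A (\<lambda>s x y. g s y)"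
  shows "tame A (\<lambda>s x y. backward (g s) x)" "tame A (\<lambda>s x y. backward (g s) y)"
proof -
  have "tame A (\<lambda>s x y. (- 1/2) * (g s (x + 1) + g s (x + (- 1)) - 2 * g s x))"
    by (intro tame_mult tame_const tame_add tame_diff assms(1)
        tame_shift[OF assms(1)])
  then show "tame A (\<lambda>s x y. backward (g s) x)"
    by (rule subst[where P="tame A", rotated]) (auto simp: fun_eq_iff backward_def field_simps)
  have "tame A (\<lambda>s x y. (- 1/2) * (g s (y + 1) + g s (y + (- 1)) - 2 * g s y))"
    by (intro tame_mult tame_const tame_add tame_diff assms(2)
        tame_shift[OF assms(2)])
  then show "tame A (\<lambda>s x y. backward (g s) y)"
    by (rule subst[where P="tame A", rotated]) (auto simp: fun_eq_iff backward_def field_simps)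
qed

text \<open>Multiplication by the tilt turns the generator \<open>hop \<beta>\<close> minus
  \<open>cosh \<beta>\<close> into that of the symmetric walk; the decay rate
  \<open>cosh \<beta> - 1\<close> of the tilt accounts for the difference of the constants.\<close>

lemma wt_heat_backward:
  assumes "\<And>x. \<bar>\<psi> x\<bar> \<le> B"
  shows "((\<lambda>s. wt \<beta> s x * heat \<beta> (T - s) \<psi> x) has_real_derivative backward (\<lambda>x. wt \<beta> s x * heat \<beta> (T - s) \<psi> x) x) (at s within A)"
proof -
  have "((\<lambda>s. T - s) has_real_derivative - 1) (at s within A)" by (auto intro!: derivative_eq_intros)
  from DERIV_chain2[OF heat_derivative[where \<psi>=\<psi> and B=B, OF assms] this]
  have "((\<lambda>s. heat \<beta> (T - s) \<psi> x) has_real_derivative (hop \<beta> (heat \<beta> (T - s) \<psi>) x - cosh \<beta> * heat \<beta> (T - s) \<psi> x) * - 1) (at s within A)" .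
  moreover have "((\<lambda>s. wt \<beta> s x) has_real_derivative - (cosh \<beta> - 1) * wt \<beta> s x) (at s within A)"
    unfolding wt_def by (auto intro!: derivative_eq_intros)
  ultimately show ?thesis
    by (auto intro!: derivative_eq_intros simp: backward_def wt_shift hop_def field_simps)
qed

lemma tame_wt_heat:
  assumes "\<And>x. \<bar>\<psi> x\<bar> \<le> B"
  shows "tame {0..T} (\<lambda>s x y. wt \<beta> s x * heat \<beta> (T - s) \<psi> x)" "tame {0..T} (\<lambda>s x y. wt \<beta> s y * heat \<beta> (T - s) \<psi> y)"
  by (intro tame_mult tame_wt tame_bounded[of _ _ B] heat_bound assms; simp)+

section \<open>Moments along the backward heat flow\<close>

context two_point
begin

text \<open>The mixed difference of a weight depending on x alone vanishes. The interaction drops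
  out, and a solution of the backward equation pairs to a constant.\<close>

lemma single_constant:
  assumes T: "0 < T" and g: "tame {0..T} (\<lambda>s x y. g s x)" "tame {0..T} (\<lambda>s x y. g s y)"
    and d: "\<And>s x. s \<in> {0..T} \<Longrightarrow> ((\<lambda>s. g s x) has_real_derivative backward (g s) x) (at s within {0..T})"
  shows "S2 (\<lambda>x y. m T x y * g T x) = g 0 0"
proof -
  have "((\<lambda>s. S2 (\<lambda>x y. m s x y * g s x)) has_real_derivative 0) (at s within {0..T})" if s: "s \<in> {0..T}" for s
  proof -
    have "((\<lambda>s. S2 (\<lambda>x y. m s x y * g s x)) has_real_derivative
        S2 (\<lambda>x y. m s x y * (lap (\<lambda>x y. g s x) x y + backward (g s) x)) + (\<Sum>\<^sub>\<infinity>b. dd (m s) b * dd (\<lambda>x y. g s x) b) / 4) (at s within {0..T})"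
      by (rule pairing[OF T g(1) tame_back(1)[OF g] d s])
    moreover have "lap (\<lambda>x y. g s x) x y + backward (g s) x = 0" for x y
      by (simp add: lap_def backward_def field_simps)
    ultimately show ?thesis by (simp add: dd_def[of "\<lambda>x y. g s x"] S2_def)
  qed
  note d0 = this
  have "S2 (\<lambda>x y. m 0 x y * g 0 x) \<le> S2 (\<lambda>x y. m T x y * g T x)"
    by (rule DERIV_within_nonneg_mono[where g="\<lambda>s. S2 (\<lambda>x y. m s x y * g s x)" and g'="\<lambda>_. 0"]) (use T d0 in auto)
  moreover have "- S2 (\<lambda>x y. m 0 x y * g 0 x) \<le> - S2 (\<lambda>x y. m T x y * g T x)"
    by (rule DERIV_within_nonneg_mono[where g="\<lambda>s. - S2 (\<lambda>x y. m s x y * g s x)" and g'="\<lambda>_. 0"])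
      (use T DERIV_minus[OF d0] in auto)
  ultimately have "S2 (\<lambda>x y. m T x y * g T x) = S2 (\<lambda>x y. m 0 x y * g 0 x)" by simp
  then show ?thesis by (simp add: S2_init)
qed

text \<open>For a product of two solutions the transport terms cancel, and the interaction with the
  squared increment of g is all that remains.\<close>

lemma pair_derivative:
  assumes T: "0 < T" and g: "tame {0..T} (\<lambda>s x y. g s x)" "tame {0..T} (\<lambda>s x y. g s y)"
    and d: "\<And>s x. s \<in> {0..T} \<Longrightarrow> ((\<lambda>s. g s x) has_real_derivative backward (g s) x) (at s within {0..T})"
    and s: "s \<in> {0..T}"
  shows "((\<lambda>s. S2 (\<lambda>x y. m s x y * (g s x * g s y))) has_real_derivative
     (\<Sum>\<^sub>\<infinity>b. dd (m s) b * (g s (b + 1) - g s b)\<^sup>2) / 4) (at s within {0..T})"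
    and "(\<lambda>b. dd (m s) b * (g s (b + 1) - g s b)\<^sup>2) summable_on UNIV"
proof -
  have sq: "dd (\<lambda>x y. g s x * g s y) b = (g s (b + 1) - g s b)\<^sup>2" for b
    by (simp add: dd_def power2_eq_square algebra_simps)
  have tg: "tame {0..T} (\<lambda>s x y. g s x * g s y)" by (intro tame_mult g)
  have "((\<lambda>s. S2 (\<lambda>x y. m s x y * (g s x * g s y))) has_real_derivative
        S2 (\<lambda>x y. m s x y * (lap (\<lambda>x y. g s x * g s y) x y + (backward (g s) x * g s y + g s x * backward (g s) y)))
         + (\<Sum>\<^sub>\<infinity>b. dd (m s) b * dd (\<lambda>x y. g s x * g s y) b) / 4) (at s within {0..T})"
  proof (rule pairing[OF T tg _ _ s])
    show "tame {0..T} (\<lambda>s x y. backward (g s) x * g s y + g s x * backward (g s) y)"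
      by (intro tame_add tame_mult g tame_back)
    show "((\<lambda>s. g s x * g s y) has_real_derivative backward (g s) x * g s y + g s x * backward (g s) y) (at s within {0..T})"
      if "s \<in> {0..T}" for s x y
      using DERIV_mult[OF d[OF that, of x] d[OF that, of y]] by (simp add: algebra_simps)
  qed
  moreover have "lap (\<lambda>x y. g s x * g s y) x y + (backward (g s) x * g s y + g s x * backward (g s) y) = 0" for x y
    by (simp add: lap_def backward_def field_simps)
  ultimately show "((\<lambda>s. S2 (\<lambda>x y. m s x y * (g s x * g s y))) has_real_derivative
     (\<Sum>\<^sub>\<infinity>b. dd (m s) b * (g s (b + 1) - g s b)\<^sup>2) / 4) (at s within {0..T})"
    by (simp add: sq S2_def)
  have "s \<ge> 0" "tame {s} (\<lambda>s x y. g s x * g s y)" using s tame_subset[OF tg] by auto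
  from rapid_dd_summable[OF rapid_at[OF this(1)] this(2)]
  show "(\<lambda>b. dd (m s) b * (g s (b + 1) - g s b)\<^sup>2) summable_on UNIV" by (simp add: sq)
qed

lemma mean_formula:
  assumes T: "0 < T" and \<psi>: "\<And>x. \<bar>\<psi> x\<bar> \<le> B"
  shows "S2 (\<lambda>x y. m T x y * (wt \<beta> T x * \<psi> x)) = heat \<beta> T \<psi> 0"
  using single_constant[OF T tame_wt_heat[where \<psi>=\<psi> and B=B, OF \<psi>] wt_heat_backward[where \<psi>=\<psi> and B=B, OF \<psi>], of \<beta>]
  by (simp add: heat_0 wt_def)

lemma total_mass: "0 < T \<Longrightarrow> S2 (m T) = 1"
  using single_constant[of T "\<lambda>_ _. 1"] by (simp add: tame_const backward_def)

text \<open>Under the tilt the walk has mean \<open>s * sinh \<beta>\<close> and variance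
  \<open>s * cosh \<beta>\<close>. Correspondingly the tilt times the centred square minus the
  variance solves the backward equation and starts from zero.\<close>

lemma second_moment_formula:
  assumes T: "0 < T"
  shows "S2 (\<lambda>x y. m T x y * (wt \<beta> T x * ((of_int x - T * sinh \<beta>)\<^sup>2 - T * cosh \<beta>))) = 0"
proof -
  let ?g = "\<lambda>s x. wt \<beta> s x * ((of_int x - s * sinh \<beta>)\<^sup>2 - s * cosh \<beta>)"
  have "S2 (\<lambda>x y. m T x y * ?g T x) = ?g 0 0"
  proof (rule single_constant[OF T])
    have b: "tame {0..T} (\<lambda>s x y. s * c)" for c
      by (rule tame_bounded[of _ _ "T * \<bar>c\<bar>"]) (auto simp: abs_mult intro!: mult_right_mono)
    show "tame {0..T} (\<lambda>s x y. ?g s x)" "tame {0..T} (\<lambda>s x y. ?g s y)"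
      unfolding power2_eq_square by (intro tame_mult tame_diff tame_wt tame_of_int b)+
    fix s x
    have e: "exp \<beta> = cosh \<beta> + sinh \<beta>" "exp (- \<beta>) = cosh \<beta> - sinh \<beta>"
      by (simp_all add: cosh_plus_sinh cosh_minus_sinh)
    show "((\<lambda>s. ?g s x) has_real_derivative backward (?g s) x) (at s within {0..T})"
    proof -
      have 1: "((\<lambda>s. wt \<beta> s x) has_real_derivative - (cosh \<beta> - 1) * wt \<beta> s x) (at s within {0..T})"
        unfolding wt_def by (auto intro!: derivative_eq_intros)
      have 2: "((\<lambda>s. (of_int x - s * sinh \<beta>)\<^sup>2 - s * cosh \<beta>) has_real_derivative
          - 2 * sinh \<beta> * (of_int x - s * sinh \<beta>) - cosh \<beta>) (at s within {0..T})"
        by (auto intro!: derivative_eq_intros)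
      show ?thesis
        by (rule DERIV_cong[OF DERIV_mult[OF 1 2]])
          (simp add: backward_def wt_shift e power2_eq_square field_simps)
    qed
  qed
  then show ?thesis by simp
qed

end

locale two_point_psd = two_point +
  assumes dd_nonneg: "\<And>s b. 0 \<le> s \<Longrightarrow> 0 \<le> dd (m s) b"
begin

text \<open>
  Along the backward heat flow the first moment is constant, while the interaction term
  contributes a sum of squares.
\<close>

lemma second_moment_mono:
  assumes T: "0 < T" and s: "0 \<le> s" "s \<le> T" and \<psi>: "\<And>x. \<bar>\<psi> x\<bar> \<le> B"
  shows "S2 (\<lambda>x y. m s x y * ((wt \<beta> s x * heat \<beta> (T - s) \<psi> x) * (wt \<beta> s y * heat \<beta> (T - s) \<psi> y)))
    \<le> S2 (\<lambda>x y. m T x y * ((wt \<beta> T x * \<psi> x) * (wt \<beta> T y * \<psi> y)))"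
proof -
  let ?g = "\<lambda>s x. wt \<beta> s x * heat \<beta> (T - s) \<psi> x"
  let ?V = "\<lambda>s. S2 (\<lambda>x y. m s x y * (?g s x * ?g s y))"
  have "?V s \<le> ?V T"
  proof (rule DERIV_within_nonneg_mono[where g = ?V and g' = "\<lambda>s. (\<Sum>\<^sub>\<infinity>b. dd (m s) b * (?g s (b + 1) - ?g s b)\<^sup>2) / 4"])
    fix u assume u: "s \<le> u" "u \<le> T"
    then have "u \<in> {0..T}" using s by simp
    from has_field_derivative_subset[OF pair_derivative(1)[OF T tame_wt_heat[where \<psi>=\<psi> and B=B, OF \<psi>] wt_heat_backward[where \<psi>=\<psi> and B=B, OF \<psi>] this], of "{s..T}"]
    show "(?V has_real_derivative (\<Sum>\<^sub>\<infinity>b. dd (m u) b * (?g u (b + 1) - ?g u b)\<^sup>2) / 4) (at u within {s..T})"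
      using s by auto
    show "0 \<le> (\<Sum>\<^sub>\<infinity>b. dd (m u) b * (?g u (b + 1) - ?g u b)\<^sup>2) / 4"
      using u s by (intro divide_nonneg_nonneg infsum_nonneg mult_nonneg_nonneg dd_nonneg) auto
  qed (use s in simp)
  then show ?thesis by (simp add: heat_0)
qed

text \<open>The increment of tilt times heat flow splits into an increment of the tilt, whose square
  relative to the tilt of the bond is at most 2 (cosh \<beta> - 1) B^2, and an increment of the
  flow, at most l. The first part is matched by the growth of 2 B^2 times the total second moment,
  which is therefore subtracted; only the second has to be paid for through
  \<open>diag\<close>.\<close>

lemma variance_bound:
  assumes T: "0 < T" and \<beta>: "0 \<le> \<beta>" and \<psi>: "\<And>x. \<bar>\<psi> x\<bar> \<le> B" and lip: "\<And>x. \<bar>\<psi> (x + 1) - \<psi> x\<bar> \<le> l"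
    and \<mu>: "0 < \<mu>" "\<mu> \<le> 1" and pot: "pot \<beta> \<mu> \<le> - \<rho>" and \<rho>: "0 < \<rho>"
  shows "S2 (\<lambda>x y. m T x y * ((wt \<beta> T x * \<psi> x) * (wt \<beta> T y * \<psi> y))) - (heat \<beta> T \<psi> 0)\<^sup>2
     \<le> 2 * B\<^sup>2 * (lyap \<beta> (\<lambda>_. 1) T - 1) + 2 * cosh \<beta> * l\<^sup>2 / \<rho> * exp (rate \<beta> \<mu> * T)"
proof -
  let ?h = "\<lambda>s. heat \<beta> (T - s) \<psi>"
  let ?g = "\<lambda>s x. wt \<beta> s x * ?h s x"
  let ?V = "\<lambda>s. S2 (\<lambda>x y. m s x y * (?g s x * ?g s y))"
  let ?V' = "\<lambda>s. (\<Sum>\<^sub>\<infinity>b. dd (m s) b * (?g s (b + 1) - ?g s b)\<^sup>2) / 4"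
  let ?c = "cosh \<beta>"
  have "?V T - 2 * B\<^sup>2 * lyap \<beta> (\<lambda>_. 1) T \<le> ?V 0 - 2 * B\<^sup>2 * lyap \<beta> (\<lambda>_. 1) 0 + 2 * (?c * l\<^sup>2) / \<rho> * exp (rate \<beta> \<mu> * T)"
  proof (rule lyap_potential[OF T \<mu> pot \<rho>, where V' = "\<lambda>s. ?V' s - 2 * B\<^sup>2 * ((?c - 1) / 2 * grad \<beta> s)"])
    fix s assume s: "s \<in> {0..T}"
    then have s0: "0 \<le> s" by simp
    note pd = pair_derivative[OF T tame_wt_heat[where \<psi>=\<psi> and B=B, OF \<psi>] wt_heat_backward[where \<psi>=\<psi> and B=B and \<beta>=\<beta>, OF \<psi>] s]
    show "((\<lambda>s. ?V s - 2 * B\<^sup>2 * lyap \<beta> (\<lambda>_. 1) s) has_real_derivative ?V' s - 2 * B\<^sup>2 * ((?c - 1) / 2 * grad \<beta> s)) (at s within {0..T})"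
      by (intro DERIV_diff DERIV_cmult pd(1) lyap_1_derivative[OF T s])
    let ?e = "\<lambda>b. exp (\<beta> * (2 * of_int b + 1) - 2 * s * (?c - 1))"
    have sq: "(?g s (b + 1) - ?g s b)\<^sup>2 \<le> ?e b * (4 * (?c - 1) * B\<^sup>2 + 2 * l\<^sup>2)" for b
    proof -
      have h: "\<bar>?h s (b + 1)\<bar> \<le> B" "\<bar>?h s (b + 1) - ?h s b\<bar> \<le> l"
        using s by (auto simp: heat_diff[where \<psi>=\<psi> and B=B, OF \<psi>] intro!: heat_bound \<psi> lip)
      define p q where "p = (exp \<beta> - 1) * ?h s (b + 1)" and "q = ?h s (b + 1) - ?h s b"
      have "?g s (b + 1) - ?g s b = wt \<beta> s b * (p + q)"
        by (simp add: wt_shift p_def q_def algebra_simps)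
      then have "(?g s (b + 1) - ?g s b)\<^sup>2 = (wt \<beta> s b)\<^sup>2 * (p + q)\<^sup>2"
        by (simp add: power_mult_distrib)
      also have "(p + q)\<^sup>2 \<le> 2 * p\<^sup>2 + 2 * q\<^sup>2"
        using zero_le_power2[of "p - q"] by (simp add: power2_eq_square algebra_simps)
      also have "p\<^sup>2 \<le> (exp \<beta> - 1)\<^sup>2 * B\<^sup>2"
        unfolding p_def power_mult_distrib using h(1) by (intro mult_left_mono) (auto simp: abs_le_square_iff[symmetric])
      also have "q\<^sup>2 \<le> l\<^sup>2"
        unfolding q_def using h(2) by (auto simp: abs_le_square_iff[symmetric])
      also have "(wt \<beta> s b)\<^sup>2 * (2 * ((exp \<beta> - 1)\<^sup>2 * B\<^sup>2) + 2 * l\<^sup>2) =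
          ?e b * (2 * (exp (- \<beta>) * (exp \<beta> - 1)\<^sup>2) * B\<^sup>2 + exp (- \<beta>) * (2 * l\<^sup>2))"
      proof -
        have "(wt \<beta> s b)\<^sup>2 = ?e b * exp (- \<beta>)"
          by (simp add: wt_def power2_eq_square exp_add[symmetric] algebra_simps)
        then show ?thesis by (simp add: algebra_simps)
      qed
      also have "exp (- \<beta>) * (exp \<beta> - 1)\<^sup>2 = 2 * (?c - 1)"
        by (simp add: cosh_def power2_eq_square exp_minus field_simps)
      also have "exp (- \<beta>) * (2 * l\<^sup>2) \<le> 1 * (2 * l\<^sup>2)" using \<beta> by (intro mult_right_mono) auto
      finally show ?thesis by (simp add: mult_left_mono)
    qed
    have "?V' s \<le> (\<Sum>\<^sub>\<infinity>b. dd (m s) b * ?e b * (4 * (?c - 1) * B\<^sup>2 + 2 * l\<^sup>2)) / 4"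
    proof (intro divide_right_mono infsum_mono)
      show "(\<lambda>b. dd (m s) b * ?e b * (4 * (?c - 1) * B\<^sup>2 + 2 * l\<^sup>2)) summable_on UNIV"
        by (intro summable_on_cmult_left grad_summable(1)[OF s0])
      show "dd (m s) b * (?g s (b + 1) - ?g s b)\<^sup>2 \<le> dd (m s) b * ?e b * (4 * (?c - 1) * B\<^sup>2 + 2 * l\<^sup>2)" for b
        unfolding mult.assoc[of "dd (m s) b"] by (intro mult_left_mono sq dd_nonneg[OF s0])
    qed (use pd(2) in auto)
    also have "\<dots> = grad \<beta> s * (4 * (?c - 1) * B\<^sup>2 + 2 * l\<^sup>2) / 4"
      by (simp add: infsum_cmult_left' grad_def)
    also have "\<dots> = 2 * B\<^sup>2 * ((?c - 1) / 2 * grad \<beta> s) + l\<^sup>2 / 2 * grad \<beta> s" by (simp add: field_simps)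
    also have "l\<^sup>2 / 2 * grad \<beta> s \<le> l\<^sup>2 / 2 * (2 * ?c * diag \<beta> s)"
      by (intro mult_left_mono grad_le[OF s0]) auto
    finally show "?V' s - 2 * B\<^sup>2 * ((?c - 1) / 2 * grad \<beta> s) \<le> ?c * l\<^sup>2 * diag \<beta> s" by (simp add: mult_ac)
  qed (simp add: less_imp_le[OF cosh_real_pos])
  moreover have "?V 0 = (heat \<beta> T \<psi> 0)\<^sup>2" by (subst S2_init) (simp add: wt_def power2_eq_square)
  ultimately show ?thesis by (simp add: heat_0 lyap_init algebra_simps)
qed

end

section \<open>Linear statistics of the profile\<close>

lemma infsum_via_bij:
  fixes f :: "'i \<Rightarrow> real" and e :: "nat \<Rightarrow> 'i"
  assumes e: "bij e"
  shows "f summable_on UNIV \<longleftrightarrow> summable (\<lambda>n. norm (f (e n)))"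
    and "summable (\<lambda>n. norm (f (e n))) \<Longrightarrow> infsum f UNIV = (\<Sum>n. f (e n))"
proof -
  have "f summable_on UNIV \<longleftrightarrow> (\<lambda>i. norm (f i)) summable_on UNIV"
    by (rule summable_on_iff_abs_summable_on_real)
  also have "\<dots> \<longleftrightarrow> (\<lambda>n. norm (f (e n))) summable_on UNIV"
    using summable_on_reindex_bij_betw[OF e, of "\<lambda>i. norm (f i)"] by simp
  also have "\<dots> \<longleftrightarrow> summable (\<lambda>n. norm (f (e n)))"
    by (rule summable_on_UNIV_nonneg_real_iff) simp
  finally show "f summable_on UNIV \<longleftrightarrow> summable (\<lambda>n. norm (f (e n)))" .
  assume s: "summable (\<lambda>n. norm (f (e n)))"
  have "((\<lambda>n. f (e n)) has_sum (\<Sum>n. f (e n))) UNIV"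
    by (rule norm_summable_imp_has_sum[OF s summable_sums[OF summable_norm_cancel[OF s]]])
  then have "infsum (\<lambda>n. f (e n)) UNIV = (\<Sum>n. f (e n))" by (rule infsumI)
  then show "infsum f UNIV = (\<Sum>n. f (e n))"
    using infsum_reindex_bij_betw[OF e, of f] by simp
qed

text \<open>The sum has the default value 0 on non-summable families, so it is described separately
  on the measurable set where the series of absolute values is finite and on its complement.\<close>

lemma borel_measurable_infsum_bij:
  fixes f :: "'i \<Rightarrow> 'a \<Rightarrow> real" and e :: "nat \<Rightarrow> 'i"
  assumes e: "bij e" and [measurable]: "\<And>i. f i \<in> borel_measurable M"
  shows "(\<lambda>\<omega>. \<Sum>\<^sub>\<infinity>i. f i \<omega>) \<in> borel_measurable M"
proof -
  have sm: "summable (\<lambda>n. norm (f (e n) \<omega>)) \<longleftrightarrow> (\<Sum>n. ennreal \<bar>f (e n) \<omega>\<bar>) \<noteq> top" for \<omega>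
  proof
    assume "summable (\<lambda>n. norm (f (e n) \<omega>))"
    then have "(\<Sum>n. ennreal \<bar>f (e n) \<omega>\<bar>) = ennreal (\<Sum>n. \<bar>f (e n) \<omega>\<bar>)"
      by (intro suminf_ennreal2) simp_all
    then show "(\<Sum>n. ennreal \<bar>f (e n) \<omega>\<bar>) \<noteq> top" by simp
  next
    assume "(\<Sum>n. ennreal \<bar>f (e n) \<omega>\<bar>) \<noteq> top"
    then show "summable (\<lambda>n. norm (f (e n) \<omega>))"
      unfolding real_norm_def by (rule summable_suminf_not_top[rotated]) simp
  qed
  have m: "(\<lambda>\<omega>. if (\<Sum>n. ennreal \<bar>f (e n) \<omega>\<bar>) \<noteq> top then (\<Sum>n. f (e n) \<omega>) else 0) \<in> borel_measurable M"
    by measurable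
  have eq: "(\<Sum>\<^sub>\<infinity>i. f i \<omega>) = (if (\<Sum>n. ennreal \<bar>f (e n) \<omega>\<bar>) \<noteq> top then (\<Sum>n. f (e n) \<omega>) else 0)" for \<omega>
  proof (cases "summable (\<lambda>n. norm (f (e n) \<omega>))")
    case True
    then show ?thesis using infsum_via_bij(2)[OF e, of "\<lambda>i. f i \<omega>"] sm[of \<omega>] by simp
  next
    case False
    then have "\<not> (\<lambda>i. f i \<omega>) summable_on UNIV" using infsum_via_bij(1)[OF e, of "\<lambda>i. f i \<omega>"] by simp
    then show ?thesis using False sm[of \<omega>] by (simp add: infsum_not_exists)
  qed
  show ?thesis unfolding eq by (rule m)
qed

text \<open>Tonelli: finiteness of the sum of the means forces almost sure absolute convergence,
  after which sum and integral may be exchanged.\<close>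

lemma expectation_infsum_bij:
  fixes f :: "'i \<Rightarrow> 'a \<Rightarrow> real" and e :: "nat \<Rightarrow> 'i"
  assumes e: "bij e" and int: "\<And>i. integrable M (f i)" and nn: "AE \<omega> in M. \<forall>i. 0 \<le> f i \<omega>"
    and sm: "(\<lambda>i. \<integral>\<omega>. f i \<omega> \<partial>M) summable_on UNIV"
  shows "AE \<omega> in M. (\<lambda>i. f i \<omega>) summable_on UNIV"
    and "integrable M (\<lambda>\<omega>. \<Sum>\<^sub>\<infinity>i. f i \<omega>)"
    and "(\<integral>\<omega>. (\<Sum>\<^sub>\<infinity>i. f i \<omega>) \<partial>M) = (\<Sum>\<^sub>\<infinity>i. \<integral>\<omega>. f i \<omega> \<partial>M)"
proof -
  note [measurable] = borel_measurable_integrable[OF int]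
  have nni: "AE \<omega> in M. 0 \<le> f i \<omega>" for i using nn by eventually_elim simp
  have I0: "0 \<le> (\<integral>\<omega>. f i \<omega> \<partial>M)" for i by (rule integral_nonneg_AE[OF nni])
  have s1: "summable (\<lambda>n. norm (\<integral>\<omega>. f (e n) \<omega> \<partial>M))" using sm infsum_via_bij(1)[OF e, of "\<lambda>i. \<integral>\<omega>. f i \<omega> \<partial>M"] by simp
  then have s2: "summable (\<lambda>n. \<integral>\<omega>. f (e n) \<omega> \<partial>M)" by (rule summable_norm_cancel)
  have "(\<integral>\<^sup>+\<omega>. (\<Sum>n. ennreal (f (e n) \<omega>)) \<partial>M) = (\<Sum>n. \<integral>\<^sup>+\<omega>. ennreal (f (e n) \<omega>) \<partial>M)"
    by (rule nn_integral_suminf) measurable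
  also have "\<dots> = (\<Sum>n. ennreal (\<integral>\<omega>. f (e n) \<omega> \<partial>M))"
    by (intro suminf_cong nn_integral_eq_integral int nni)
  also have "\<dots> \<noteq> \<infinity>" using suminf_ennreal2[OF I0 s2] by simp
  finally have "AE \<omega> in M. (\<Sum>n. ennreal (f (e n) \<omega>)) \<noteq> \<infinity>"
    by (intro nn_integral_PInf_AE) auto
  with nn have s3: "AE \<omega> in M. summable (\<lambda>n. norm (f (e n) \<omega>))"
  proof eventually_elim
    case (elim \<omega>)
    then have "summable (\<lambda>n. f (e n) \<omega>)" by (intro summable_suminf_not_top) auto
    then show ?case using elim by simp
  qed
  show "AE \<omega> in M. (\<lambda>i. f i \<omega>) summable_on UNIV"
    using s3 by eventually_elim (simp add: infsum_via_bij(1)[OF e])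
  have s4: "summable (\<lambda>n. \<integral>\<omega>. norm (f (e n) \<omega>) \<partial>M)"
  proof -
    have "(\<integral>\<omega>. norm (f (e n) \<omega>) \<partial>M) = (\<integral>\<omega>. f (e n) \<omega> \<partial>M)" for n
      using nni[of "e n"] by (intro integral_cong_AE) (auto elim: eventually_mono)
    then show ?thesis using s2 by simp
  qed
  have eq: "AE \<omega> in M. (\<Sum>n. f (e n) \<omega>) = (\<Sum>\<^sub>\<infinity>i. f i \<omega>)"
    using s3 by eventually_elim (simp add: infsum_via_bij(2)[OF e])
  have m: "(\<lambda>\<omega>. \<Sum>\<^sub>\<infinity>i. f i \<omega>) \<in> borel_measurable M"
    by (rule borel_measurable_infsum_bij[OF e]) measurable
  have i1: "integrable M (\<lambda>\<omega>. \<Sum>n. f (e n) \<omega>)" by (rule integrable_suminf[OF int s3 s4])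
  then show "integrable M (\<lambda>\<omega>. \<Sum>\<^sub>\<infinity>i. f i \<omega>)"
    by (rule integrable_cong_AE_imp[OF _ m]) (use eq in \<open>auto elim: eventually_mono\<close>)
  have "(\<integral>\<omega>. (\<Sum>\<^sub>\<infinity>i. f i \<omega>) \<partial>M) = (\<integral>\<omega>. (\<Sum>n. f (e n) \<omega>) \<partial>M)"
    using m i1 eq by (intro integral_cong_AE) (auto elim: eventually_mono)
  also have "\<dots> = (\<Sum>n. \<integral>\<omega>. f (e n) \<omega> \<partial>M)" by (rule integral_suminf[OF int s3 s4])
  also have "\<dots> = (\<Sum>\<^sub>\<infinity>i. \<integral>\<omega>. f i \<omega> \<partial>M)" by (rule infsum_via_bij(2)[OF e s1, symmetric])
  finally show "(\<integral>\<omega>. (\<Sum>\<^sub>\<infinity>i. f i \<omega>) \<partial>M) = (\<Sum>\<^sub>\<infinity>i. \<integral>\<omega>. f i \<omega> \<partial>M)" .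
qed

text \<open>The second part recovers summability of a single factor from the pair family. It is
  applied with the profile as second factor, whose sum is one.\<close>

lemma infsum_prod_eq:
  fixes a b :: "int \<Rightarrow> real"
  assumes "(\<lambda>p. a (fst p) * b (snd p)) summable_on UNIV"
  shows "(\<Sum>\<^sub>\<infinity>p. a (fst p) * b (snd p)) = infsum a UNIV * infsum b UNIV"
    and "infsum b UNIV \<noteq> 0 \<Longrightarrow> a summable_on UNIV"
proof -
  have eqf: "(\<lambda>p. a (fst p) * b (snd p)) = (\<lambda>(x, y). a x * b y)" by (simp add: fun_eq_iff)
  have s: "(\<lambda>(x, y). a x * b y) summable_on (UNIV \<times> UNIV)"
    using assms unfolding eqf by simp
  have "(\<Sum>\<^sub>\<infinity>p. a (fst p) * b (snd p)) = (\<Sum>\<^sub>\<infinity>x. \<Sum>\<^sub>\<infinity>y. a x * b y)"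
    unfolding eqf using infsum_Sigma'_banach[OF s] by simp
  also have "\<dots> = infsum a UNIV * infsum b UNIV" by (simp add: infsum_cmult_right' infsum_cmult_left')
  finally show "(\<Sum>\<^sub>\<infinity>p. a (fst p) * b (snd p)) = infsum a UNIV * infsum b UNIV" .
  assume b: "infsum b UNIV \<noteq> 0"
  have "(\<lambda>x. a x * infsum b UNIV) summable_on UNIV"
    using summable_on_Sigma_banach[OF s] by (simp add: infsum_cmult_right')
  then show "a summable_on UNIV" using b by (simp add: summable_on_cmult_left')
qed

abbreviation tame1 :: "(int \<Rightarrow> real) \<Rightarrow> bool" where
  "tame1 f \<equiv> tame UNIV (\<lambda>_ x y. f x) \<and> tame UNIV (\<lambda>_ x y. f y)"

section \<open>Expectations and variances of linear statistics\<close>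

context averaging
begin

lemma dd_m2_nonneg:
  assumes "0 \<le> s"
  shows "0 \<le> dd (m2 s) b"
proof -
  note int = integrable_eta_prod[OF assms]
  have "dd (m2 s) b = expectation (\<lambda>\<omega>. \<eta> s b \<omega> * \<eta> s b \<omega> + \<eta> s (b + 1) \<omega> * \<eta> s (b + 1) \<omega> - \<eta> s b \<omega> * \<eta> s (b + 1) \<omega> - \<eta> s (b + 1) \<omega> * \<eta> s b \<omega>)"
    using int m2_sym[of s b "b + 1"] by (simp add: dd_def m2_def)
  also have "\<dots> = expectation (\<lambda>\<omega>. (\<eta> s b \<omega> - \<eta> s (b + 1) \<omega>)\<^sup>2)"
    by (rule Bochner_Integration.integral_cong) (auto simp: power2_eq_square algebra_simps)
  finally show ?thesis by simp
qed

sublocale two_point_psd m2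
  apply unfold_locales
  subgoal by (rule m2_bounds)
  subgoal by (rule m2_bounds)
  subgoal by (rule m2_sym)
  subgoal by (rule m2_0)
  subgoal by (rule m2_derivative)
  subgoal by (rule dd_m2_nonneg)
  done

lemma AE_eta_nonneg: "0 \<le> s \<Longrightarrow> AE \<omega> in M. \<forall>x. 0 \<le> \<eta> s x \<omega>"
proof -
  assume "0 \<le> s"
  from AE_sum_eta_le[OF this finite.emptyI] show ?thesis by eventually_elim simp
qed

definition lin :: "real \<Rightarrow> (int \<Rightarrow> real) \<Rightarrow> 'w \<Rightarrow> real" where
  "lin s f \<omega> = (\<Sum>\<^sub>\<infinity>x. f x * \<eta> s x \<omega>)"

lemma measurable_lin [measurable]:
  assumes "0 \<le> s"
  shows "lin s f \<in> borel_measurable M"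
proof -
  have "bij (from_nat_into (UNIV :: int set))" by (rule bij_betw_from_nat_into) (auto simp: infinite_UNIV_char_0)
  then show ?thesis unfolding lin_def[abs_def]
    by (rule borel_measurable_infsum_bij) (use assms in measurable)
qed

lemma pair_sum:
  assumes s: "0 \<le> s" and G: "tame UNIV (\<lambda>_. G)" "\<And>x y. 0 \<le> G x y"
  shows "AE \<omega> in M. (\<lambda>p. G (fst p) (snd p) * (\<eta> s (fst p) \<omega> * \<eta> s (snd p) \<omega>)) summable_on UNIV"
    and "integrable M (\<lambda>\<omega>. \<Sum>\<^sub>\<infinity>p. G (fst p) (snd p) * (\<eta> s (fst p) \<omega> * \<eta> s (snd p) \<omega>))"
    and "expectation (\<lambda>\<omega>. \<Sum>\<^sub>\<infinity>p. G (fst p) (snd p) * (\<eta> s (fst p) \<omega> * \<eta> s (snd p) \<omega>)) = S2 (\<lambda>x y. m2 s x y * G x y)"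
proof -
  have e: "bij (from_nat_into (UNIV :: (int \<times> int) set))"
    by (rule bij_betw_from_nat_into) (auto simp: infinite_UNIV_char_0 finite_prod)
  have int: "integrable M (\<lambda>\<omega>. G (fst p) (snd p) * (\<eta> s (fst p) \<omega> * \<eta> s (snd p) \<omega>))" for p
    by (intro integrable_mult_right integrable_eta_prod s)
  have nn: "AE \<omega> in M. \<forall>p. 0 \<le> G (fst p) (snd p) * (\<eta> s (fst p) \<omega> * \<eta> s (snd p) \<omega>)"
    using AE_eta_nonneg[OF s] by eventually_elim (use G(2) in auto)
  have E: "expectation (\<lambda>\<omega>. G (fst p) (snd p) * (\<eta> s (fst p) \<omega> * \<eta> s (snd p) \<omega>)) = m2 s (fst p) (snd p) * G (fst p) (snd p)" for p
    by (simp add: m2_def)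
  have "rapid {s} (\<lambda>s x y. m2 s x y * G x y)"
    by (intro rapid_mult rapid_at s tame_subset[OF G(1)]) auto
  from rapid_summable[OF this]
  have sm: "(\<lambda>p. expectation (\<lambda>\<omega>. G (fst p) (snd p) * (\<eta> s (fst p) \<omega> * \<eta> s (snd p) \<omega>))) summable_on UNIV"
    unfolding E .
  note * = expectation_infsum_bij[OF e int nn sm]
  show "AE \<omega> in M. (\<lambda>p. G (fst p) (snd p) * (\<eta> s (fst p) \<omega> * \<eta> s (snd p) \<omega>)) summable_on UNIV"
    and "integrable M (\<lambda>\<omega>. \<Sum>\<^sub>\<infinity>p. G (fst p) (snd p) * (\<eta> s (fst p) \<omega> * \<eta> s (snd p) \<omega>))"
    and "expectation (\<lambda>\<omega>. \<Sum>\<^sub>\<infinity>p. G (fst p) (snd p) * (\<eta> s (fst p) \<omega> * \<eta> s (snd p) \<omega>)) = S2 (\<lambda>x y. m2 s x y * G x y)"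
    using * unfolding E S2_def by simp_all
qed

text \<open>The total mass is at most one by comparison with the chain, and its second moment
  \<open>S2 (m2 s)\<close> equals one. A variable between 0 and 1 with mean square one is almost
  surely one.\<close>

lemma AE_total_mass:
  assumes s: "0 < s"
  shows "AE \<omega> in M. (\<lambda>x. \<eta> s x \<omega>) summable_on UNIV \<and> (\<Sum>\<^sub>\<infinity>x. \<eta> s x \<omega>) = 1"
proof -
  have s0: "0 \<le> s" using s by simp
  let ?S = "\<lambda>\<omega>. \<Sum>\<^sub>\<infinity>x. \<eta> s x \<omega>"
  have fin: "AE \<omega> in M. \<forall>n. (\<Sum>x\<in>{- int n..int n}. \<eta> s x \<omega>) \<le> 1"
    unfolding AE_all_countable
  proof
    fix n show "AE \<omega> in M. (\<Sum>x\<in>{- int n..int n}. \<eta> s x \<omega>) \<le> 1"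
      using AE_sum_eta_le[OF s0, of "{- int n..int n}"] by (auto elim: eventually_mono)
  qed
  have le: "AE \<omega> in M. (\<lambda>x. \<eta> s x \<omega>) summable_on UNIV \<and> 0 \<le> ?S \<omega> \<and> ?S \<omega> \<le> 1"
    using fin AE_eta_nonneg[OF s0]
  proof eventually_elim
    case (elim \<omega>)
    have F: "sum (\<lambda>x. \<eta> s x \<omega>) F \<le> 1" if F: "finite F" for F
    proof -
      define n where "n = nat (Max (insert 0 (abs ` F)))"
      have "F \<subseteq> {- int n..int n}"
      proof
        fix x assume "x \<in> F"
        then have "\<bar>x\<bar> \<le> Max (insert 0 (abs ` F))" using F by (intro Max_ge) auto
        then show "x \<in> {- int n..int n}" unfolding n_def by (auto simp: abs_le_iff)
      qed
      then have "sum (\<lambda>x. \<eta> s x \<omega>) F \<le> sum (\<lambda>x. \<eta> s x \<omega>) {- int n..int n}"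
        using elim(2) by (intro sum_mono2) auto
      also have "\<dots> \<le> 1" using elim(1) by blast
      finally show ?thesis .
    qed
    have sm: "(\<lambda>x. \<eta> s x \<omega>) summable_on UNIV"
      by (rule nonneg_bdd_above_summable_on) (use elim F in \<open>auto intro!: bdd_aboveI[of _ 1]\<close>)
    then show ?case
      using infsum_le_finite_sums[OF sm, of 1] F infsum_nonneg[of UNIV "\<lambda>x. \<eta> s x \<omega>"] elim(2) by auto
  qed
  have t1: "tame UNIV (\<lambda>_ _ _. 1 :: real)" by (rule tame_const)
  note ps = pair_sum[OF s0 t1 zero_le_one]
  have sq: "AE \<omega> in M. (\<Sum>\<^sub>\<infinity>p. 1 * (\<eta> s (fst p) \<omega> * \<eta> s (snd p) \<omega>)) = ?S \<omega> * ?S \<omega>"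
    using ps(1) by eventually_elim (use infsum_prod_eq(1) in \<open>auto simp: zero_le_one\<close>)
  have "expectation (\<lambda>\<omega>. 1 - (\<Sum>\<^sub>\<infinity>p. 1 * (\<eta> s (fst p) \<omega> * \<eta> s (snd p) \<omega>))) = 0"
    using ps(2,3) total_mass[OF s] by (simp add: prob_space)
  moreover have "integrable M (\<lambda>\<omega>. 1 - (\<Sum>\<^sub>\<infinity>p. 1 * (\<eta> s (fst p) \<omega> * \<eta> s (snd p) \<omega>)))" using ps(2) by simp
  moreover have "AE \<omega> in M. 0 \<le> 1 - (\<Sum>\<^sub>\<infinity>p. 1 * (\<eta> s (fst p) \<omega> * \<eta> s (snd p) \<omega>))"
    using sq le by eventually_elim (simp add: mult_le_one)
  ultimately have "AE \<omega> in M. 1 - (\<Sum>\<^sub>\<infinity>p. 1 * (\<eta> s (fst p) \<omega> * \<eta> s (snd p) \<omega>)) = 0"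
    using integral_nonneg_eq_0_iff_AE by blast
  then show ?thesis using sq le
  proof eventually_elim
    case (elim \<omega>)
    then have "?S \<omega> * ?S \<omega> = 1" by simp
    then show ?case using elim(3) by (auto simp: square_eq_1_iff)
  qed
qed

text \<open>Multiplication by the total mass, which is one, turns the linear statistic into a sum
  over pairs, so that \<open>pair_sum\<close> applies.\<close>

lemma AE_lin_summable:
  assumes s: "0 < s" and f: "tame1 f" "\<And>x. 0 \<le> f x"
  shows "AE \<omega> in M. (\<lambda>x. f x * \<eta> s x \<omega>) summable_on UNIV"
    and "integrable M (lin s f)" and "expectation (lin s f) = S2 (\<lambda>x y. m2 s x y * f x)"
proof -
  have s0: "0 \<le> s" using s by simp
  note ps = pair_sum[OF s0, of "\<lambda>x y. f x", OF conjunct1[OF f(1)] f(2)]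
  have eq: "AE \<omega> in M. (\<lambda>x. f x * \<eta> s x \<omega>) summable_on UNIV \<and>
     (\<Sum>\<^sub>\<infinity>p. f (fst p) * (\<eta> s (fst p) \<omega> * \<eta> s (snd p) \<omega>)) = lin s f \<omega>"
    using ps(1) AE_total_mass[OF s]
  proof eventually_elim
    case (elim \<omega>)
    then have "(\<lambda>p. (f (fst p) * \<eta> s (fst p) \<omega>) * \<eta> s (snd p) \<omega>) summable_on UNIV"
      using f by (simp add: mult.assoc)
    from infsum_prod_eq[OF this] elim(2) show ?case by (simp add: lin_def mult.assoc)
  qed
  show "AE \<omega> in M. (\<lambda>x. f x * \<eta> s x \<omega>) summable_on UNIV" using eq by eventually_elim simp
  have i: "integrable M (\<lambda>\<omega>. \<Sum>\<^sub>\<infinity>p. f (fst p) * (\<eta> s (fst p) \<omega> * \<eta> s (snd p) \<omega>))" by (rule ps(2))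
  show il: "integrable M (lin s f)"
    by (rule integrable_cong_AE_imp[OF i measurable_lin[OF s0]]) (use eq in \<open>auto elim: eventually_mono\<close>)
  have "expectation (lin s f) = expectation (\<lambda>\<omega>. \<Sum>\<^sub>\<infinity>p. f (fst p) * (\<eta> s (fst p) \<omega> * \<eta> s (snd p) \<omega>))"
    using i il eq by (intro integral_cong_AE) (auto elim: eventually_mono)
  then show "expectation (lin s f) = S2 (\<lambda>x y. m2 s x y * f x)" using ps(3) by simp
qed

lemma expectation_lin_mult:
  assumes s: "0 < s" and f: "tame1 f" "\<And>x. 0 \<le> f x" and g: "tame1 g" "\<And>x. 0 \<le> g x"
  shows "integrable M (\<lambda>\<omega>. lin s f \<omega> * lin s g \<omega>)"
    and "expectation (\<lambda>\<omega>. lin s f \<omega> * lin s g \<omega>) = S2 (\<lambda>x y. m2 s x y * (f x * g y))"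
proof -
  have s0: "0 \<le> s" using s by simp
  have t: "tame UNIV (\<lambda>_ x y. f x * g y)" using f g by (intro tame_mult) auto
  note ps = pair_sum[OF s0 t mult_nonneg_nonneg[OF f(2) g(2)]]
  have eq: "AE \<omega> in M. (\<Sum>\<^sub>\<infinity>p. f (fst p) * g (snd p) * (\<eta> s (fst p) \<omega> * \<eta> s (snd p) \<omega>)) = lin s f \<omega> * lin s g \<omega>"
    using ps(1)
  proof eventually_elim
    case (elim \<omega>)
    have r: "f (fst p) * g (snd p) * (\<eta> s (fst p) \<omega> * \<eta> s (snd p) \<omega>) = (f (fst p) * \<eta> s (fst p) \<omega>) * (g (snd p) * \<eta> s (snd p) \<omega>)" for p
      by (simp add: mult_ac)
    from infsum_prod_eq(1)[OF elim[unfolded r]] show ?case unfolding r by (simp add: lin_def)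
  qed
  have m: "(\<lambda>\<omega>. lin s f \<omega> * lin s g \<omega>) \<in> borel_measurable M" using s0 by measurable
  show il: "integrable M (\<lambda>\<omega>. lin s f \<omega> * lin s g \<omega>)"
    by (rule integrable_cong_AE_imp[OF ps(2) m]) (use eq in \<open>auto elim: eventually_mono\<close>)
  have "expectation (\<lambda>\<omega>. lin s f \<omega> * lin s g \<omega>) = expectation (\<lambda>\<omega>. \<Sum>\<^sub>\<infinity>p. f (fst p) * g (snd p) * (\<eta> s (fst p) \<omega> * \<eta> s (snd p) \<omega>))"
    using ps(2) il eq by (intro integral_cong_AE) (auto elim: eventually_mono)
  then show "expectation (\<lambda>\<omega>. lin s f \<omega> * lin s g \<omega>) = S2 (\<lambda>x y. m2 s x y * (f x * g y))" using ps(3) by simp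
qed

definition quad :: "real \<Rightarrow> (int \<Rightarrow> real) \<Rightarrow> real" where
  "quad s f = S2 (\<lambda>x y. m2 s x y * (f x * f y))"

lemma lin_square:
  assumes "0 < s" "tame1 f" "\<And>x. 0 \<le> f x"
  shows "integrable M (\<lambda>\<omega>. (lin s f \<omega>)\<^sup>2)" "expectation (\<lambda>\<omega>. (lin s f \<omega>)\<^sup>2) = quad s f"
  unfolding power2_eq_square quad_def by (rule expectation_lin_mult[OF assms assms(2,3)])+

lemma variance_lin:
  assumes "0 < s" "tame1 f" "\<And>x. 0 \<le> f x"
  shows "variance (lin s f) = quad s f - (S2 (\<lambda>x y. m2 s x y * f x))\<^sup>2"
proof -
  have "variance (lin s f) = expectation (\<lambda>\<omega>. (lin s f \<omega>)\<^sup>2) - (expectation (lin s f))\<^sup>2"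
    by (rule variance_eq[OF AE_lin_summable(2)[OF assms] lin_square(1)[OF assms]])
  then show ?thesis unfolding lin_square(2)[OF assms] by (simp only: AE_lin_summable(3)[OF assms])
qed

lemma AE_lin_add:
  assumes s: "0 < s" and f: "tame1 f" "\<And>x. 0 \<le> f x" and g: "tame1 g" "\<And>x. 0 \<le> g x"
  shows "AE \<omega> in M. lin s (\<lambda>x. f x + g x) \<omega> = lin s f \<omega> + lin s g \<omega>"
  using AE_lin_summable(1)[OF s f] AE_lin_summable(1)[OF s g]
  unfolding lin_def ring_distribs by eventually_elim (rule infsum_add)

lemma AE_lin_mono:
  assumes s: "0 < s" and f: "tame1 f" "\<And>x. 0 \<le> f x" and g: "tame1 g" "\<And>x. f x \<le> g x"
  shows "AE \<omega> in M. 0 \<le> lin s f \<omega> \<and> lin s f \<omega> \<le> lin s g \<omega>"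
proof -
  have g0: "0 \<le> g x" for x by (rule order.trans[OF f(2) g(2)])
  have "AE \<omega> in M. \<forall>x. 0 \<le> \<eta> s x \<omega>" using s by (intro AE_eta_nonneg) simp
  with AE_lin_summable(1)[OF s f] AE_lin_summable(1)[OF s g(1) g0] show ?thesis
  proof eventually_elim
    case (elim \<omega>)
    have "0 \<le> lin s f \<omega>" unfolding lin_def using f(2) elim(3) by (intro infsum_nonneg mult_nonneg_nonneg) blast+
    moreover have "lin s f \<omega> \<le> lin s g \<omega>"
      unfolding lin_def using g(2) elim by (intro infsum_mono mult_right_mono) blast+
    ultimately show ?case by blast
  qed
qed

lemma quad_mono:
  assumes s: "0 < s" and f: "tame1 f" "\<And>x. 0 \<le> f x" and g: "tame1 g" "\<And>x. f x \<le> g x"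
  shows "quad s f \<le> quad s g"
proof -
  have g0: "0 \<le> g x" for x by (rule order.trans[OF f(2) g(2)])
  have "quad s f = expectation (\<lambda>\<omega>. (lin s f \<omega>)\<^sup>2)" using lin_square(2)[OF s f] by simp
  also have "\<dots> \<le> expectation (\<lambda>\<omega>. (lin s g \<omega>)\<^sup>2)"
  proof (rule integral_mono_AE[OF lin_square(1)[OF s f] lin_square(1)[OF s g(1) g0]])
    show "AE \<omega> in M. (lin s f \<omega>)\<^sup>2 \<le> (lin s g \<omega>)\<^sup>2"
      using AE_lin_mono[OF s f g] by eventually_elim (simp add: power_mono)
  qed
  also have "\<dots> = quad s g" using lin_square(2)[OF s g(1) g0] by simp
  finally show ?thesis .
qed

lemma tame1_add: "tame1 f \<Longrightarrow> tame1 g \<Longrightarrow> tame1 (\<lambda>x. f x + g x)"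
  by auto

lemma sum_square_le: "(a + b)\<^sup>2 \<le> 2 * a\<^sup>2 + 2 * (b::real)\<^sup>2"
  using zero_le_power2[of "a - b"] by (simp add: power2_eq_square algebra_simps)

lemma quad_add:
  assumes s: "0 < s" and f: "tame1 f" "\<And>x. 0 \<le> f x" and g: "tame1 g" "\<And>x. 0 \<le> g x"
  shows "quad s (\<lambda>x. f x + g x) \<le> 2 * quad s f + 2 * quad s g"
proof -
  have fg: "tame1 (\<lambda>x. f x + g x)" "\<And>x. 0 \<le> f x + g x" using f g by (auto intro: tame1_add)
  note sf = lin_square[OF s f] and sg = lin_square[OF s g]
  have "quad s (\<lambda>x. f x + g x) = expectation (\<lambda>\<omega>. (lin s (\<lambda>x. f x + g x) \<omega>)\<^sup>2)" using lin_square(2)[OF s fg] by simp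
  also have "\<dots> \<le> expectation (\<lambda>\<omega>. 2 * (lin s f \<omega>)\<^sup>2 + 2 * (lin s g \<omega>)\<^sup>2)"
  proof (rule integral_mono_AE[OF lin_square(1)[OF s fg]])
    show "AE \<omega> in M. (lin s (\<lambda>x. f x + g x) \<omega>)\<^sup>2 \<le> 2 * (lin s f \<omega>)\<^sup>2 + 2 * (lin s g \<omega>)\<^sup>2"
      using AE_lin_add[OF s f g] by eventually_elim (simp add: sum_square_le)
  qed (use sf(1) sg(1) in simp)
  also have "\<dots> = 2 * quad s f + 2 * quad s g" using sf sg by simp
  finally show ?thesis .
qed

text \<open>The difference of the two statistics is dominated by \<open>lin s d\<close>. Its
  variance is at most its second moment, and the variance of a sum is at most twice the sum of the
  variances.\<close>

lemma variance_perturb: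
  assumes s: "0 < s" and f: "tame1 f" "\<And>x. 0 \<le> f x" and g: "tame1 g" "\<And>x. 0 \<le> g x"
    and d: "tame1 d" "\<And>x. \<bar>f x - g x\<bar> \<le> d x"
  shows "variance (lin s f) \<le> 2 * variance (lin s g) + 2 * quad s d"
proof -
  have d0: "0 \<le> d x" for x using d(2)[of x] by linarith
  note F = AE_lin_summable[OF s f] lin_square[OF s f] and G = AE_lin_summable[OF s g] lin_square[OF s g]
    and D = AE_lin_summable[OF s d(1) d0] lin_square[OF s d(1) d0]
  have close: "AE \<omega> in M. \<bar>lin s f \<omega> - lin s g \<omega>\<bar> \<le> lin s d \<omega>"
  proof -
    have "AE \<omega> in M. \<forall>x. 0 \<le> \<eta> s x \<omega>" using s by (intro AE_eta_nonneg) simp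
    with F(1) G(1) D(1) show ?thesis
    proof eventually_elim
      case (elim \<omega>)
      have *: "lin s u \<omega> \<le> lin s v \<omega> + lin s d \<omega>"
        if "(\<lambda>x. u x * \<eta> s x \<omega>) summable_on UNIV" "(\<lambda>x. v x * \<eta> s x \<omega>) summable_on UNIV" "\<And>x. u x \<le> v x + d x" for u v
      proof -
        have "lin s u \<omega> \<le> (\<Sum>\<^sub>\<infinity>x. v x * \<eta> s x \<omega> + d x * \<eta> s x \<omega>)"
          unfolding lin_def
        proof (rule infsum_mono[OF that(1) summable_on_add[OF that(2) elim(3)]])
          fix x show "u x * \<eta> s x \<omega> \<le> v x * \<eta> s x \<omega> + d x * \<eta> s x \<omega>"
            using mult_right_mono[OF that(3)[of x], of "\<eta> s x \<omega>"] elim(4) by (simp only: ring_distribs)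
        qed
        also have "\<dots> = lin s v \<omega> + lin s d \<omega>" unfolding lin_def by (rule infsum_add[OF that(2) elim(3)])
        finally show ?thesis .
      qed
      have "f x \<le> g x + d x" "g x \<le> f x + d x" for x using d(2)[of x] by linarith+
      from *[OF elim(1,2) this(1)] *[OF elim(2,1) this(2)] show ?case by linarith
    qed
  qed
  let ?v = "\<lambda>h. expectation (\<lambda>\<omega>. (lin s h \<omega> - expectation (lin s h))\<^sup>2)"
  let ?Z = "\<lambda>\<omega>. lin s f \<omega> - lin s g \<omega>"
  have iZ: "integrable M ?Z" using F G by simp
  have Z2: "AE \<omega> in M. (?Z \<omega>)\<^sup>2 \<le> (lin s d \<omega>)\<^sup>2"
    using close by eventually_elim (metis abs_ge_zero abs_le_square_iff abs_of_nonneg order.trans)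
  have iZ2: "integrable M (\<lambda>\<omega>. (?Z \<omega>)\<^sup>2)"
    by (rule Bochner_Integration.integrable_bound[OF D(4)]) (use Z2 s in \<open>auto elim!: eventually_mono\<close>)
  have i: "integrable M (\<lambda>\<omega>. (lin s h \<omega> - c)\<^sup>2)" if "integrable M (lin s h)" "integrable M (\<lambda>\<omega>. (lin s h \<omega>)\<^sup>2)" for h c
    using that by (simp add: power2_diff)
  have iZ3: "integrable M (\<lambda>\<omega>. (?Z \<omega> - c)\<^sup>2)" for c
  proof -
    have "(\<lambda>\<omega>. (?Z \<omega> - c)\<^sup>2) = (\<lambda>\<omega>. (?Z \<omega>)\<^sup>2 + c\<^sup>2 - (2 * c) * ?Z \<omega>)"
      by (simp add: fun_eq_iff power2_eq_square algebra_simps)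
    moreover have "integrable M (\<lambda>\<omega>. (?Z \<omega>)\<^sup>2 + c\<^sup>2 - (2 * c) * ?Z \<omega>)"
      by (rule Bochner_Integration.integrable_diff[OF Bochner_Integration.integrable_add[OF iZ2] integrable_mult_right[OF iZ]]) simp
    ultimately show ?thesis by simp
  qed
  have "variance (lin s f) \<le> expectation (\<lambda>\<omega>. 2 * (lin s g \<omega> - expectation (lin s g))\<^sup>2 + 2 * (?Z \<omega> - expectation ?Z)\<^sup>2)"
  proof (rule integral_mono)
    show "(lin s f \<omega> - expectation (lin s f))\<^sup>2 \<le> 2 * (lin s g \<omega> - expectation (lin s g))\<^sup>2 + 2 * (?Z \<omega> - expectation ?Z)\<^sup>2" for \<omega>
    proof -
      have "lin s f \<omega> - expectation (lin s f) = (lin s g \<omega> - expectation (lin s g)) + (?Z \<omega> - expectation ?Z)"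
        using F(2) G(2) by simp
      then show ?thesis by (simp only: sum_square_le)
    qed
  qed (use i F G iZ3 in auto)
  also have "\<dots> = 2 * variance (lin s g) + 2 * expectation (\<lambda>\<omega>. (?Z \<omega> - expectation ?Z)\<^sup>2)"
    using i[OF G(2,4)] iZ3 by simp
  also have "expectation (\<lambda>\<omega>. (?Z \<omega> - expectation ?Z)\<^sup>2) = expectation (\<lambda>\<omega>. (?Z \<omega>)\<^sup>2) - (expectation ?Z)\<^sup>2"
    by (rule variance_eq[OF iZ iZ2])
  also have "\<dots> \<le> expectation (\<lambda>\<omega>. (?Z \<omega>)\<^sup>2)" by simp
  also have "\<dots> \<le> expectation (\<lambda>\<omega>. (lin s d \<omega>)\<^sup>2)" by (rule integral_mono_AE[OF iZ2 D(4) Z2])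
  also have "\<dots> = quad s d" by (rule D(5))
  finally show ?thesis by simp
qed

text \<open>
  With \<open>X = lin s w\<close> of mean one and \<open>Y = lin s (w d\<^sup>2)\<close>, the Cauchy-Schwarz inequality gives
  \<open>lin s (w d)\<^sup>2 \<le> X Y = Y + (X - 1) Y\<close>, and \<open>Y \<le> B\<^sup>2 X\<close>.
\<close>

lemma quad_le_mean:
  assumes s: "0 < s" and w: "tame1 w" "\<And>x. 0 \<le> w x" "S2 (\<lambda>x y. m2 s x y * w x) = 1"
    and d: "tame1 d" "\<And>x. 0 \<le> d x" "\<And>x. d x \<le> B" and \<epsilon>: "0 < \<epsilon>"
  shows "quad s (\<lambda>x. w x * d x) \<le> S2 (\<lambda>x y. m2 s x y * (w x * (d x)\<^sup>2)) + B\<^sup>2 * ((1 + 1 / (4 * \<epsilon>)) * (quad s w - 1) + \<epsilon>)"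
proof -
  let ?f = "\<lambda>x. w x * (d x)\<^sup>2"
  have f: "tame1 ?f" "\<And>x. 0 \<le> ?f x" using w d unfolding power2_eq_square by (auto intro!: tame_mult)
  have fb: "?f x \<le> B\<^sup>2 * w x" for x
    using mult_left_mono[OF power_mono[OF d(3,2), of x 2] w(2)[of x]] by (simp add: mult.commute)
  have bw: "tame1 (\<lambda>x. B\<^sup>2 * w x)" using w(1) by (auto intro!: tame_mult tame_const)
  have wd: "tame1 (\<lambda>x. w x * d x)" using w d by (auto intro!: tame_mult)
  have "quad s (\<lambda>x. w x * d x) \<le> S2 (\<lambda>x y. m2 s x y * (?f x * w y))"
  proof -
    let ?a = "\<lambda>x y. m2 s x y * (?f x * w y)" and ?b = "\<lambda>x y. m2 s x y * (w x * ?f y)"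
    have s0: "0 \<le> s" using s by simp
    have ra: "rapid {s} (\<lambda>s x y. m2 s x y * (?f x * w y))" "rapid {s} (\<lambda>s x y. m2 s x y * (w x * ?f y))"
      "rapid {s} (\<lambda>s x y. m2 s x y * ((w x * d x) * (w y * d y)))"
    proof -
      have t: "tame {s} (\<lambda>_ x y. h x)" "tame {s} (\<lambda>_ x y. h y)" if "tame1 h" for h
        using that by (auto intro: tame_subset)
      show "rapid {s} (\<lambda>s x y. m2 s x y * (?f x * w y))"
        by (rule rapid_mult[OF rapid_at[OF s0] tame_mult[OF t(1)[OF f(1)] t(2)[OF w(1)]]])
      show "rapid {s} (\<lambda>s x y. m2 s x y * (w x * ?f y))"
        by (rule rapid_mult[OF rapid_at[OF s0] tame_mult[OF t(1)[OF w(1)] t(2)[OF f(1)]]])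
      show "rapid {s} (\<lambda>s x y. m2 s x y * ((w x * d x) * (w y * d y)))"
        by (rule rapid_mult[OF rapid_at[OF s0] tame_mult[OF t(1)[OF wd] t(2)[OF wd]]])
    qed
    \<comment> \<open>Cauchy-Schwarz in pointwise form: \<open>d x * d y\<close> is at most half the
      sum of the squares, and the symmetry of \<open>m2\<close> identifies the two halves.\<close>
    have "quad s (\<lambda>x. w x * d x) \<le> S2 (\<lambda>x y. 1/2 * (?a x y + ?b x y))"
      unfolding quad_def
    proof (rule S2_mono[OF ra(3) rapid_cmult[OF rapid_add[OF ra(1,2)]]])
      fix x y
      have "0 \<le> (m2 s x y * (w x * w y)) * (d x - d y)\<^sup>2" using m2_bounds[OF s0] w by simp
      then show "m2 s x y * (w x * d x * (w y * d y)) \<le> 1/2 * (?a x y + ?b x y)"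
        by (simp add: power2_eq_square algebra_simps)
    qed
    also have "\<dots> = 1/2 * (S2 ?a + S2 ?b)" unfolding S2_cmult using S2_add[OF ra(1,2)] by simp
    also have "S2 ?b = S2 ?a"
    proof -
      have "bij_betw prod.swap (UNIV :: (int \<times> int) set) UNIV" by (rule bij_swap)
      from infsum_reindex_bij_betw[OF this, of "\<lambda>p. ?a (fst p) (snd p)"]
      show ?thesis unfolding S2_def using m2_sym[of s] by (simp add: mult_ac)
    qed
    finally show ?thesis by simp
  qed
  also have "\<dots> = expectation (\<lambda>\<omega>. lin s ?f \<omega> * lin s w \<omega>)" using expectation_lin_mult(2)[OF s f w(1,2)] by simp
  also have "\<dots> \<le> expectation (\<lambda>\<omega>. lin s ?f \<omega> + B\<^sup>2 * ((1 + 1 / (4 * \<epsilon>)) * (lin s w \<omega> - 1)\<^sup>2 + \<epsilon>))"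
  proof (rule integral_mono_AE)
    show "integrable M (\<lambda>\<omega>. lin s ?f \<omega> * lin s w \<omega>)" by (rule expectation_lin_mult(1)[OF s f w(1,2)])
    show "integrable M (\<lambda>\<omega>. lin s ?f \<omega> + B\<^sup>2 * ((1 + 1 / (4 * \<epsilon>)) * (lin s w \<omega> - 1)\<^sup>2 + \<epsilon>))"
      using AE_lin_summable(2)[OF s f] AE_lin_summable(2)[OF s w(1,2)] lin_square(1)[OF s w(1,2)] by (simp add: power2_diff)
    have "AE \<omega> in M. lin s (\<lambda>x. B\<^sup>2 * w x) \<omega> = B\<^sup>2 * lin s w \<omega>"
      by (rule AE_I2) (simp add: lin_def mult.assoc infsum_cmult_right')
    with AE_lin_mono[OF s f bw fb]
    show "AE \<omega> in M. lin s ?f \<omega> * lin s w \<omega> \<le> lin s ?f \<omega> + B\<^sup>2 * ((1 + 1 / (4 * \<epsilon>)) * (lin s w \<omega> - 1)\<^sup>2 + \<epsilon>)"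
    proof eventually_elim
      case (elim \<omega>)
      \<comment> \<open>As a may be negative, the product Z a is bounded through its absolute value;
        Young's inequality then replaces |a| by \<epsilon> plus a multiple of a^2, whose mean is the
        variance of the tilted mass.\<close>
      define a Z where "a = lin s w \<omega> - 1" and "Z = lin s ?f \<omega>"
      have Z: "0 \<le> Z" "Z \<le> B\<^sup>2 * (1 + a)" using elim by (auto simp: a_def Z_def)
      have "Z * a \<le> Z * \<bar>a\<bar>" using Z by (intro mult_left_mono) auto
      also have "\<dots> \<le> B\<^sup>2 * (1 + a) * \<bar>a\<bar>" using Z by (intro mult_right_mono) auto
      also have "\<dots> \<le> B\<^sup>2 * (1 + \<bar>a\<bar>) * \<bar>a\<bar>" by (intro mult_right_mono mult_left_mono) auto
      also have "\<dots> = B\<^sup>2 * (\<bar>a\<bar> + a\<^sup>2)" by (simp add: algebra_simps power2_eq_square)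
      also have "\<dots> \<le> B\<^sup>2 * ((\<epsilon> + a\<^sup>2 / (4 * \<epsilon>)) + a\<^sup>2)"
      proof (intro mult_left_mono add_right_mono)
        have "0 \<le> (\<bar>a\<bar> - 2 * \<epsilon>)\<^sup>2 / (4 * \<epsilon>)" using \<epsilon> by simp
        also have "\<dots> = a\<^sup>2 / (4 * \<epsilon>) - \<bar>a\<bar> + \<epsilon>" using \<epsilon> by (simp add: power2_diff field_simps power2_eq_square)
        finally show "\<bar>a\<bar> \<le> \<epsilon> + a\<^sup>2 / (4 * \<epsilon>)" by simp
      qed simp
      finally have "Z + Z * a \<le> Z + B\<^sup>2 * ((1 + 1 / (4 * \<epsilon>)) * a\<^sup>2 + \<epsilon>)" by (simp add: algebra_simps)
      then show ?case by (simp add: a_def Z_def algebra_simps)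
    qed
  qed
  also have "\<dots> = expectation (lin s ?f) + B\<^sup>2 * ((1 + 1 / (4 * \<epsilon>)) * expectation (\<lambda>\<omega>. (lin s w \<omega> - 1)\<^sup>2) + \<epsilon>)"
    using AE_lin_summable(2)[OF s f] AE_lin_summable(2)[OF s w(1,2)] lin_square(1)[OF s w(1,2)]
    by (simp add: power2_diff prob_space)
  also have "expectation (\<lambda>\<omega>. (lin s w \<omega> - 1)\<^sup>2) = quad s w - 1"
    using variance_lin[OF s w(1,2)] AE_lin_summable(3)[OF s w(1,2)] w(3) by simp
  also have "expectation (lin s ?f) = S2 (\<lambda>x y. m2 s x y * ?f x)" by (rule AE_lin_summable(3)[OF s f])
  finally show ?thesis .
qed

end

section \<open>The subcritical regime\<close>

text \<open>With e = cosh \<beta> - 1 the numerator of \<open>pot\<close> is at most 2 e^2 - 2 a +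
  a^2. The assumptions give 2 e^2 \<le> a/2 and a^2 \<le> a/2, which leaves -a; dividing a negative
  number by 1 - a < 1 only lowers it.\<close>

lemma pot_le:
  assumes a: "0 < a" "a \<le> 1/2" and e: "(cosh \<beta> - 1)\<^sup>2 \<le> a / 4"
  shows "pot \<beta> (1 - a) \<le> - a" and "rate \<beta> (1 - a) \<le> 2 * cosh \<beta> * a\<^sup>2"
proof -
  define e where "e = cosh \<beta> - 1"
  have e0: "0 \<le> e" using cosh_real_ge_1[of \<beta>] by (simp add: e_def)
  have c: "cosh \<beta> = 1 + e" by (simp add: e_def)
  define P where "P = (1 - a) ^ 3 - 2 * cosh \<beta> * (1 - a)\<^sup>2 + (2 * (cosh \<beta>)\<^sup>2 + 1) * (1 - a) - 2 * cosh \<beta>"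
  have "P = 2 * e\<^sup>2 - a * (2 + 2 * e\<^sup>2) + a\<^sup>2 * (1 - 2 * e) - a ^ 3"
    unfolding P_def c by (simp add: power2_eq_square power3_eq_cube algebra_simps)
  also have "\<dots> \<le> 2 * e\<^sup>2 - 2 * a + a\<^sup>2"
  proof -
    have "0 \<le> a * e\<^sup>2" "0 \<le> a\<^sup>2 * e" "0 \<le> a ^ 3" using a e0 by auto
    then show ?thesis by (simp add: algebra_simps)
  qed
  also have "\<dots> \<le> - a"
  proof -
    have "a\<^sup>2 \<le> a / 2" using mult_left_mono[OF a(2), of a] a(1) by (simp add: power2_eq_square)
    then show ?thesis using e unfolding e_def[symmetric] by simp
  qed
  finally have P: "P \<le> - a" .
  have "P / (1 - a) \<le> P"
  proof -
    have "P * 1 \<le> P * (1 - a)" using P a by (intro mult_left_mono_neg) auto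
    then show ?thesis using a by (simp add: divide_le_eq)
  qed
  then show "pot \<beta> (1 - a) \<le> - a" using P by (simp add: pot_def P_def)
  have "(1 - a) + 1 / (1 - a) - 2 = a\<^sup>2 / (1 - a)" using a by (simp add: field_simps power2_eq_square)
  also have "\<dots> \<le> 2 * a\<^sup>2"
  proof -
    have "a\<^sup>2 * 1 \<le> a\<^sup>2 * (2 * (1 - a))" using a by (intro mult_left_mono) auto
    then show ?thesis using a by (simp add: divide_le_eq mult_ac)
  qed
  finally show "rate \<beta> (1 - a) \<le> 2 * cosh \<beta> * a\<^sup>2"
    unfolding rate_def using mult_left_mono[of "1 - a + 1 / (1 - a) - 2" "2 * a\<^sup>2" "cosh \<beta>"] cosh_real_pos[of \<beta>] by simp
qed

text \<open>Infimal convolution with \<open>L * \<bar>u - v\<bar>\<close>. The slope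
  \<open>B / \<delta>\<close> lifts all points at distance at least \<delta> above the bound B, and
  for nearer points uniform continuity on a slightly larger compact interval limits the loss to
  \<epsilon>.\<close>

lemma lipschitz_minorant:
  fixes \<phi> :: "real \<Rightarrow> real"
  assumes nn: "\<And>u. 0 \<le> \<phi> u" and B: "\<And>u. \<phi> u \<le> B" and cont: "continuous_on UNIV \<phi>" and \<epsilon>: "0 < \<epsilon>"
  obtains \<psi> L where "0 \<le> L" "\<And>u. 0 \<le> \<psi> u" "\<And>u. \<psi> u \<le> \<phi> u"
    "\<And>u v. \<bar>\<psi> u - \<psi> v\<bar> \<le> L * \<bar>u - v\<bar>" "\<And>u. \<bar>u\<bar> \<le> R \<Longrightarrow> \<phi> u - \<psi> u \<le> \<epsilon>"
proof -
  have B0: "0 \<le> B" using nn[of 0] B[of 0] by simp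
  have "uniformly_continuous_on (cball 0 (\<bar>R\<bar> + 1)) \<phi>"
    by (intro compact_uniformly_continuous continuous_on_subset[OF cont]) auto
  then obtain d where d: "0 < d" "\<And>u v. u \<in> cball 0 (\<bar>R\<bar> + 1) \<Longrightarrow> v \<in> cball 0 (\<bar>R\<bar> + 1) \<Longrightarrow> dist v u < d \<Longrightarrow> dist (\<phi> v) (\<phi> u) < \<epsilon>"
    using \<epsilon> unfolding uniformly_continuous_on_def by blast
  define \<delta> where "\<delta> = min d 1"
  have \<delta>: "0 < \<delta>" "\<delta> \<le> 1" "\<delta> \<le> d" using d by (auto simp: \<delta>_def)
  define L where "L = B / \<delta>"
  have L: "0 \<le> L" using B0 \<delta> by (simp add: L_def)
  let ?S = "\<lambda>u. range (\<lambda>v. \<phi> v + L * \<bar>u - v\<bar>)"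
  define \<psi> where "\<psi> u = Inf (?S u)" for u
  have bdd: "bdd_below (?S u)" for u
    by (rule bdd_belowI[of _ 0]) (use nn L in auto)
  have lower: "\<psi> u \<le> \<phi> v + L * \<bar>u - v\<bar>" for u v
    unfolding \<psi>_def by (rule cInf_lower[OF _ bdd]) auto
  have greatest: "c \<le> \<psi> u" if "\<And>v. c \<le> \<phi> v + L * \<bar>u - v\<bar>" for c u
    unfolding \<psi>_def by (rule cInf_greatest) (use that in auto)
  have lip: "\<psi> u \<le> \<psi> v + L * \<bar>u - v\<bar>" for u v
  proof -
    have "\<psi> u - L * \<bar>u - v\<bar> \<le> \<psi> v"
    proof (rule greatest)
      fix w
      have "\<bar>u - w\<bar> \<le> \<bar>u - v\<bar> + \<bar>v - w\<bar>" by simp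
      then have "L * \<bar>u - w\<bar> \<le> L * \<bar>u - v\<bar> + L * \<bar>v - w\<bar>"
        unfolding distrib_left[symmetric] by (rule mult_left_mono[OF _ L])
      then show "\<psi> u - L * \<bar>u - v\<bar> \<le> \<phi> w + L * \<bar>v - w\<bar>" using lower[of u w] by simp
    qed
    then show ?thesis by simp
  qed
  show ?thesis
  proof (rule that[OF L])
    show "0 \<le> \<psi> u" for u by (rule greatest) (use nn L in simp)
    show "\<psi> u \<le> \<phi> u" for u using lower[of u u] by simp
    show "\<bar>\<psi> u - \<psi> v\<bar> \<le> L * \<bar>u - v\<bar>" for u v
      using lip[of u v] lip[of v u] by (simp add: abs_le_iff abs_minus_commute)
    show "\<phi> u - \<psi> u \<le> \<epsilon>" if u: "\<bar>u\<bar> \<le> R" for u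
    proof -
      have "\<phi> u - \<epsilon> \<le> \<psi> u"
      proof (rule greatest)
        fix v
        show "\<phi> u - \<epsilon> \<le> \<phi> v + L * \<bar>u - v\<bar>"
        proof (cases "\<bar>u - v\<bar> < \<delta>")
          case True
          have "dist (\<phi> v) (\<phi> u) < \<epsilon>"
            by (rule d(2)) (use u True \<delta> in \<open>auto simp: dist_real_def\<close>)
          moreover have "0 \<le> L * \<bar>u - v\<bar>" using L by simp
          ultimately show ?thesis by (simp add: dist_real_def abs_less_iff)
        next
          case False
          then have "B \<le> L * \<bar>u - v\<bar>" using B0 \<delta> mult_left_mono[of \<delta> "\<bar>u - v\<bar>" L] L by (simp add: L_def)
          then show ?thesis using nn[of v] B[of u] \<epsilon> by simp
        qed
      qed
      then show ?thesis by simp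
    qed
  qed
qed

lemma cosh_arsinh_bounds:
  fixes b :: real
  assumes "0 \<le> b" "b \<le> 1"
  shows "cosh (arsinh b) - 1 \<le> b\<^sup>2 / 2" "b\<^sup>2 / 3 \<le> cosh (arsinh b) - 1" "cosh (arsinh b) \<le> 2"
proof -
  have c: "cosh (arsinh b) = sqrt (b\<^sup>2 + 1)" by (rule cosh_arsinh_real)
  have "sqrt (b\<^sup>2 + 1) \<le> 1 + b\<^sup>2 / 2"
  proof (rule real_le_lsqrt)
    have "0 \<le> (b\<^sup>2)\<^sup>2 / 4" by simp
    then show "b\<^sup>2 + 1 \<le> (1 + b\<^sup>2 / 2)\<^sup>2" by (simp add: power2_sum power_divide)
  qed simp
  moreover have "1 + b\<^sup>2 / 3 \<le> sqrt (b\<^sup>2 + 1)"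
  proof (rule real_le_rsqrt)
    have "b\<^sup>2 * b\<^sup>2 \<le> b\<^sup>2 * 1" using assms by (intro mult_left_mono) (auto simp: power_le_one)
    moreover have "(1 + b\<^sup>2 / 3)\<^sup>2 = 1 + 2 * b\<^sup>2 / 3 + b\<^sup>2 * b\<^sup>2 / 9" by (simp add: power2_eq_square field_simps)
    moreover have "0 \<le> b\<^sup>2" by simp
    ultimately show "(1 + b\<^sup>2 / 3)\<^sup>2 \<le> b\<^sup>2 + 1" by linarith
  qed
  moreover have "b\<^sup>2 \<le> 1" using assms by (simp add: power_le_one)
  ultimately show "cosh (arsinh b) - 1 \<le> b\<^sup>2 / 2" "b\<^sup>2 / 3 \<le> cosh (arsinh b) - 1" "cosh (arsinh b) \<le> 2"
    unfolding c by linarith+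
qed

section \<open>Mass, tails and variance for small tilts\<close>

context averaging
begin

lemma tame1_wt: "tame1 (wt \<beta> s)"
proof
  show "tame UNIV (\<lambda>_ x y. wt \<beta> s x)"
    by (rule subst[where P="tame UNIV", OF _ tame_mult[OF tame_exp[of UNIV \<beta> 0] tame_const[of UNIV "exp (- s * (cosh \<beta> - 1))"]]])
      (simp add: fun_eq_iff wt_def exp_add[symmetric])
  show "tame UNIV (\<lambda>_ x y. wt \<beta> s y)"
    by (rule subst[where P="tame UNIV", OF _ tame_mult[OF tame_exp[of UNIV 0 \<beta>] tame_const[of UNIV "exp (- s * (cosh \<beta> - 1))"]]])
      (simp add: fun_eq_iff wt_def exp_add[symmetric])
qed

lemma tame1_bounded: "(\<And>x. \<bar>h x\<bar> \<le> B) \<Longrightarrow> tame1 h"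
  by (auto intro: tame_bounded)

lemma tame1_mult: "tame1 f \<Longrightarrow> tame1 g \<Longrightarrow> tame1 (\<lambda>x. f x * g x)"
  by (auto intro: tame_mult)

lemma quad_wt: "quad s (wt \<beta> s) = lyap \<beta> (\<lambda>_. 1) s"
  by (simp add: quad_def lyap_def tilt2_wt)

text \<open>Constants are eigenfunctions of \<open>hop \<beta>\<close> with eigenvalue
  \<open>cosh \<beta>\<close>, so \<open>heat\<close> preserves them.\<close>

lemma mean_wt: "0 < T \<Longrightarrow> S2 (\<lambda>x y. m2 T x y * wt \<beta> T x) = 1"
proof -
  assume T: "0 < T"
  have "heat \<beta> T (\<lambda>_. 1) 0 = 1"
  proof -
    have h: "(hop \<beta> ^^ k) (\<lambda>_. 1) x = cosh \<beta> ^ k" for k x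
      by (induction k arbitrary: x) (simp_all add: hop_def[of \<beta> "(hop \<beta> ^^ _) _"] cosh_def field_simps)
    have "(\<Sum>k. (cosh \<beta>) ^ k / fact k * T ^ k) = exp (cosh \<beta> * T)"
      unfolding exp_def by (simp add: power_mult_distrib divide_inverse mult_ac)
    then show ?thesis by (simp add: heat_def h exp_minus field_simps)
  qed
  then show ?thesis using mean_formula[OF T, of "\<lambda>_. 1" 1 \<beta>] by simp
qed

lemma subcritical_mass:
  assumes T: "0 < T" and a: "0 < a" "a \<le> 1/2" and e: "(cosh \<beta> - 1)\<^sup>2 \<le> a / 4"
  shows "lyap \<beta> (\<lambda>_. 1) T \<le> 2 - 1 / cosh \<beta> + 4 * (cosh \<beta> - 1)\<^sup>2 / a * exp (2 * cosh \<beta> * a\<^sup>2 * T)"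
proof -
  have "lyap \<beta> (\<lambda>_. 1) T \<le> 2 - 1 / cosh \<beta> + 4 * (cosh \<beta> - 1)\<^sup>2 / a * exp (rate \<beta> (1 - a) * T)"
    by (rule mass_upper[OF T _ _ pot_le(1)[OF a e] a(1)]) (use a in auto)
  also have "4 * (cosh \<beta> - 1)\<^sup>2 / a * exp (rate \<beta> (1 - a) * T) \<le> 4 * (cosh \<beta> - 1)\<^sup>2 / a * exp (2 * cosh \<beta> * a\<^sup>2 * T)"
    using a T pot_le(2)[OF a e] by (intro mult_left_mono) (auto intro: mult_right_mono)
  finally show ?thesis by simp
qed

lemma subcritical_variance_lipschitz:
  assumes T: "0 < T" and \<beta>: "0 \<le> \<beta>" and a: "0 < a" "a \<le> 1/2" and e: "(cosh \<beta> - 1)\<^sup>2 \<le> a / 4"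
    and \<psi>: "\<And>x. 0 \<le> \<psi> x" "\<And>x. \<psi> x \<le> B" and lip: "\<And>x. \<bar>\<psi> (x + 1) - \<psi> x\<bar> \<le> l"
  shows "variance (lin T (\<lambda>x. wt \<beta> T x * \<psi> x)) \<le>
    2 * B\<^sup>2 * (lyap \<beta> (\<lambda>_. 1) T - 1) + 2 * cosh \<beta> * l\<^sup>2 / a * exp (2 * cosh \<beta> * a\<^sup>2 * T)"
proof -
  have b: "\<bar>\<psi> x\<bar> \<le> B" for x using \<psi>[of x] by simp
  have t: "tame1 (\<lambda>x. wt \<beta> T x * \<psi> x)" by (intro tame1_mult tame1_wt tame1_bounded[of _ B] b)
  have nn: "0 \<le> wt \<beta> T x * \<psi> x" for x using wt_pos[of \<beta> T x] \<psi> by simp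
  have "variance (lin T (\<lambda>x. wt \<beta> T x * \<psi> x)) = quad T (\<lambda>x. wt \<beta> T x * \<psi> x) - (heat \<beta> T \<psi> 0)\<^sup>2"
    unfolding variance_lin[OF T t nn] mean_formula[where \<psi>=\<psi> and B=B, OF T b] ..
  also have "\<dots> \<le> 2 * B\<^sup>2 * (lyap \<beta> (\<lambda>_. 1) T - 1) + 2 * cosh \<beta> * l\<^sup>2 / a * exp (rate \<beta> (1 - a) * T)"
    unfolding quad_def
    by (rule variance_bound[where \<psi>=\<psi> and B=B and l=l, OF T \<beta> b lip _ _ pot_le(1)[OF a e] a(1)]) (use a in auto)
  also have "2 * cosh \<beta> * l\<^sup>2 / a * exp (rate \<beta> (1 - a) * T) \<le> 2 * cosh \<beta> * l\<^sup>2 / a * exp (2 * cosh \<beta> * a\<^sup>2 * T)"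
    using a T pot_le(2)[OF a e] cosh_real_pos[of \<beta>] by (intro mult_left_mono) (auto intro: mult_right_mono)
  finally show ?thesis by simp
qed

text \<open>Chebyshev's inequality for the tilted walk: the quadratic part of the bound integrates
  to Kc times the variance \<open>T * cosh \<beta>\<close>.\<close>

lemma mean_square_tail:
  assumes T: "0 < T" and d: "\<And>x. 0 \<le> d x" "\<And>x. (d x)\<^sup>2 \<le> \<epsilon> + Kc * (of_int x - T * sinh \<beta>)\<^sup>2"
    and dB: "\<And>x. d x \<le> B" and K: "0 \<le> Kc"
  shows "S2 (\<lambda>x y. m2 T x y * (wt \<beta> T x * (d x)\<^sup>2)) \<le> \<epsilon> + Kc * (T * cosh \<beta>)"
proof -
  have T0: "0 \<le> T" using T by simp
  let ?q = "\<lambda>x::int. (of_int x - T * sinh \<beta>)\<^sup>2 - T * cosh \<beta>"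
  have tw: "tame {T} (\<lambda>_ x y. wt \<beta> T x)" using tame1_wt[of \<beta> T] by (auto intro: tame_subset)
  have tq: "tame {T} (\<lambda>_ x y. ?q x)"
    unfolding power2_eq_square by (intro tame_diff tame_mult tame_const tame_of_int)
  have td: "tame {T} (\<lambda>_ x y. (d x)\<^sup>2)"
    using d dB by (intro tame_bounded[of _ _ "B\<^sup>2"]) (auto intro: power_mono)
  have rw: "rapid {T} (\<lambda>s x y. m2 s x y * wt \<beta> T x)" by (intro rapid_mult rapid_at T0 tw)
  have rq: "rapid {T} (\<lambda>s x y. m2 s x y * (wt \<beta> T x * ?q x))" by (intro rapid_mult[OF rapid_at[OF T0] tame_mult[OF tw tq]])
  have rd: "rapid {T} (\<lambda>s x y. m2 s x y * (wt \<beta> T x * (d x)\<^sup>2))" by (rule rapid_mult[OF rapid_at[OF T0] tame_mult[OF tw td]])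
  have "S2 (\<lambda>x y. m2 T x y * (wt \<beta> T x * (d x)\<^sup>2)) \<le>
      S2 (\<lambda>x y. (\<epsilon> + Kc * (T * cosh \<beta>)) * (m2 T x y * wt \<beta> T x) + Kc * (m2 T x y * (wt \<beta> T x * ?q x)))"
  proof (rule S2_mono[OF rd rapid_add[OF rapid_cmult[OF rw] rapid_cmult[OF rq]]])
    fix x y
    have "0 \<le> m2 T x y * wt \<beta> T x" using m2_bounds(1)[OF T0] wt_pos[of \<beta> T x] by simp
    from mult_left_mono[OF d(2)[of x] this]
    show "m2 T x y * (wt \<beta> T x * (d x)\<^sup>2) \<le> (\<epsilon> + Kc * (T * cosh \<beta>)) * (m2 T x y * wt \<beta> T x) + Kc * (m2 T x y * (wt \<beta> T x * ?q x))"
      by (simp add: algebra_simps)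
  qed
  also have "\<dots> = (\<epsilon> + Kc * (T * cosh \<beta>)) * S2 (\<lambda>x y. m2 T x y * wt \<beta> T x) + Kc * S2 (\<lambda>x y. m2 T x y * (wt \<beta> T x * ?q x))"
    unfolding S2_add[OF rapid_cmult[OF rw] rapid_cmult[OF rq]] S2_cmult ..
  also have "\<dots> = \<epsilon> + Kc * (T * cosh \<beta>)"
    unfolding mean_wt[OF T] second_moment_formula[OF T] by simp
  finally show ?thesis .
qed

lemma tilted_field_lin:
  "tilted_field \<eta> lam N t \<phi> = lin (t * real N) (\<lambda>x. wt (beta lam N) (t * real N) x *
      \<phi> (real N powr (-1/2) * (of_int x - t * real N powr lam)))"
  by (simp add: fun_eq_iff tilted_field_def lin_def vartheta_def wt_def mult_ac)

text \<open>D bounds the excess over one of the second moment of the mass. Its first term, of order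
  b^2, is the excess of the gap weight at 0; its second, of order b^4 N^(1/2), is the price for the
  time spent on the diagonal.\<close>

lemma subcritical_bound:
  fixes \<phi> \<psi> :: "real \<Rightarrow> real" and N :: nat
  assumes N: "4 \<le> N" and t: "0 < t" and lam: "lam < 7/8"
    and \<phi>: "\<And>u. 0 \<le> \<phi> u" "\<And>u. \<phi> u \<le> B" and \<psi>: "\<And>u. 0 \<le> \<psi> u" "\<And>u. \<psi> u \<le> \<phi> u"
    and lip: "\<And>u v. \<bar>\<psi> u - \<psi> v\<bar> \<le> L * \<bar>u - v\<bar>" "0 \<le> L" and close: "\<And>u. \<bar>u\<bar> \<le> R \<Longrightarrow> \<phi> u - \<psi> u \<le> \<epsilon>" and R: "0 < R" and \<epsilon>: "0 < \<epsilon>"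
  defines "D \<equiv> real N powr (2 * lam - 2) / 2 + real N powr (4 * lam - 7/2) * exp (4 * t)"
  shows "variance (tilted_field \<eta> lam N t \<phi>) \<le>
     2 * (2 * B\<^sup>2 * D + 4 * L\<^sup>2 * exp (4 * t) * real N powr (-1/2)) +
     2 * (\<epsilon>\<^sup>2 + 2 * t * (B / R)\<^sup>2 + B\<^sup>2 * ((1 + 1 / (4 * \<epsilon>)) * D + \<epsilon>))"
proof -
  define \<beta> where "\<beta> = beta lam N"
  define b where "b = real N powr (lam - 1)"
  define T where "T = t * real N"
  \<comment> \<open>This number serves twice: as the lattice spacing seen by the test function and
    as 1 - \<mu> in the gap weight.\<close>
  define n where "n = real N powr (-1/2)"
  have N0: "0 < real N" using N by simp
  have b: "0 \<le> b" "b \<le> 1"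
    unfolding b_def using powr_mono[of "lam - 1" 0 "real N"] N lam by simp_all
  have \<beta>b: "\<beta> = arsinh b" by (simp add: \<beta>_def beta_def b_def)
  have sh: "sinh \<beta> = b" by (simp add: \<beta>b)
  have \<beta>: "0 \<le> \<beta>" using sinh_real_nonneg_iff[of \<beta>] sh b by simp
  note cb = cosh_arsinh_bounds[OF b, folded \<beta>b]
  have T: "0 < T" using t N0 by (simp add: T_def)
  have n: "0 < n" "n\<^sup>2 = 1 / real N" "n \<le> 1/2"
  proof -
    show "0 < n" using N0 by (simp add: n_def)
    have n_sqrt: "n = 1 / sqrt (real N)" unfolding n_def using N0 by (simp add: powr_minus_divide powr_half_sqrt[symmetric])
    show "n\<^sup>2 = 1 / real N" unfolding n_sqrt using N0 by (simp add: power_divide)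
    have "sqrt 4 \<le> sqrt (real N)" using N by (intro real_sqrt_le_mono) simp
    then show "n \<le> 1/2" unfolding n_sqrt using N0 by (intro divide_left_mono) simp_all
  qed
  have b2: "b\<^sup>2 = real N powr (2 * lam - 2)" and b4: "b ^ 4 = real N powr (4 * lam - 4)"
    unfolding b_def using N0 by (simp_all add: powr_realpow[symmetric] powr_powr algebra_simps del: powr_realpow)
  have b4n: "b ^ 4 / n = real N powr (4 * lam - 7/2)"
    unfolding b4 n_def using N0 by (simp add: powr_diff[symmetric] algebra_simps)
  have e0: "0 \<le> cosh \<beta> - 1" using cosh_real_ge_1[of \<beta>] by simp
  have e2: "(cosh \<beta> - 1)\<^sup>2 \<le> b ^ 4 / 4"
    using power_mono[OF cb(1) e0, of 2] by (simp add: power_divide power_mult[symmetric])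
  \<comment> \<open>Comparison of the exponents 4 lam - 4 and -1/2: here lam < 7/8 enters.\<close>
  have "b ^ 4 \<le> n" unfolding b4 n_def using N lam by (intro powr_mono) auto
  then have e: "(cosh \<beta> - 1)\<^sup>2 \<le> n / 4" using e2 by simp
  \<comment> \<open>Since \<open>n\<^sup>2 * T = t\<close>, the growth of the gap weight is bounded
    uniformly in N.\<close>
  have growth: "exp (2 * cosh \<beta> * n\<^sup>2 * T) \<le> exp (4 * t)"
  proof -
    have "2 * cosh \<beta> * n\<^sup>2 * T = 2 * cosh \<beta> * t" unfolding n(2) T_def using N0 by simp
    moreover have "2 * cosh \<beta> * t \<le> 4 * t" using cb(3) t by simp
    ultimately show ?thesis unfolding exp_le_cancel_iff by linarith
  qed
  have mass: "lyap \<beta> (\<lambda>_. 1) T - 1 \<le> D"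
  proof -
    have "1 - 1 / cosh \<beta> \<le> cosh \<beta> - 1"
    proof -
      have "0 \<le> (cosh \<beta> - 1)\<^sup>2 / cosh \<beta>" using cosh_real_pos[of \<beta>] by simp
      also have "\<dots> = (cosh \<beta> - 1) - (1 - 1 / cosh \<beta>)" using cosh_real_pos[of \<beta>] by (simp add: field_simps power2_eq_square)
      finally show ?thesis by simp
    qed
    moreover have "4 * (cosh \<beta> - 1)\<^sup>2 / n * exp (2 * cosh \<beta> * n\<^sup>2 * T) \<le> b ^ 4 / n * exp (4 * t)"
      using e2 n growth by (intro mult_mono divide_right_mono) auto
    ultimately show ?thesis
      using subcritical_mass[OF T n(1,3) e] cb(1) unfolding D_def b4n[symmetric] b2[symmetric] by simp
  qed
  define sc where "sc x = n * (of_int x - t * real N powr lam)" for x :: int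
  \<comment> \<open>The centring of the field is exactly the drift of the tilted walk, because
    \<open>sinh \<beta>\<close> is \<open>real N powr (lam - 1)\<close>; this is the reason for the
    arcsinh in the tilt.\<close>
  have drift: "t * real N powr lam = T * sinh \<beta>"
    unfolding T_def sh b_def using N0 powr_add[of "real N" 1 "lam - 1"] by simp
  have field: "tilted_field \<eta> lam N t \<phi> = lin T (\<lambda>x. wt \<beta> T x * \<phi> (sc x))"
    by (simp add: tilted_field_lin \<beta>_def T_def sc_def n_def)
  have tm: "tame1 (\<lambda>x. wt \<beta> T x * h (sc x))" if "\<And>u. \<bar>h u\<bar> \<le> B" for h
    by (intro tame1_mult tame1_wt tame1_bounded[of _ B] that)
  have w0: "0 \<le> wt \<beta> T x" for x using wt_pos[of \<beta> T x] by simp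
  have \<psi>B: "\<psi> u \<le> B" for u using \<psi>(2)[of u] \<phi>(2)[of u] by simp
  let ?d = "\<lambda>x. \<phi> (sc x) - \<psi> (sc x)"
  have d: "0 \<le> ?d x" "?d x \<le> B" for x using \<psi>[of "sc x"] \<phi>[of "sc x"] by auto
  have td: "tame1 ?d" using d by (intro tame1_bounded[of _ B]) auto
  have v1: "variance (tilted_field \<eta> lam N t \<phi>) \<le>
     2 * variance (lin T (\<lambda>x. wt \<beta> T x * \<psi> (sc x))) + 2 * quad T (\<lambda>x. wt \<beta> T x * ?d x)"
    unfolding field
  proof (rule variance_perturb[OF T tm _ tm])
    show "tame1 (\<lambda>x. wt \<beta> T x * ?d x)" by (intro tame1_mult tame1_wt td)
    show "\<bar>wt \<beta> T x * \<phi> (sc x) - wt \<beta> T x * \<psi> (sc x)\<bar> \<le> wt \<beta> T x * ?d x" for x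
      using d(1)[of x] w0[of x] by (simp add: right_diff_distrib[symmetric])
  qed (use \<phi> \<psi> \<psi>B w0 in auto)
  have v2: "variance (lin T (\<lambda>x. wt \<beta> T x * \<psi> (sc x))) \<le> 2 * B\<^sup>2 * D + 4 * L\<^sup>2 * exp (4 * t) * n"
  proof -
    have "variance (lin T (\<lambda>x. wt \<beta> T x * \<psi> (sc x))) \<le>
       2 * B\<^sup>2 * (lyap \<beta> (\<lambda>_. 1) T - 1) + 2 * cosh \<beta> * (L * n)\<^sup>2 / n * exp (2 * cosh \<beta> * n\<^sup>2 * T)"
    proof (rule subcritical_variance_lipschitz[OF T \<beta> n(1,3) e])
      show "\<bar>\<psi> (sc (x + 1)) - \<psi> (sc x)\<bar> \<le> L * n" for x
      proof -
        have "sc (x + 1) - sc x = n" by (simp add: sc_def algebra_simps)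
        then show ?thesis using lip(1)[of "sc (x + 1)" "sc x"] n(1) by simp
      qed
    qed (use \<psi> \<psi>B in auto)
    \<comment> \<open>The squared lattice gradient (L n)^2, divided by the strength n of the
      potential, is L^2 n and still tends to zero.\<close>
    also have "2 * cosh \<beta> * (L * n)\<^sup>2 / n * exp (2 * cosh \<beta> * n\<^sup>2 * T) = (2 * cosh \<beta>) * (L\<^sup>2 * n * exp (2 * cosh \<beta> * n\<^sup>2 * T))"
      using n(1) by (simp add: power2_eq_square)
    also have "\<dots> \<le> 4 * (L\<^sup>2 * n * exp (4 * t))"
      using cb(3) growth n(1) by (intro mult_mono) auto
    also have "2 * B\<^sup>2 * (lyap \<beta> (\<lambda>_. 1) T - 1) \<le> 2 * B\<^sup>2 * D" using mass by (intro mult_left_mono) auto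
    finally show ?thesis by (simp add: mult_ac)
  qed
  have v3: "quad T (\<lambda>x. wt \<beta> T x * ?d x) \<le> \<epsilon>\<^sup>2 + 2 * t * (B / R)\<^sup>2 + B\<^sup>2 * ((1 + 1 / (4 * \<epsilon>)) * D + \<epsilon>)"
  proof -
    have "quad T (\<lambda>x. wt \<beta> T x * ?d x) \<le> S2 (\<lambda>x y. m2 T x y * (wt \<beta> T x * (?d x)\<^sup>2)) + B\<^sup>2 * ((1 + 1 / (4 * \<epsilon>)) * (quad T (wt \<beta> T) - 1) + \<epsilon>)"
      by (rule quad_le_mean[OF T tame1_wt w0 mean_wt[OF T] td d \<epsilon>])
    also have "S2 (\<lambda>x y. m2 T x y * (wt \<beta> T x * (?d x)\<^sup>2)) \<le> \<epsilon>\<^sup>2 + ((B / R)\<^sup>2 / real N) * (T * cosh \<beta>)"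
    proof (rule mean_square_tail[OF T d(1) _ d(2)])
      show "(?d x)\<^sup>2 \<le> \<epsilon>\<^sup>2 + (B / R)\<^sup>2 / real N * (of_int x - T * sinh \<beta>)\<^sup>2" for x
      proof (cases "\<bar>sc x\<bar> \<le> R")
        case True
        then have "(?d x)\<^sup>2 \<le> \<epsilon>\<^sup>2" using close[OF True] d(1)[of x] by (intro power_mono) auto
        moreover have "0 \<le> (B / R)\<^sup>2 / real N * (of_int x - T * sinh \<beta>)\<^sup>2" by simp
        ultimately show ?thesis by linarith
      next
        case False
        have "(?d x)\<^sup>2 \<le> B\<^sup>2 * 1" using d[of x] by (simp add: power_mono)
        also have "\<dots> \<le> B\<^sup>2 * ((sc x)\<^sup>2 / R\<^sup>2)"
        proof (rule mult_left_mono)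
          have "R\<^sup>2 \<le> (sc x)\<^sup>2" using False R by (simp add: abs_le_square_iff[symmetric])
          then show "1 \<le> (sc x)\<^sup>2 / R\<^sup>2" using R by simp
        qed simp
        also have "\<dots> = (B / R)\<^sup>2 / real N * (of_int x - T * sinh \<beta>)\<^sup>2"
          unfolding sc_def drift power_mult_distrib n(2) by (simp add: power_divide)
        finally show ?thesis using zero_le_power2[of \<epsilon>] by linarith
      qed
    qed simp
    also have "(B / R)\<^sup>2 / real N * (T * cosh \<beta>) \<le> 2 * t * (B / R)\<^sup>2"
    proof -
      have "(B / R)\<^sup>2 / real N * (T * cosh \<beta>) = ((B / R)\<^sup>2 * t) * cosh \<beta>" using N0 by (simp add: T_def)
      also have "\<dots> \<le> ((B / R)\<^sup>2 * t) * 2" using cb(3) t by (intro mult_left_mono) auto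
      finally show ?thesis by (simp add: mult_ac)
    qed
    also have "(1 + 1 / (4 * \<epsilon>)) * (quad T (wt \<beta> T) - 1) \<le> (1 + 1 / (4 * \<epsilon>)) * D"
      using mass \<epsilon> unfolding quad_wt by (intro mult_left_mono) auto
    finally show ?thesis by (simp add: mult_left_mono)
  qed
  show ?thesis
    by (rule order.trans[OF v1], intro add_mono mult_left_mono v2[unfolded n_def] v3) simp_all
qed

lemma subcritical_limit:
  assumes t: "0 < t" and lam: "lam < 7/8"
    and \<phi>: "\<And>u. 0 \<le> \<phi> u" "\<And>u. \<phi> u \<le> B" and cont: "continuous_on UNIV \<phi>"
  shows "(\<lambda>N. variance (tilted_field \<eta> lam N t \<phi>)) \<longlonglongrightarrow> 0"
proof (rule LIMSEQ_I)
  fix r :: real assume r: "0 < r"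
  define C where "C = 1 + 2 * B\<^sup>2"
  \<comment> \<open>The budget: U uses less than r/4, while the \<epsilon>-terms use at most r/16
    and the tail at most r/8, the last two counted twice.\<close>
  define \<epsilon> where "\<epsilon> = min 1 (r / (16 * C))"
  have C: "1 \<le> C" by (simp add: C_def)
  have \<epsilon>: "0 < \<epsilon>" "\<epsilon> \<le> 1" "\<epsilon> * C \<le> r / 16"
  proof -
    show "0 < \<epsilon>" "\<epsilon> \<le> 1" using r C by (auto simp: \<epsilon>_def)
    have "\<epsilon> \<le> r / (16 * C)" by (simp add: \<epsilon>_def)
    then have "\<epsilon> * C \<le> r / (16 * C) * C" using C by (intro mult_right_mono) auto
    then show "\<epsilon> * C \<le> r / 16" using C by simp
  qed
  define R where "R = 1 + 16 * (t * (1 + B\<^sup>2)) / r"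
  have R: "1 \<le> R" using t r by (simp add: R_def)
  have Rb: "2 * t * (B / R)\<^sup>2 \<le> r / 8"
  proof -
    have "2 * t * (B / R)\<^sup>2 = 2 * (t * B\<^sup>2) / R\<^sup>2" by (simp add: power_divide)
    also have "\<dots> \<le> 2 * (t * B\<^sup>2) / R"
      using R t by (intro divide_left_mono) (auto simp: power2_eq_square)
    also have "\<dots> \<le> r / 8"
    proof -
      have "16 * (t * B\<^sup>2) \<le> 16 * (t * (1 + B\<^sup>2))" using t by simp
      also have "\<dots> \<le> r * R" using r by (simp add: R_def field_simps)
      finally show ?thesis using R by (simp add: divide_le_eq)
    qed
    finally show ?thesis .
  qed
  obtain \<psi> L where \<psi>: "0 \<le> L" "\<And>u. 0 \<le> \<psi> u" "\<And>u. \<psi> u \<le> \<phi> u"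
    "\<And>u v. \<bar>\<psi> u - \<psi> v\<bar> \<le> L * \<bar>u - v\<bar>" "\<And>u. \<bar>u\<bar> \<le> R \<Longrightarrow> \<phi> u - \<psi> u \<le> \<epsilon>"
  proof -
    have "\<exists>\<psi> L. 0 \<le> L \<and> (\<forall>u. 0 \<le> \<psi> u) \<and> (\<forall>u. \<psi> u \<le> \<phi> u) \<and> (\<forall>u v. \<bar>\<psi> u - \<psi> v\<bar> \<le> L * \<bar>u - v\<bar>) \<and>
      (\<forall>u. \<bar>u\<bar> \<le> R \<longrightarrow> \<phi> u - \<psi> u \<le> \<epsilon>)"
      by (rule lipschitz_minorant[where \<phi>=\<phi> and B=B and R=R, OF \<phi> cont \<epsilon>(1)]) blast
    then show ?thesis using that by auto
  qed
  define D where "D N = real N powr (2 * lam - 2) / 2 + real N powr (4 * lam - 7/2) * exp (4 * t)" for N :: nat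
  define U where "U N = 2 * (2 * B\<^sup>2 * D N + 4 * L\<^sup>2 * exp (4 * t) * real N powr (-1/2)) +
     2 * (B\<^sup>2 * ((1 + 1 / (4 * \<epsilon>)) * D N))" for N :: nat
  have z: "(\<lambda>N. real N powr s) \<longlonglongrightarrow> 0" if "s < 0" for s
    by (rule tendsto_neg_powr[OF that filterlim_real_sequentially])
  have D0: "D \<longlonglongrightarrow> 0 / 2 + 0 * exp (4 * t)"
    unfolding D_def[abs_def] using lam by (intro tendsto_intros z) auto
  have "U \<longlonglongrightarrow> 2 * (2 * B\<^sup>2 * (0 / 2 + 0 * exp (4 * t)) + 4 * L\<^sup>2 * exp (4 * t) * 0) +
     2 * (B\<^sup>2 * ((1 + 1 / (4 * \<epsilon>)) * (0 / 2 + 0 * exp (4 * t))))"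
    unfolding U_def[abs_def] by (intro tendsto_intros z D0) auto
  then have "eventually (\<lambda>N. U N < r / 4) sequentially" using r by (intro order_tendstoD(2)) auto
  then obtain N0 where N0: "\<And>N. N \<ge> N0 \<Longrightarrow> U N < r / 4" by (auto simp: eventually_sequentially)
  show "\<exists>no. \<forall>n\<ge>no. norm (variance (tilted_field \<eta> lam n t \<phi>) - 0) < r"
  proof (intro exI allI impI)
    fix N assume N: "max 4 N0 \<le> N"
    have "variance (tilted_field \<eta> lam N t \<phi>) \<le>
     2 * (2 * B\<^sup>2 * D N + 4 * L\<^sup>2 * exp (4 * t) * real N powr (-1/2)) +
     2 * (\<epsilon>\<^sup>2 + 2 * t * (B / R)\<^sup>2 + B\<^sup>2 * ((1 + 1 / (4 * \<epsilon>)) * D N + \<epsilon>))"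
      unfolding D_def by (rule subcritical_bound[where \<phi>=\<phi> and \<psi>=\<psi>, OF _ t lam \<phi> \<psi>(2,3,4,1,5) _ \<epsilon>(1)]) (use N R in auto)
    also have "\<dots> = U N + 2 * (\<epsilon>\<^sup>2 + 2 * t * (B / R)\<^sup>2 + B\<^sup>2 * \<epsilon>)"
      by (simp add: U_def algebra_simps)
    also have "\<dots> < r"
    proof -
      have "\<epsilon>\<^sup>2 \<le> \<epsilon>" using \<epsilon> by (simp add: power2_eq_square mult_left_le)
      moreover have "0 \<le> B\<^sup>2 * \<epsilon>" using \<epsilon>(1) by simp
      moreover have "\<epsilon> * C = \<epsilon> + 2 * (B\<^sup>2 * \<epsilon>)" by (simp add: C_def algebra_simps)
      ultimately have "\<epsilon>\<^sup>2 + B\<^sup>2 * \<epsilon> \<le> \<epsilon> * C" by linarith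
      then show ?thesis using N0[of N] N \<epsilon>(3) Rb r by simp
    qed
    finally have "variance (tilted_field \<eta> lam N t \<phi>) < r" .
    moreover have "0 \<le> variance (tilted_field \<eta> lam N t \<phi>)" by (rule variance_positive)
    ultimately show "norm (variance (tilted_field \<eta> lam N t \<phi>) - 0) < r" by simp
  qed
qed

end

section \<open>The supercritical regime\<close>

text \<open>A Stirling-type upper bound. The induction step reduces to ((n / (n + 1))^(n + 1) \<le>
  exp (-1), which follows from ln x \<le> x - 1.\<close>

lemma fact_exp_le:
  assumes "1 \<le> n"
  shows "fact n * exp (real n) \<le> exp 1 * real n ^ (n + 1)"
  using assms
proof (induction n rule: dec_induct)
  case (step n)
  have n: "0 < real n" using step by simp
  have "exp 1 * real n ^ (n + 1) \<le> real (Suc n) ^ (n + 1)"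
  proof -
    have "1 - real n / real (Suc n) \<le> - ln (real n / real (Suc n))"
      using ln_le_minus_one[of "real n / real (Suc n)"] n by simp
    moreover have "1 - real n / real (Suc n) = 1 / real (Suc n)" by (simp add: field_simps)
    ultimately have "ln (real n / real (Suc n)) \<le> - (1 / real (Suc n))" by linarith
    then have "real n / real (Suc n) \<le> exp (- (1 / real (Suc n)))"
      using n exp_ln[of "real n / real (Suc n)"] exp_le_cancel_iff[of "ln (real n / real (Suc n))" "- (1 / real (Suc n))"]
      by (simp del: of_nat_Suc exp_le_cancel_iff)
    then have "(real n / real (Suc n)) ^ Suc n \<le> exp (- (1 / real (Suc n))) ^ Suc n" by (intro power_mono) auto
    also have "\<dots> = exp (- 1)" unfolding exp_of_nat_mult[symmetric] by simp
    finally have "real n ^ Suc n \<le> exp (- 1) * real (Suc n) ^ Suc n"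
      unfolding power_divide by (simp add: divide_le_eq del: power_Suc of_nat_Suc)
    then have "exp 1 * real n ^ Suc n \<le> exp 1 * (exp (- 1) * real (Suc n) ^ Suc n)" by (rule mult_left_mono) simp
    also have "\<dots> = real (Suc n) ^ Suc n" by (simp add: mult.assoc[symmetric] exp_add[symmetric] del: power_Suc of_nat_Suc)
    finally show ?thesis by simp
  qed
  have "fact (Suc n) * exp (real (Suc n)) = (real (Suc n) * exp 1) * (fact n * exp (real n))"
    by (simp add: exp_add algebra_simps)
  also have "\<dots> \<le> (real (Suc n) * exp 1) * (exp 1 * real n ^ (n + 1))"
    by (intro mult_left_mono step.IH) auto
  also have "\<dots> \<le> (real (Suc n) * exp 1) * (real (Suc n) ^ (n + 1))"
    by (intro mult_left_mono \<open>exp 1 * real n ^ (n + 1) \<le> real (Suc n) ^ (n + 1)\<close>) auto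
  finally show ?case by (simp add: mult_ac)
qed simp

text \<open>After Stirling's bound the exponent is i - \<mu> - i ln (i / \<mu>), and ln x \<le> x -
  1 bounds it below by -(i - \<mu>)^2 / \<mu>. Within a distance of order sqrt \<mu> from the mean
  only a polynomial factor is lost.\<close>

lemma poisson_lower:
  assumes \<mu>: "0 < \<mu>" and i: "1 \<le> i"
  shows "exp (- ((real i - \<mu>)\<^sup>2 / \<mu>)) / (exp 1 * real i) \<le> exp (- \<mu>) * \<mu> ^ i / fact i"
proof -
  have i0: "0 < real i" using i by simp
  have "ln (real i / \<mu>) \<le> real i / \<mu> - 1" using ln_le_minus_one[of "real i / \<mu>"] i0 \<mu> by simp
  then have "real i * ln (real i / \<mu>) \<le> real i * (real i / \<mu> - 1)" by (intro mult_left_mono) auto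
  moreover have "real i - \<mu> - real i * (real i / \<mu> - 1) = - ((real i - \<mu>)\<^sup>2 / \<mu>)"
    using \<mu> by (simp add: field_simps power2_eq_square)
  ultimately have "exp (- ((real i - \<mu>)\<^sup>2 / \<mu>)) \<le> exp (real i - \<mu> - real i * ln (real i / \<mu>))" by simp
  also have "\<dots> = exp (- \<mu>) * \<mu> ^ i * exp (real i) / real i ^ i"
  proof -
    have "exp (real i * ln (real i / \<mu>)) = (real i / \<mu>) ^ i"
      using i0 \<mu> by (subst exp_of_nat_mult) simp
    then have "exp (real i - \<mu> - real i * ln (real i / \<mu>)) = exp (real i) / exp \<mu> / (real i / \<mu>) ^ i"
      by (simp only: exp_diff)
    also have "\<dots> = exp (- \<mu>) * \<mu> ^ i * exp (real i) / real i ^ i"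
      using \<mu> i0 by (simp only: exp_minus power_divide) (simp add: field_simps)
    finally show ?thesis .
  qed
  finally have "exp (- ((real i - \<mu>)\<^sup>2 / \<mu>)) / (exp 1 * real i) \<le> exp (- \<mu>) * \<mu> ^ i * exp (real i) / real i ^ i / (exp 1 * real i)"
    by (rule divide_right_mono) (use i0 in simp)
  also have "\<dots> = exp (- \<mu>) * \<mu> ^ i * (exp (real i) / (exp 1 * real i ^ (i + 1)))" by simp
  also have "\<dots> \<le> exp (- \<mu>) * \<mu> ^ i * (1 / fact i)"
  proof (rule mult_left_mono)
    show "exp (real i) / (exp 1 * real i ^ (i + 1)) \<le> 1 / fact i"
      using fact_exp_le[OF i] i0 by (simp add: field_simps)
  qed (use \<mu> in simp)
  finally show ?thesis by simp
qed

lemma exp_le_quadratic: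
  fixes y :: real
  assumes "\<bar>y\<bar> \<le> 1"
  shows "exp y \<le> 1 + y + y\<^sup>2"
proof (cases "0 \<le> y")
  case True
  then show ?thesis using exp_bound[of y] assms by simp
next
  case False
  then show ?thesis using one_minus_exp_ge[of "- y"] by simp
qed

text \<open>The linear term of cosh (\<beta> + \<theta>) in \<theta> is \<theta> sinh \<beta> =
  \<theta> b, the contribution of the drift; the rest is quadratic in \<theta>.\<close>

lemma tilt_perturbation:
  fixes b \<theta> :: real
  assumes b: "0 \<le> b" "b \<le> 1" and \<theta>: "\<bar>\<theta>\<bar> \<le> b"
  defines "\<beta> \<equiv> arsinh b"
  shows "cosh (\<beta> + \<theta>) - 1 \<le> 5 * b\<^sup>2" "cosh (\<beta> + \<theta>) - cosh \<beta> - \<theta> * b \<le> 3 * \<theta>\<^sup>2"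
proof -
  have sh: "sinh \<beta> = b" by (simp add: \<beta>_def)
  note cb = cosh_arsinh_bounds[OF b, folded \<beta>_def]
  have \<theta>1: "\<bar>\<theta>\<bar> \<le> 1" using b \<theta> by linarith
  have e1: "exp \<theta> \<le> 1 + \<theta> + \<theta>\<^sup>2" "exp (- \<theta>) \<le> 1 - \<theta> + \<theta>\<^sup>2"
    using exp_le_quadratic[of \<theta>] exp_le_quadratic[of "- \<theta>"] \<theta>1 by simp_all
  have e2: "1 + \<theta> \<le> exp \<theta>" "1 - \<theta> \<le> exp (- \<theta>)" using exp_ge_add_one_self[of \<theta>] exp_ge_add_one_self[of "- \<theta>"] by simp_all
  have c: "cosh \<theta> - 1 \<le> \<theta>\<^sup>2" "0 \<le> cosh \<theta> - 1" using e1 cosh_real_ge_1[of \<theta>] unfolding cosh_def by (simp_all add: field_simps)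
  have s: "sinh \<theta> - \<theta> \<le> \<theta>\<^sup>2" using e1 e2 unfolding sinh_def scaleR_conv_of_real by (simp add: field_simps)
  have add: "cosh (\<beta> + \<theta>) = cosh \<beta> * cosh \<theta> + b * sinh \<theta>" by (simp add: cosh_add sh)
  have 1: "cosh \<beta> * (cosh \<theta> - 1) \<le> 2 * \<theta>\<^sup>2" using cb(3) c cosh_real_pos[of \<beta>] by (intro mult_mono) auto
  have 2: "b * (sinh \<theta> - \<theta>) \<le> 1 * \<theta>\<^sup>2"
    using mult_left_mono[OF s b(1)] mult_right_mono[OF b(2), of "\<theta>\<^sup>2"] by simp
  have "cosh (\<beta> + \<theta>) - cosh \<beta> - \<theta> * b = cosh \<beta> * (cosh \<theta> - 1) + b * (sinh \<theta> - \<theta>)" unfolding add by (simp add: algebra_simps)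
  then show *: "cosh (\<beta> + \<theta>) - cosh \<beta> - \<theta> * b \<le> 3 * \<theta>\<^sup>2" using 1 2 by linarith
  have t2: "\<theta>\<^sup>2 \<le> b\<^sup>2" using \<theta> by (simp add: abs_le_square_iff[symmetric])
  have "\<theta> * b \<le> \<bar>\<theta>\<bar> * b" using b by (intro mult_right_mono) auto
  also have "\<dots> \<le> b * b" using \<theta> b by (intro mult_right_mono) auto
  finally have "\<theta> * b \<le> b\<^sup>2" by (simp add: power2_eq_square)
  then show "cosh (\<beta> + \<theta>) - 1 \<le> 5 * b\<^sup>2" using * t2 cb(1) zero_le_power2[of b] by linarith
qed

text \<open>The choice a = e^2/2 keeps the leading part 2 e^2 - 2 a of the potential equal to e^2 >
  0, while the rate is still a^2 = e^4/4 to leading order.\<close>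

lemma pot_nonneg:
  assumes e: "e = cosh \<beta> - 1" "0 < e" "e \<le> 1/2"
  shows "0 \<le> pot \<beta> (1 - e\<^sup>2 / 2)" "e ^ 4 / 4 \<le> rate \<beta> (1 - e\<^sup>2 / 2)" "0 < 1 - e\<^sup>2 / 2"
proof -
  have c: "cosh \<beta> = 1 + e" using e by simp
  have e2: "e\<^sup>2 \<le> 1/4" using power_mono[OF e(3), of 2] e(2) by (simp add: power2_eq_square)
  show pos: "0 < 1 - e\<^sup>2 / 2" using e2 by simp
  have "(1 - e\<^sup>2 / 2) ^ 3 - 2 * cosh \<beta> * (1 - e\<^sup>2 / 2)\<^sup>2 + (2 * (cosh \<beta>)\<^sup>2 + 1) * (1 - e\<^sup>2 / 2) - 2 * cosh \<beta>
     = e\<^sup>2 * (1 - 3/4 * e\<^sup>2 - 1/2 * e * e\<^sup>2 - 1/8 * (e\<^sup>2)\<^sup>2)"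
    unfolding c by (simp add: power2_eq_square power3_eq_cube field_simps)
  also have "\<dots> \<ge> 0"
  proof -
    have "e * e\<^sup>2 \<le> (1/2) * (1/4)" using e e2 by (intro mult_mono) auto
    moreover have "(e\<^sup>2)\<^sup>2 \<le> (1/4)\<^sup>2" using e2 by (intro power_mono) auto
    ultimately have "0 \<le> 1 - 3/4 * e\<^sup>2 - 1/2 * e * e\<^sup>2 - 1/8 * (e\<^sup>2)\<^sup>2" using e2 by (simp add: power2_eq_square[of "1/4"])
    then show ?thesis by simp
  qed
  finally show "0 \<le> pot \<beta> (1 - e\<^sup>2 / 2)" using pos by (simp add: pot_def)
  have "(1 - e\<^sup>2 / 2) + 1 / (1 - e\<^sup>2 / 2) - 2 = (e\<^sup>2 / 2)\<^sup>2 / (1 - e\<^sup>2 / 2)"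
    using pos by (simp add: field_simps power2_eq_square)
  moreover have "(e\<^sup>2 / 2)\<^sup>2 \<le> (e\<^sup>2 / 2)\<^sup>2 / (1 - e\<^sup>2 / 2)"
    using pos by (simp add: le_divide_eq mult_left_le)
  ultimately have "1 * (e\<^sup>2 / 2)\<^sup>2 \<le> rate \<beta> (1 - e\<^sup>2 / 2)"
    unfolding rate_def using cosh_real_ge_1[of \<beta>] by (intro mult_mono) auto
  then show "e ^ 4 / 4 \<le> rate \<beta> (1 - e\<^sup>2 / 2)" by (simp add: power_divide power_mult[symmetric])
qed

text \<open>The walk is made to end at \<open>\<lfloor>z\<rfloor>\<close>, with j left jumps, the
  floor of their mean, and i right jumps that supply the missing displacement. Both counts stay
  within D + 2 of their means, so \<open>poisson_lower\<close> bounds both weights.\<close>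

lemma heat_window:
  assumes \<psi>: "\<And>x. \<bar>\<psi> x\<bar> \<le> B" "\<And>x. 0 \<le> \<psi> x" and p0: "0 \<le> p0" "\<And>y. \<bar>of_int y - z\<bar> \<le> 1 \<Longrightarrow> p0 \<le> \<psi> y"
    and r: "0 \<le> r" and \<beta>: "0 \<le> \<beta>" and mu: "1 \<le> r * exp (- \<beta>) / 2" "D + 3 \<le> r * exp \<beta> / 2"
    and x: "\<bar>z - of_int x - r * sinh \<beta>\<bar> \<le> D"
  shows "p0 * (exp (- ((D + 2)\<^sup>2 / (r * exp (- \<beta>) / 2))) / (exp 1 * (r * exp \<beta> / 2 + (D + 2))))\<^sup>2 \<le> heat \<beta> r \<psi> x"
proof -
  define mp mm where "mp = r * exp \<beta> / 2" and "mm = r * exp (- \<beta>) / 2"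
  have D0: "0 \<le> D" using x by linarith
  have mm1: "1 \<le> mm" "D + 3 \<le> mp" using mu by (auto simp: mp_def mm_def)
  have mle: "mm \<le> mp" unfolding mp_def mm_def using r \<beta> by (intro divide_right_mono mult_left_mono) auto
  have diff: "mp - mm = r * sinh \<beta>" by (simp add: mp_def mm_def sinh_def field_simps)
  define j where "j = nat \<lfloor>mm\<rfloor>"
  have fl: "1 \<le> \<lfloor>mm\<rfloor>" using mm1 by (simp add: le_floor_iff)
  have j: "real j = of_int \<lfloor>mm\<rfloor>" "1 \<le> j" using fl unfolding j_def by linarith+
  have j_close: "real j \<le> mm" "mm < real j + 1" unfolding j by (auto simp: floor_correct)
  define k where "k = \<lfloor>z\<rfloor> - x"
  have k_close: "\<bar>of_int k - r * sinh \<beta>\<bar> \<le> D + 1"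
    using x floor_correct[of z] unfolding k_def of_int_diff by linarith
  define i where "i = nat (int j + k)"
  \<comment> \<open>One unit of rounding comes from z and one from the mean number of left jumps;
    hence D + 2.\<close>
  have i_real: "\<bar>of_int (int j + k) - mp\<bar> \<le> D + 2"
    using j_close k_close diff unfolding abs_le_iff of_int_add of_int_of_nat_eq by linarith
  have "1 \<le> of_int (int j + k) + (0::real)" using i_real mm1(2) by linarith
  then have ge1: "1 \<le> int j + k" by linarith
  then have i: "real i = of_int (int j + k)" "1 \<le> i" "int i = int j + k" by (auto simp: i_def)
  let ?E = "exp (- ((D + 2)\<^sup>2 / mm)) / (exp 1 * (mp + (D + 2)))"
  have E0: "0 \<le> ?E" using mm1 D0 by simp
  have low: "?E \<le> exp (- m) * m ^ l / fact l" if m: "mm \<le> m" and l: "1 \<le> l" "\<bar>real l - m\<bar> \<le> D + 2" "real l \<le> mp + (D + 2)" for m l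
  proof -
    have m0: "0 < m" using m mm1 by linarith
    have "(real l - m)\<^sup>2 \<le> (D + 2)\<^sup>2" using l(2) by (metis abs_ge_zero power2_abs power_mono)
    then have "(real l - m)\<^sup>2 / m \<le> (D + 2)\<^sup>2 / mm" using m mm1 by (intro frac_le) auto
    then have "?E \<le> exp (- ((real l - m)\<^sup>2 / m)) / (exp 1 * real l)"
      using l mm1 by (intro frac_le mult_left_mono) auto
    also have "\<dots> \<le> exp (- m) * m ^ l / fact l" by (rule poisson_lower[OF m0 l(1)])
    finally show ?thesis .
  qed
  have li: "?E \<le> exp (- mp) * mp ^ i / fact i"
    by (rule low[OF mle i(2)]) (use i_real i(1) in linarith)+
  have lj: "?E \<le> exp (- mm) * mm ^ j / fact j"
    by (rule low[OF order.refl j(2)]) (use j_close D0 mle in linarith)+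
  have y: "x + int i - int j = \<lfloor>z\<rfloor>" using i(3) by (simp add: k_def)
  have "p0 \<le> \<psi> (x + int i - int j)"
    unfolding y by (rule p0(2)) (use floor_correct[of z] in linarith)
  then have "(?E * ?E) * p0 \<le> (exp (- mp) * mp ^ i / fact i) * (exp (- mm) * mm ^ j / fact j) * \<psi> (x + int i - int j)"
    using E0 p0(1) mm1 mle D0 by (intro mult_mono li lj) auto
  also have "\<dots> \<le> heat \<beta> r \<psi> x"
    using heat_ge_poisson[where \<psi>=\<psi> and B=B and r=r and \<beta>=\<beta> and i=i and j=j and x=x, OF \<psi> r] by (simp add: mp_def mm_def)
  finally show ?thesis unfolding mp_def mm_def by (simp add: power2_eq_square mult_ac)
qed

section \<open>Second moment carried by a window around the drift\<close>

context averaging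
begin

lemma quad_cmult: "quad s (\<lambda>x. c * f x) = c\<^sup>2 * quad s f"
  unfolding quad_def S2_cmult[symmetric] by (simp add: power2_eq_square mult_ac)

text \<open>
  Mass far from \<open>s b\<close> is controlled by the total masses of the fields with the tilts \<open>\<beta> \<pm> \<theta>\<close>.
\<close>

lemma window_mass:
  fixes b \<theta> W s :: real
  assumes s: "0 < s" and b: "0 < b" "5 * b\<^sup>2 \<le> 1" "200 * b ^ 4 \<le> 1" and \<theta>: "0 < \<theta>" "\<theta> \<le> b"
  defines "\<beta> \<equiv> arsinh b"
  shows "exp (b ^ 8 * s / 324) / 2 - 12 * exp (6 * (s * \<theta>\<^sup>2) - 2 * (\<theta> * W) + 40000 * (b ^ 8 * s)) \<le>
    quad s (\<lambda>x. wt \<beta> s x * of_bool (\<bar>of_int x - s * b\<bar> \<le> W))"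
proof -
  have "b\<^sup>2 \<le> 1" using b(2) by simp
  then have b1: "0 \<le> b" "b \<le> 1" using b(1) by (auto simp: power_le_one_iff abs_square_le_1)
  note cb = cosh_arsinh_bounds[OF b1, folded \<beta>_def]
  have s0: "0 \<le> s" using s by simp
  let ?near = "\<lambda>x. wt \<beta> s x * of_bool (\<bar>of_int x - s * b\<bar> \<le> W)"
  let ?far = "\<lambda>x. wt \<beta> s x * of_bool (\<not> \<bar>of_int x - s * b\<bar> \<le> W)"
  have w0: "0 \<le> wt \<beta>' s x" for \<beta>' x using wt_pos[of \<beta>' s x] by simp
  have tn: "tame1 ?near" "tame1 ?far" by (intro tame1_mult tame1_wt tame1_bounded[of _ 1]; simp)+
  have "quad s (wt \<beta> s) = quad s (\<lambda>x. ?near x + ?far x)"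
    by (rule arg_cong[where f="quad s"]) (auto simp: fun_eq_iff)
  also have "\<dots> \<le> 2 * quad s ?near + 2 * quad s ?far"
    by (rule quad_add[OF s tn(1) _ tn(2)]) (use w0 in auto)
  finally have split: "quad s (wt \<beta> s) / 2 - quad s ?far \<le> quad s ?near" by simp
  have mass: "exp (b ^ 8 * s / 324) \<le> quad s (wt \<beta> s)"
  proof -
    define e where "e = cosh \<beta> - 1"
    have e: "b\<^sup>2 / 3 \<le> e" "0 < e" "e \<le> 1/2"
      using cb \<open>b\<^sup>2 \<le> 1\<close> b(1) by (auto simp: e_def) (smt (verit) zero_less_power)
    \<comment> \<open>324 is 4 times 3^4: the rate is at least e^4/4, and e is at least
      b^2/3.\<close>
    have "exp (b ^ 8 * s / 324) \<le> exp (rate \<beta> (1 - e\<^sup>2 / 2) * s)"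
    proof -
      have "(b\<^sup>2 / 3) ^ 4 \<le> e ^ 4" using e by (intro power_mono) auto
      then have "b ^ 8 / 324 \<le> e ^ 4 / 4" by (simp add: power_divide power_mult[symmetric])
      also have "\<dots> \<le> rate \<beta> (1 - e\<^sup>2 / 2)" by (rule pot_nonneg(2)[OF e_def e(2,3)])
      finally have "b ^ 8 / 324 * s \<le> rate \<beta> (1 - e\<^sup>2 / 2) * s" by (rule mult_right_mono[OF _ s0])
      then show ?thesis by simp
    qed
    also have "\<dots> \<le> quad s (wt \<beta> s)"
      unfolding quad_wt by (rule mass_lower[OF s0 pot_nonneg(3)[OF e_def e(2,3)] _ pot_nonneg(1)[OF e_def e(2,3)]]) simp
    finally show ?thesis .
  qed
  let ?E = "exp (40000 * (b ^ 8 * s))"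
  have Q: "quad s (wt (\<beta> + \<theta>') s) \<le> 3 * ?E" if \<theta>': "\<bar>\<theta>'\<bar> \<le> b" for \<theta>'
  proof -
    let ?c = "cosh (\<beta> + \<theta>')"
    \<comment> \<open>Since (cosh - 1)^2 \<le> 25 b^4, this value meets the condition (cosh - 1)^2
      \<le> a/4 and makes the prefactor at most 1; as cosh \<le> 2, the exponent is at most 4 a^2 s
      = 40000 b^8 s.\<close>
    let ?a = "100 * b ^ 4"
    have c: "?c - 1 \<le> 5 * b\<^sup>2" "0 \<le> ?c - 1"
      using tilt_perturbation(1)[OF b1 \<theta>'] cosh_real_ge_1[of "\<beta> + \<theta>'"] by (auto simp: \<beta>_def)
    have c2: "(?c - 1)\<^sup>2 \<le> 25 * b ^ 4" using power_mono[OF c, of 2] by (simp add: power_mult_distrib power_mult[symmetric])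
    have a: "0 < ?a" "?a \<le> 1/2" using b by auto
    have "lyap (\<beta> + \<theta>') (\<lambda>_. 1) s \<le> 2 - 1 / ?c + 4 * (?c - 1)\<^sup>2 / ?a * exp (2 * ?c * ?a\<^sup>2 * s)"
      by (rule subcritical_mass[OF s a]) (use c2 in simp)
    also have "\<dots> \<le> 2 + 1 * ?E"
    proof (intro add_mono mult_mono)
      show "2 - 1 / ?c \<le> 2" using cosh_real_pos[of "\<beta> + \<theta>'"] by simp
      show "4 * (?c - 1)\<^sup>2 / ?a \<le> 1" using c2 a by (simp add: divide_le_eq)
      have "2 * ?c * ?a\<^sup>2 * s \<le> 4 * ?a\<^sup>2 * s" using c b(2) s0 by (intro mult_right_mono) auto
      also have "4 * ?a\<^sup>2 * s = 40000 * (b ^ 8 * s)" by (simp add: power_mult_distrib power_mult[symmetric])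
      finally show "exp (2 * ?c * ?a\<^sup>2 * s) \<le> ?E" by simp
    qed auto
    also have "\<dots> \<le> 3 * ?E" using s0 b1 by simp
    finally show ?thesis unfolding quad_wt .
  qed
  let ?C = "exp (3 * (s * \<theta>\<^sup>2) - \<theta> * W)"
  have far_le: "?far x \<le> ?C * (wt (\<beta> + \<theta>) s x + wt (\<beta> + - \<theta>) s x)" for x
  proof (cases "\<bar>of_int x - s * b\<bar> \<le> W")
    case True
    then show ?thesis using w0 by simp
  next
    case False
    \<comment> \<open>Changing the tilt costs only the quadratic remainder of the cosh, because
      centring at s b absorbs the linear term.\<close>
    have tilt: "wt \<beta> s x * exp (\<theta>' * (of_int x - s * b)) \<le> exp (3 * (s * \<theta>'\<^sup>2)) * wt (\<beta> + \<theta>') s x" if "\<bar>\<theta>'\<bar> \<le> b" for \<theta>'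
    proof -
      have "wt \<beta> s x * exp (\<theta>' * (of_int x - s * b)) = wt (\<beta> + \<theta>') s x * exp (s * (cosh (\<beta> + \<theta>') - cosh \<beta> - \<theta>' * b))"
        by (simp add: wt_def exp_add[symmetric] algebra_simps)
      also have "\<dots> \<le> wt (\<beta> + \<theta>') s x * exp (s * (3 * \<theta>'\<^sup>2))"
        using tilt_perturbation(2)[OF b1 that] s0 w0 unfolding \<beta>_def by (intro mult_left_mono) (auto intro: mult_left_mono)
      finally show ?thesis by (simp add: mult_ac)
    qed
    \<comment> \<open>Outside the window one of the two exponentials, depending on the side, is at
      least \<open>exp (\<theta> * W)\<close>.\<close>
    have sum: "exp (\<theta> * W) \<le> exp (\<theta> * (of_int x - s * b)) + exp (- \<theta> * (of_int x - s * b))"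
    proof (cases "0 \<le> of_int x - s * b")
      case True
      then have "\<theta> * W \<le> \<theta> * (of_int x - s * b)" using False \<theta> by (intro mult_left_mono) auto
      then show ?thesis by (simp add: add_increasing2)
    next
      case neg: False
      then have "\<theta> * W \<le> \<theta> * (- (of_int x - s * b))" using False \<theta> by (intro mult_left_mono) auto
      then have "exp (\<theta> * W) \<le> exp (- \<theta> * (of_int x - s * b))" by (simp add: algebra_simps)
      then show ?thesis by (simp add: add_increasing)
    qed
    have "wt \<beta> s x = exp (- (\<theta> * W)) * (wt \<beta> s x * exp (\<theta> * W))" by (simp add: exp_minus)
    also have "\<dots> \<le> exp (- (\<theta> * W)) * (wt \<beta> s x * (exp (\<theta> * (of_int x - s * b)) + exp (- \<theta> * (of_int x - s * b))))"
      using sum w0 by (intro mult_left_mono) auto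
    also have "\<dots> \<le> exp (- (\<theta> * W)) * (exp (3 * (s * \<theta>\<^sup>2)) * wt (\<beta> + \<theta>) s x + exp (3 * (s * \<theta>\<^sup>2)) * wt (\<beta> + - \<theta>) s x)"
      using tilt[of \<theta>] tilt[of "- \<theta>"] \<theta> unfolding distrib_left by (intro mult_left_mono add_mono) auto
    also have "\<dots> = ?C * (wt (\<beta> + \<theta>) s x + wt (\<beta> + - \<theta>) s x)" by (simp add: exp_diff exp_minus field_simps)
    finally show ?thesis using False by simp
  qed
  have "quad s ?far \<le> quad s (\<lambda>x. ?C * (wt (\<beta> + \<theta>) s x + wt (\<beta> + - \<theta>) s x))"
  proof (rule quad_mono[OF s tn(2) _ _ far_le])
    show "0 \<le> ?far x" for x using w0[of \<beta> x] by simp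
    show "tame1 (\<lambda>x. ?C * (wt (\<beta> + \<theta>) s x + wt (\<beta> + - \<theta>) s x))"
      by (intro tame1_mult[OF tame1_bounded[of "\<lambda>_. ?C" ?C]] tame1_add tame1_wt) simp
  qed
  also have "\<dots> = ?C\<^sup>2 * quad s (\<lambda>x. wt (\<beta> + \<theta>) s x + wt (\<beta> + - \<theta>) s x)" by (rule quad_cmult)
  also have "\<dots> \<le> ?C\<^sup>2 * (2 * (3 * ?E) + 2 * (3 * ?E))"
    using quad_add[OF s tame1_wt w0 tame1_wt w0, of "\<beta> + \<theta>" "\<beta> + - \<theta>"] Q[of \<theta>] Q[of "- \<theta>"] \<theta>
    by (intro mult_left_mono) auto
  also have "\<dots> = 12 * exp (6 * (s * \<theta>\<^sup>2) - 2 * (\<theta> * W) + 40000 * (b ^ 8 * s))"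
    unfolding exp_double[symmetric] by (simp add: exp_add[symmetric] algebra_simps)
  finally show ?thesis using split mass by simp
qed

end

text \<open>In the variable x = N^(p/4) the polynomial loss N^4 is x^q with q = 16/p, against exp (x
  / 324). The exponent 40006 x - 2 x^2 of the error is at most 0 once x \<ge> 20003.\<close>

lemma supercritical_growth:
  fixes p \<kappa> B :: real
  assumes p: "0 < p" and \<kappa>: "0 < \<kappa>"
  shows "filterlim (\<lambda>N. \<kappa> / real N ^ 4 * (exp (real N powr (p / 4) / 324) / 2 -
      12 * exp (6 * real N powr (p / 4) - 2 * real N powr (p / 2) + 40000 * real N powr (p / 4))) - B) at_top sequentially"
proof -
  define q where "q = 16 / p"
  have q: "0 < q" using p by (simp add: q_def)
  have "filterlim (\<lambda>x::real. \<kappa> / x powr q * (exp (x / 324) / 2 - 12)) at_top at_top"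
    using q \<kappa> by real_asymp
  moreover have "eventually (\<lambda>x::real. \<kappa> / x powr q * (exp (x / 324) / 2 - 12) \<le>
      \<kappa> / x powr q * (exp (x / 324) / 2 - 12 * exp (6 * x - 2 * x\<^sup>2 + 40000 * x))) at_top"
    using eventually_ge_at_top[of 20003]
  proof eventually_elim
    case (elim x)
    have "20003 * x \<le> x * x" using elim by (intro mult_right_mono) auto
    then have "exp (6 * x - 2 * x\<^sup>2 + 40000 * x) \<le> 1" by (simp add: power2_eq_square)
    then show ?case using \<kappa> by (intro mult_left_mono) auto
  qed
  ultimately have *: "filterlim (\<lambda>x::real. \<kappa> / x powr q * (exp (x / 324) / 2 - 12 * exp (6 * x - 2 * x\<^sup>2 + 40000 * x))) at_top at_top"
    by (rule filterlim_at_top_mono)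
  have "filterlim (\<lambda>N. real N powr (p / 4)) at_top sequentially"
    using p by real_asymp
  from filterlim_compose[OF * this]
  have lim: "filterlim (\<lambda>N. - B + \<kappa> / (real N powr (p / 4)) powr q * (exp (real N powr (p / 4) / 324) / 2 -
      12 * exp (6 * real N powr (p / 4) - 2 * (real N powr (p / 4))\<^sup>2 + 40000 * real N powr (p / 4)))) at_top sequentially"
    by (rule filterlim_tendsto_add_at_top[OF tendsto_const])
  have sq: "(real N powr (p / 4))\<^sup>2 = real N powr (p / 2)" for N
    by (simp add: power2_eq_square powr_add[symmetric])
  show ?thesis
  proof (rule filterlim_mono_eventually[OF lim order.refl order.refl])
    show "\<forall>\<^sub>F N in sequentially. - B + \<kappa> / (real N powr (p / 4)) powr q * (exp (real N powr (p / 4) / 324) / 2 -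
      12 * exp (6 * real N powr (p / 4) - 2 * (real N powr (p / 4))\<^sup>2 + 40000 * real N powr (p / 4))) =
      \<kappa> / real N ^ 4 * (exp (real N powr (p / 4) / 324) / 2 -
      12 * exp (6 * real N powr (p / 4) - 2 * real N powr (p / 2) + 40000 * real N powr (p / 4))) - B"
      using eventually_gt_at_top[of 0]
    proof eventually_elim
      case (elim N)
      then have "(real N powr (p / 4)) powr q = real N ^ 4"
        using p powr_realpow[of "real N" 4] by (simp add: powr_powr q_def)
      then show ?case unfolding sq by simp
    qed
  qed
qed

lemma powr_eventually_small:
  fixes a \<epsilon> :: real
  assumes "a < 0" "0 < \<epsilon>"
  shows "eventually (\<lambda>N. real N powr a \<le> \<epsilon>) sequentially"
  using order_tendstoD(2)[OF tendsto_neg_powr[OF assms(1) filterlim_real_sequentially] assms(2)]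
  by (rule eventually_mono) simp

section \<open>Divergence of the variance\<close>

context averaging
begin

text \<open>Monotonicity along the backward flow replaces the second moment at T by the one at the
  earlier time s. There the evolved test function is bounded below by a constant on the window, and
  \<open>window_mass\<close> bounds the mass in it. The squared mean is at most B^2.\<close>

lemma supercritical_bound:
  fixes b \<theta> W s T D q p0 z :: real
  assumes s: "0 < s" "s \<le> T / 2" and b: "0 < b" "5 * b\<^sup>2 \<le> 1" "200 * b ^ 4 \<le> 1" and \<theta>: "0 < \<theta>" "\<theta> \<le> b"
    and \<psi>: "\<And>x. 0 \<le> \<psi> x" "\<And>x. \<psi> x \<le> B" and p0: "0 \<le> p0" "\<And>y. \<bar>of_int y - z\<bar> \<le> 1 \<Longrightarrow> p0 \<le> \<psi> y"
    and D: "W + \<bar>z - T * b\<bar> \<le> D" "0 \<le> D" "D + 3 \<le> T / 4" "12 * (D + 2)\<^sup>2 \<le> q * T"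
  defines "\<beta> \<equiv> arsinh b"
  shows "(p0 * (exp (- q) / (2 * exp 1 * T))\<^sup>2)\<^sup>2 *
      (exp (b ^ 8 * s / 324) / 2 - 12 * exp (6 * (s * \<theta>\<^sup>2) - 2 * (\<theta> * W) + 40000 * (b ^ 8 * s))) - B\<^sup>2 \<le>
    variance (lin T (\<lambda>x. wt \<beta> T x * \<psi> x))"
proof -
  have "b\<^sup>2 \<le> 1" using b(2) by simp
  then have b1: "0 \<le> b" "b \<le> 1" using b(1) by (auto simp: power_le_one_iff abs_square_le_1)
  have sh: "sinh \<beta> = b" by (simp add: \<beta>_def)
  have \<beta>: "0 \<le> \<beta>" using sinh_real_nonneg_iff[of \<beta>] sh b1 by simp
  have T: "0 < T" "12 \<le> T" using s D by linarith+
  have B: "\<bar>\<psi> x\<bar> \<le> B" for x using \<psi>[of x] by simp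
  have w0: "0 \<le> wt \<beta> s x" for s x using wt_pos[of \<beta> s x] by simp
  define r where "r = T - s"
  have r: "T / 2 \<le> r" "r \<le> T" "0 \<le> r" using s T by (auto simp: r_def)
  have exp_b: "exp \<beta> \<le> 3" "1 \<le> exp \<beta>"
  proof -
    have "exp \<beta> = sinh \<beta> + cosh \<beta>" by (simp add: sinh_plus_cosh)
    then show "exp \<beta> \<le> 3" using cosh_arsinh_bounds(3)[OF b1] sh b1 by (simp add: \<beta>_def)
    show "1 \<le> exp \<beta>" using \<beta> by simp
  qed
  define mm mp where "mm = r * exp (- \<beta>) / 2" and "mp = r * exp \<beta> / 2"
  \<comment> \<open>The remaining time is at least T/2 and exp \<beta> \<le> 3. This is the source
    of the factor 12 in the condition on q.\<close>
  have mm: "T / 12 \<le> mm"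
  proof -
    have "1 / 3 \<le> exp (- \<beta>)" using exp_b by (simp add: exp_minus field_simps)
    then have "(T / 2) * (1 / 3) \<le> r * exp (- \<beta>)" using r T by (intro mult_mono) auto
    then show ?thesis by (simp add: mm_def)
  qed
  have mp: "T / 4 \<le> mp" "mp \<le> 3 * T / 2"
  proof -
    have "(T / 2) * 1 \<le> r * exp \<beta>" using r T exp_b by (intro mult_mono) auto
    then show "T / 4 \<le> mp" by (simp add: mp_def)
    have "r * exp \<beta> \<le> T * 3" using r T exp_b by (intro mult_mono) auto
    then show "mp \<le> 3 * T / 2" by (simp add: mp_def)
  qed
  define h where "h = p0 * (exp (- q) / (2 * exp 1 * T))\<^sup>2"
  have h0: "0 \<le> h" using p0 by (simp add: h_def)
  have heat0: "0 \<le> heat \<beta> r \<psi> x" for x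
    by (rule heat_nonneg[where \<psi>=\<psi> and B=B, OF B \<psi>(1) r(3)])
  have heat_near: "h \<le> heat \<beta> r \<psi> x" if x: "\<bar>of_int x - s * b\<bar> \<le> W" for x
  proof -
    have "exp (- q) / (2 * exp 1 * T) \<le> exp (- ((D + 2)\<^sup>2 / mm)) / (exp 1 * (mp + (D + 2)))"
    proof (rule frac_le)
      have "(D + 2)\<^sup>2 / mm \<le> (D + 2)\<^sup>2 / (T / 12)" using mm T by (intro divide_left_mono) auto
      also have "\<dots> \<le> q" using D(4) T by (simp add: divide_le_eq mult_ac)
      finally show "exp (- q) \<le> exp (- ((D + 2)\<^sup>2 / mm))" by simp
      have "mp + (D + 2) \<le> 2 * T" using mp D(3) T by linarith
      then show "exp 1 * (mp + (D + 2)) \<le> 2 * exp 1 * T" by simp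
      show "0 < exp 1 * (mp + (D + 2))" using mp D(2) T by simp
    qed simp
    then have "h \<le> p0 * (exp (- ((D + 2)\<^sup>2 / mm)) / (exp 1 * (mp + (D + 2))))\<^sup>2"
      unfolding h_def using T by (intro mult_left_mono power_mono p0(1)) auto
    also have "\<dots> \<le> heat \<beta> r \<psi> x"
      unfolding mm_def mp_def
    proof (rule heat_window[where \<psi>=\<psi> and B=B and z=z, OF B \<psi>(1) p0 r(3) \<beta>])
      show "1 \<le> r * exp (- \<beta>) / 2" using mm T(2) by (simp add: mm_def)
      show "D + 3 \<le> r * exp \<beta> / 2" using mp D(3) by (simp add: mp_def)
      have "z - of_int x - r * sinh \<beta> = (z - T * b) - (of_int x - s * b)" by (simp add: sh r_def algebra_simps)
      then show "\<bar>z - of_int x - r * sinh \<beta>\<bar> \<le> D" using x D(1) by linarith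
    qed
    finally show ?thesis .
  qed
  let ?near = "\<lambda>x. wt \<beta> s x * of_bool (\<bar>of_int x - s * b\<bar> \<le> W)"
  have "h\<^sup>2 * (exp (b ^ 8 * s / 324) / 2 - 12 * exp (6 * (s * \<theta>\<^sup>2) - 2 * (\<theta> * W) + 40000 * (b ^ 8 * s))) \<le> h\<^sup>2 * quad s ?near"
    unfolding \<beta>_def by (intro mult_left_mono window_mass s b \<theta>) simp
  also have "\<dots> = quad s (\<lambda>x. h * ?near x)" by (rule quad_cmult[symmetric])
  also have "\<dots> \<le> quad s (\<lambda>x. wt \<beta> s x * heat \<beta> r \<psi> x)"
  proof (rule quad_mono[OF s(1)])
    show "tame1 (\<lambda>x. h * ?near x)"
      by (intro tame1_mult[OF tame1_bounded[of "\<lambda>_. h" h]] tame1_mult[OF tame1_wt tame1_bounded[of _ 1]]) (use h0 in auto)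
    show "tame1 (\<lambda>x. wt \<beta> s x * heat \<beta> r \<psi> x)"
      by (intro tame1_mult tame1_wt tame1_bounded[of _ B] heat_bound[where \<psi>=\<psi> and B=B, OF B r(3)])
    show "0 \<le> h * ?near x" for x using h0 w0[of s x] by simp
    show "h * ?near x \<le> wt \<beta> s x * heat \<beta> r \<psi> x" for x
      using mult_left_mono[OF heat_near w0[of s x]] mult_nonneg_nonneg[OF w0[of s x] heat0[of x]] by (simp add: mult_ac)
  qed
  also have "\<dots> \<le> quad T (\<lambda>x. wt \<beta> T x * \<psi> x)"
    unfolding quad_def r_def by (rule second_moment_mono[where \<psi>=\<psi> and B=B, OF T(1) _ _ B]) (use s T in auto)
  finally have lower: "h\<^sup>2 * (exp (b ^ 8 * s / 324) / 2 - 12 * exp (6 * (s * \<theta>\<^sup>2) - 2 * (\<theta> * W) + 40000 * (b ^ 8 * s)))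
      \<le> quad T (\<lambda>x. wt \<beta> T x * \<psi> x)" .
  have "variance (lin T (\<lambda>x. wt \<beta> T x * \<psi> x)) = quad T (\<lambda>x. wt \<beta> T x * \<psi> x) - (heat \<beta> T \<psi> 0)\<^sup>2"
    unfolding mean_formula[where \<psi>=\<psi> and B=B, OF T(1) B, symmetric]
    by (rule variance_lin[OF T(1) tame1_mult[OF tame1_wt tame1_bounded[of _ B, OF B]]]) (use w0 \<psi> in auto)
  moreover have "(heat \<beta> T \<psi> 0)\<^sup>2 \<le> B\<^sup>2"
    using power_mono[OF heat_bound[where \<psi>=\<psi> and B=B and r=T and \<beta>=\<beta> and x=0, OF B] abs_ge_zero, of 2] T by simp
  ultimately show ?thesis using lower unfolding h_def by linarith
qed

lemma tilted_field_square_integrable: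
  assumes "1 \<le> N" "0 < t" and \<phi>: "\<And>u. 0 \<le> \<phi> u" "\<And>u. \<phi> u \<le> B"
  shows "integrable M (\<lambda>\<omega>. (tilted_field \<eta> lam N t \<phi> \<omega>)\<^sup>2)"
  unfolding tilted_field_lin
proof (rule lin_square(1))
  show "0 < t * real N" using assms by simp
  show "tame1 (\<lambda>x. wt (beta lam N) (t * real N) x * \<phi> (real N powr (-1/2) * (of_int x - t * real N powr lam)))"
    by (intro tame1_mult tame1_wt tame1_bounded[of _ B]) (use \<phi> in simp)
  show "0 \<le> wt (beta lam N) (t * real N) x * \<phi> (real N powr (-1/2) * (of_int x - t * real N powr lam))" for x
    using wt_pos[of "beta lam N" "t * real N" x] \<phi> by simp
qed

lemma supercritical_limit:
  assumes t: "0 < t" and lam: "7/8 < lam" "lam < 1"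
    and \<phi>: "\<And>u. 0 \<le> \<phi> u" "\<And>u. \<phi> u \<le> B" "\<phi> u0 \<noteq> 0" and cont: "continuous_on UNIV \<phi>"
  shows "filterlim (\<lambda>N. variance (tilted_field \<eta> lam N t \<phi>)) at_top sequentially"
proof -
  define p where "p = 8 * lam - 7"
  have p: "0 < p" "p < 1" using lam by (auto simp: p_def)
  have pos: "0 < \<phi> u0" using \<phi>(1)[of u0] \<phi>(3) by simp
  obtain \<rho> where \<rho>: "0 < \<rho>" "\<And>u. \<bar>u - u0\<bar> \<le> \<rho> \<Longrightarrow> \<phi> u0 / 2 \<le> \<phi> u"
  proof -
    have "\<exists>d>0. \<forall>u. dist u u0 < d \<longrightarrow> dist (\<phi> u) (\<phi> u0) < \<phi> u0 / 2"
      using cont pos unfolding continuous_on_iff by (meson UNIV_I half_gt_zero)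
    then obtain d where d: "0 < d" "\<And>u. dist u u0 < d \<Longrightarrow> dist (\<phi> u) (\<phi> u0) < \<phi> u0 / 2" by blast
    show ?thesis
    proof (rule that[of "d / 2"])
      show "\<phi> u0 / 2 \<le> \<phi> u" if "\<bar>u - u0\<bar> \<le> d / 2" for u
        using d(2)[of u] that d(1) unfolding dist_real_def by linarith
    qed (use d in simp)
  qed
  \<comment> \<open>The window has half-width W around the drift at time s, and the target lies
    \<open>u0 * W\<close> off the drift at time T; the deviation to be bridged is at most c
    W.\<close>
  define c where "c = 1 + \<bar>u0\<bar>"
  have c: "1 \<le> c" by (simp add: c_def)
  define q where "q = 12 * (c + 2)\<^sup>2 / t"
  define \<kappa> where "\<kappa> = (\<phi> u0 / 2 * (exp (- q) / (2 * exp 1 * t))\<^sup>2)\<^sup>2"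
  have \<kappa>: "0 < \<kappa>" using pos t by (simp add: \<kappa>_def)
  let ?L = "\<lambda>N. \<kappa> / real N ^ 4 * (exp (real N powr (p / 4) / 324) / 2 -
      12 * exp (6 * real N powr (p / 4) - 2 * real N powr (p / 2) + 40000 * real N powr (p / 4))) - B\<^sup>2"
  have ev: "eventually (\<lambda>N. real N powr (lam - 1) \<le> 1/4) sequentially"
    "eventually (\<lambda>N. real N powr (- (3 * p / 4)) \<le> t / 2) sequentially"
    "eventually (\<lambda>N. real N powr (-1/2) \<le> \<rho>) sequentially"
    "eventually (\<lambda>N. real N powr (-1/2) \<le> t / (4 * (c + 3))) sequentially"
    by (rule powr_eventually_small; use lam p t \<rho>(1) c in simp)+
  have "eventually (\<lambda>N. ?L N \<le> variance (tilted_field \<eta> lam N t \<phi>)) sequentially"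
    using eventually_gt_at_top[of 0] ev
  proof eventually_elim
    case (elim N)
    note small = elim(2-5)
    define b where "b = real N powr (lam - 1)"
    \<comment> \<open>The exponents are chosen so that b^8 s and s \<theta>^2 both equal N^(p/4),
      while \<theta> W = N^(p/2) dominates them, and s remains small against N. Moreover \<theta>
      equals b^4, so \<theta> \<le> b.\<close>
    define s where "s = real N powr (1 - 3 * p / 4)"
    define \<theta> where "\<theta> = real N powr (p / 2 - 1/2)"
    define W where "W = real N powr (1/2)"
    define T where "T = t * real N"
    have N: "0 < real N" "1 \<le> real N" using elim(1) by simp_all
    have drift: "t * real N powr lam = T * b"
      unfolding T_def b_def using N powr_add[of "real N" 1 "lam - 1"] by simp
    have W: "1 \<le> W" "W\<^sup>2 = real N" "real N powr (-1/2) * W = 1"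
      unfolding W_def using N by (auto simp: powr_add[symmetric] power2_eq_square ge_one_powr_ge_zero)
    have e1: "b ^ 8 * s = real N powr (p / 4)"
    proof -
      have "b ^ 8 = real N powr (8 * lam - 8)"
        unfolding b_def using N by (simp add: powr_realpow[symmetric] powr_powr algebra_simps del: powr_realpow)
      then show ?thesis unfolding s_def by (simp add: powr_add[symmetric] p_def field_simps)
    qed
    have e2: "\<theta> * W = real N powr (p / 2)" by (simp add: \<theta>_def W_def powr_add[symmetric])
    have e3: "s * \<theta>\<^sup>2 = real N powr (p / 4)"
      unfolding s_def \<theta>_def power2_eq_square powr_add[symmetric] by (simp add: field_simps)
    have "(\<phi> u0 / 2 * (exp (- q) / (2 * exp 1 * T))\<^sup>2)\<^sup>2 *
      (exp (b ^ 8 * s / 324) / 2 - 12 * exp (6 * (s * \<theta>\<^sup>2) - 2 * (\<theta> * W) + 40000 * (b ^ 8 * s))) - B\<^sup>2 \<le>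
      variance (lin T (\<lambda>x. wt (arsinh b) T x * \<phi> (real N powr (-1/2) * (of_int x - T * b))))"
    proof (rule supercritical_bound[where z="T * b + u0 * W" and D="c * W" and \<psi>="\<lambda>x. \<phi> (real N powr (-1/2) * (of_int x - T * b))"])
      show "0 < s" "0 < b" "0 < \<theta>" using N by (simp_all add: s_def b_def \<theta>_def)
      have "b \<le> 1/4" "0 \<le> b" using small(1) by (simp_all add: b_def)
      then show "5 * b\<^sup>2 \<le> 1" "200 * b ^ 4 \<le> 1"
        using power_mono[of b "1/4" 2] power_mono[of b "1/4" 4] by (simp_all add: power_divide)
      have "s = real N * real N powr (- (3 * p / 4))"
        unfolding s_def using N powr_add[of "real N" 1 "- (3 * p / 4)"] by simp
      also have "\<dots> \<le> real N * (t / 2)" by (intro mult_left_mono small(2)) simp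
      finally show "s \<le> T / 2" by (simp add: T_def mult_ac)
      have "c * W + 3 \<le> (c + 3) * W" using W(1) by (simp add: algebra_simps)
      also have "\<dots> = (c + 3) * (real N powr (-1/2) * W\<^sup>2)" using W(3) by (simp add: power2_eq_square)
      also have "\<dots> \<le> (c + 3) * (t / (4 * (c + 3)) * W\<^sup>2)"
        by (intro mult_left_mono mult_right_mono small(4)) (simp_all add: c_def)
      also have "\<dots> = T / 4" unfolding W(2) T_def by (simp add: c_def add_eq_0_iff field_simps)
      finally show "c * W + 3 \<le> T / 4" .
      show "\<theta> \<le> b" unfolding \<theta>_def b_def using N lam by (intro powr_mono) (simp_all add: p_def field_simps)
      show "0 \<le> \<phi> u0 / 2" using pos by simp
      show "0 \<le> \<phi> (real N powr (-1/2) * (of_int x - T * b))" "\<phi> (real N powr (-1/2) * (of_int x - T * b)) \<le> B" for x :: int by (rule \<phi>)+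
      show "\<phi> u0 / 2 \<le> \<phi> (real N powr (-1/2) * (of_int y - T * b))" if y: "\<bar>of_int y - (T * b + u0 * W)\<bar> \<le> 1" for y :: int
      proof (rule \<rho>(2))
        have "real N powr (-1/2) * (of_int y - T * b) - u0 * (real N powr (-1/2) * W) = real N powr (-1/2) * (of_int y - (T * b + u0 * W))"
          by (simp add: algebra_simps)
        then have "\<bar>real N powr (-1/2) * (of_int y - T * b) - u0\<bar> = real N powr (-1/2) * \<bar>of_int y - (T * b + u0 * W)\<bar>"
          unfolding W(3) by (simp add: abs_mult)
        also have "\<dots> \<le> real N powr (-1/2) * 1" by (intro mult_left_mono y) simp
        also have "\<dots> \<le> \<rho>" using small(3) by simp
        finally show "\<bar>real N powr (-1/2) * (of_int y - T * b) - u0\<bar> \<le> \<rho>" .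
      qed
      show "W + \<bar>T * b + u0 * W - T * b\<bar> \<le> c * W" using W(1) by (simp add: c_def abs_mult algebra_simps)
      show "0 \<le> c * W" using W(1) by (simp add: c_def)
      have "(c * W + 2)\<^sup>2 \<le> ((c + 2) * W)\<^sup>2"
        using W(1) by (intro power_mono) (auto simp: c_def algebra_simps)
      then show "12 * (c * W + 2)\<^sup>2 \<le> q * T"
        using t by (simp add: q_def T_def power_mult_distrib W(2))
    qed
    \<comment> \<open>Two Poisson weights, each of order 1/T, enter the lower bound of the heat
      flow, and the bound is squared in the second moment; this gives the factor N^(-4).\<close>
    moreover have "(\<phi> u0 / 2 * (exp (- q) / (2 * exp 1 * T))\<^sup>2)\<^sup>2 = \<kappa> / real N ^ 4"
      unfolding \<kappa>_def T_def using N by (simp add: power_divide power_mult_distrib power_mult[symmetric])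
    moreover have "tilted_field \<eta> lam N t \<phi> = lin T (\<lambda>x. wt (arsinh b) T x * \<phi> (real N powr (-1/2) * (of_int x - T * b)))"
      unfolding tilted_field_lin drift by (simp add: T_def b_def beta_def)
    ultimately show ?case unfolding e1 e2 e3 by simp
  qed
  then show ?thesis
    by (rule filterlim_at_top_mono[OF supercritical_growth[OF p(1) \<kappa>]])
qed

end

theorem theorem1p3:
  fixes M :: "'w measure" and K :: "int \<Rightarrow> real \<Rightarrow> 'w \<Rightarrow> nat"
    and \<eta> :: "real \<Rightarrow> int \<Rightarrow> 'w \<Rightarrow> real"
    and lam t :: real and \<phi> :: "real \<Rightarrow> real"
  assumes "averaging_process M K (\<lambda>x. if x = 0 then 1 else 0) \<eta>"
    and "lam < 1" and "lam \<noteq> 7/8"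
    and "t > 0"
    and "\<And>u. \<phi> u \<ge> 0" and "\<exists>u. \<phi> u \<noteq> 0"
    and "bounded (range \<phi>)" and "continuous_on UNIV \<phi>"
  shows "(\<forall>N\<ge>1. integrable M (\<lambda>\<omega>. (tilted_field \<eta> lam N t \<phi> \<omega>)\<^sup>2)) \<and>
         (\<lambda>N. ereal (prob_space.variance M (tilted_field \<eta> lam N t \<phi>)))
           \<longlonglongrightarrow> (if lam < 7/8 then 0 else \<infinity>)"
proof -
  have "prob_space M"
    using assms(1) by (auto simp: averaging_process_def poisson_clocks_def poisson_process_def)
  then interpret averaging M K \<eta>
    using assms(1) by (simp add: averaging_def averaging_axioms_def)
  obtain B where "\<And>u. \<bar>\<phi> u\<bar> \<le> B" using assms(7) by (auto simp: bounded_iff)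
  then have B: "\<And>u. \<phi> u \<le> B" by (auto intro: order.trans[OF abs_ge_self])
  obtain u0 where u0: "\<phi> u0 \<noteq> 0" using assms(6) by blast
  have "(\<lambda>N. ereal (variance (tilted_field \<eta> lam N t \<phi>))) \<longlonglongrightarrow> (if lam < 7/8 then 0 else \<infinity>)"
  proof (cases "lam < 7/8")
    case True
    then show ?thesis
      using subcritical_limit[OF assms(4) True assms(5) B assms(8)] by (simp add: zero_ereal_def)
  next
    case False
    then have "7/8 < lam" using assms(3) by simp
    from supercritical_limit[OF assms(4) this assms(2,5) B u0 assms(8)] show ?thesis
      using False by (simp add: tendsto_PInfty_eq_at_top)
  qed
  then show ?thesis
    using tilted_field_square_integrable[where \<phi>=\<phi> and B=B, OF _ assms(4,5) B] by blast
qed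

end
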